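(* Let $x_0>0$ and $L>0$. (i) $\mathcal F$ admits a vertically symmetric area-preserving critical point $\gamma$ parametrized by arc length on $[0,2L]$ (i.e. of length $2L$) if and only if $3x_0<L$; in that case $\gamma=\gamma(x_0,L)$, and it is unique. (ii) For $\lambda\in\mathbb R$, $\mathcal F-\lambda\mathcal A$ admits a vertically symmetric critical point $\gamma$ parametrized by arc length on $[0,2L]$ if and only if $3x_0<L$ and $\lambda=\lambda(x_0,L)=\frac{2L}{L+x_0}$; in that case $\gamma=\gamma(x_0,L)$, and it is unique.
   Context: Notation: $(\xi,\eta)^\perp=(\eta,-\xi)$; for a regular curve $\gamma\in C^2([0,2L],\mathbb R^2)$, curvature $H=\langle\dot\gamma,\ddot\gamma^\perp\rangle/|\dot\gamma|^3$, normal $N=\dot\gamma^\perp/|\dot\gamma|$; strictly counterclockwise means $H>0$. A curve $\gamma=(x,y)$ is admissible if $\gamma\in C^\infty([0,2L],\mathbb R^2)$ is regular, strictly counterclockwise, injective, $\gamma(0)=(x_0,0)$, $\gamma(2L)=(-x_0,0)$, $y>0$ on $(0,2L)$. $\mathcal A(\gamma)=\frac12\int_0^{2L}(x\dot y-\dot xy)\,ds$, $\mathcal F(\gamma)=\int_0^{2L}|\dot\gamma|H^{-1}\,ds$. Vertically symmetric: support symmetric with respect to $\{x=0\}$. An admissible (resp. one-sided admissible) variation is a smooth $\mathcal V:[0,2L]\times[-t_{\mathcal V},t_{\mathcal V}]\to\mathbb R^2$ (resp. on $[0,2L]\times[0,t_{\mathcal V}]$) with $\mathcal V(\cdot,0)=\gamma$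 and each $\mathcal V(\cdot,t)$ admissible; it is area-preserving if $\mathcal A(\mathcal V(\cdot,t))$ is constant in $t$. An admissible $\gamma$ is an area-preserving critical point of $\mathcal F$ if $\frac d{dt}\mathcal F(\mathcal V(\cdot,t))|_{t=0}=0$ for every area-preserving admissible variation and the right derivative at $0$ is $\ge0$ for every area-preserving one-sided admissible variation. It is a critical point of $\mathcal F-\lambda\mathcal A$ if $\frac d{dt}(\mathcal F-\lambda\mathcal A)(\mathcal V(\cdot,t))|_{t=0}=0$ for every admissible variation and the right derivative is $\ge0$ for every one-sided admissible variation. For $0<3x_0<L$: with $\sigma=\pi\sqrt{x_0/(L+x_0)}$, $k=L/\sin\sigma$, $a(s)=\arcsin((s-L)/k)$, the curve $\gamma(x_0,L)=(x,y)$ on $[0,2L]$ is $x(s)=-\frac k2\big(\frac{\sigma}{\pi+\sigma}\sin(\tfrac{\pi+\sigma}{\sigma}a(s))+\frac{\sigma}{\pi-\sigma}\sin(\tfrac{\pi-\sigma}{\sigma}a(s))\big)$, $y(s)=\frac k2\big(\frac{\sigma}{\pi+\sigma}\cos(\tfrac{\pi+\sigma}{\sigma}a(s))+\frac{\sigma}{\pi-\sigma}\cos(\tfrac{\pi-\sigma}{\sigma}a(s))\big)+\frac{\pi x_0}{\sigma\tan\sigma}$. *)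

theory Defs
  imports "HOL-Analysis.Analysis"
begin

text \<open>C-infinity on a set S (one-sided derivatives at boundary points): there is a family
  of iterated directional derivatives D n x [v1,...,vn], each being the (Frechet) derivative
  within S of the previous one.\<close>
definition Cinf_on :: "'a::real_normed_vector set \<Rightarrow> ('a \<Rightarrow> 'b::real_normed_vector) \<Rightarrow> bool" where
  "Cinf_on S f \<longleftrightarrow>
     (\<exists>D :: nat \<Rightarrow> 'a \<Rightarrow> 'a list \<Rightarrow> 'b.
        (\<forall>x\<in>S. D 0 x [] = f x) \<and>
        (\<forall>n vs x. length vs = n \<and> x \<in> S \<longrightarrow>
           ((\<lambda>z. D n z vs) has_derivative (\<lambda>h. D (Suc n) x (h # vs))) (at x within S)))"

definition perp :: "real \<times> real \<Rightarrow> real \<times> real" where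
  "perp v = (snd v, - fst v)"

definition dvec :: "real \<Rightarrow> (real \<Rightarrow> real \<times> real) \<Rightarrow> real \<Rightarrow> real \<times> real" where
  "dvec L \<gamma> s = vector_derivative \<gamma> (at s within {0..2*L})"

definition ddvec :: "real \<Rightarrow> (real \<Rightarrow> real \<times> real) \<Rightarrow> real \<Rightarrow> real \<times> real" where
  "ddvec L \<gamma> s = vector_derivative (dvec L \<gamma>) (at s within {0..2*L})"

definition curv :: "real \<Rightarrow> (real \<Rightarrow> real \<times> real) \<Rightarrow> real \<Rightarrow> real" where
  "curv L \<gamma> s = inner (dvec L \<gamma> s) (perp (ddvec L \<gamma> s)) / norm (dvec L \<gamma> s) ^ 3"

definition admissible :: "real \<Rightarrow> real \<Rightarrow> (real \<Rightarrow> real \<times> real) \<Rightarrow> bool" where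
  "admissible x0 L \<gamma> \<longleftrightarrow>
     Cinf_on {0..2*L} \<gamma> \<and>
     (\<forall>s\<in>{0..2*L}. dvec L \<gamma> s \<noteq> 0) \<and>
     (\<forall>s\<in>{0..2*L}. curv L \<gamma> s > 0) \<and>
     inj_on \<gamma> {0..2*L} \<and>
     \<gamma> 0 = (x0, 0) \<and> \<gamma> (2*L) = (-x0, 0) \<and>
     (\<forall>s\<in>{0<..<2*L}. snd (\<gamma> s) > 0)"

definition area :: "real \<Rightarrow> (real \<Rightarrow> real \<times> real) \<Rightarrow> real" where
  "area L \<gamma> = 1/2 * integral {0..2*L}
     (\<lambda>s. fst (\<gamma> s) * snd (dvec L \<gamma> s) - fst (dvec L \<gamma> s) * snd (\<gamma> s))"

definition Ffun :: "real \<Rightarrow> (real \<Rightarrow> real \<times> real) \<Rightarrow> real" where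
  "Ffun L \<gamma> = integral {0..2*L} (\<lambda>s. norm (dvec L \<gamma> s) * inverse (curv L \<gamma> s))"

definition vert_sym :: "real \<Rightarrow> (real \<Rightarrow> real \<times> real) \<Rightarrow> bool" where
  "vert_sym L \<gamma> \<longleftrightarrow> (\<forall>p\<in>\<gamma> ` {0..2*L}. (- fst p, snd p) \<in> \<gamma> ` {0..2*L})"

definition arclength :: "real \<Rightarrow> (real \<Rightarrow> real \<times> real) \<Rightarrow> bool" where
  "arclength L \<gamma> \<longleftrightarrow> (\<forall>s\<in>{0..2*L}. norm (dvec L \<gamma> s) = 1)"

text \<open>A variation V(s,t), t ranging over J (J = [-T,T] two-sided, J = [0,T] one-sided).\<close>
definition is_variation :: "real \<Rightarrow> real \<Rightarrow> (real \<Rightarrow> real \<times> real) \<Rightarrow> (real \<Rightarrow> real \<Rightarrow> real \<times> real) \<Rightarrow> real set \<Rightarrow> bool" where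
  "is_variation x0 L \<gamma> V J \<longleftrightarrow>
     Cinf_on ({0..2*L} \<times> J) (\<lambda>p. V (fst p) (snd p)) \<and>
     (\<forall>s\<in>{0..2*L}. V s 0 = \<gamma> s) \<and>
     (\<forall>t\<in>J. admissible x0 L (\<lambda>s. V s t))"

definition area_preserving :: "real \<Rightarrow> (real \<Rightarrow> real \<Rightarrow> real \<times> real) \<Rightarrow> real set \<Rightarrow> bool" where
  "area_preserving L V J \<longleftrightarrow> (\<forall>t\<in>J. area L (\<lambda>s. V s t) = area L (\<lambda>s. V s 0))"

definition area_crit :: "real \<Rightarrow> real \<Rightarrow> (real \<Rightarrow> real \<times> real) \<Rightarrow> bool" where
  "area_crit x0 L \<gamma> \<longleftrightarrow> admissible x0 L \<gamma> \<and>
     (\<forall>V T. T > 0 \<and> is_variation x0 L \<gamma> V {-T..T} \<and> area_preserving L V {-T..T} \<longrightarrow>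
        ((\<lambda>t. Ffun L (\<lambda>s. V s t)) has_real_derivative 0) (at 0 within {-T..T})) \<and>
     (\<forall>V T. T > 0 \<and> is_variation x0 L \<gamma> V {0..T} \<and> area_preserving L V {0..T} \<longrightarrow>
        (\<exists>d\<ge>0. ((\<lambda>t. Ffun L (\<lambda>s. V s t)) has_real_derivative d) (at 0 within {0..T})))"

definition lagr_crit :: "real \<Rightarrow> real \<Rightarrow> real \<Rightarrow> (real \<Rightarrow> real \<times> real) \<Rightarrow> bool" where
  "lagr_crit x0 L lam \<gamma> \<longleftrightarrow> admissible x0 L \<gamma> \<and>
     (\<forall>V T. T > 0 \<and> is_variation x0 L \<gamma> V {-T..T} \<longrightarrow>
        ((\<lambda>t. Ffun L (\<lambda>s. V s t) - lam * area L (\<lambda>s. V s t)) has_real_derivative 0) (at 0 within {-T..T})) \<and>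
     (\<forall>V T. T > 0 \<and> is_variation x0 L \<gamma> V {0..T} \<longrightarrow>
        (\<exists>d\<ge>0. ((\<lambda>t. Ffun L (\<lambda>s. V s t) - lam * area L (\<lambda>s. V s t)) has_real_derivative d) (at 0 within {0..T})))"

definition gamma0 :: "real \<Rightarrow> real \<Rightarrow> real \<Rightarrow> real \<times> real" where
  "gamma0 x0 L s =
    (let \<sigma> = pi * sqrt (x0 / (L + x0)); k = L / sin \<sigma>; a = arcsin ((s - L) / k) in
     (- k / 2 * (\<sigma> / (pi + \<sigma>) * sin ((pi + \<sigma>) / \<sigma> * a) + \<sigma> / (pi - \<sigma>) * sin ((pi - \<sigma>) / \<sigma> * a)),
      k / 2 * (\<sigma> / (pi + \<sigma>) * cos ((pi + \<sigma>) / \<sigma> * a) + \<sigma> / (pi - \<sigma>) * cos ((pi - \<sigma>) / \<sigma> * a))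
        + pi * x0 / (\<sigma> * tan \<sigma>)))"

end

theory Submission
  imports Defs
begin

text \<open>
  Let \<open>T\<close> be the tangent and \<open>n\<close> the inner normal of a unit speed curve, let \<open>H\<close> be its curvature,
  and put \<open>g = 1/H\<^sup>2\<close>.  For a variation field \<open>\<eta>\<close> vanishing at the endpoints, two
  integrations by parts give
    \<open>\<delta>F = g n \<bullet> \<eta>' (0) - g n \<bullet> \<eta>' (2L) - \<integral> (2 + g'') n \<bullet> \<eta>\<close>  and  \<open>\<delta>A = - \<integral> n \<bullet> \<eta>\<close>.
  Variations \<open>\<gamma> + t f e\<close> in a fixed direction \<open>e\<close> change the area affinely in \<open>t\<close>, so the area
  constraint is linear on them; taking for \<open>f\<close> polynomials that vanish to second order at the ends and using
  the Weierstrass approximation theorem one gets \<open>g'' = \<lambda> - 2\<close>.  If the curve met the axis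
  transversally, the slope of \<open>f\<close> there would be free, contradicting \<open>g > 0\<close>; so the curve is
  tangent to the axis at both ends.

  The vector \<open>2 H\<^sup>-\<^sup>1 T + g' n - \<lambda> J \<gamma>\<close> (with \<open>J\<close> the rotation by a right angle) is then constant
  along the curve.  Comparing the ends shows that \<open>g\<close> is symmetric about \<open>L\<close> and that
  \<open>\<lambda> = 2L/(L + x0)\<close>, so \<open>H\<close> is the derivative of a multiple of \<open>arcsin ((s - L)/k)\<close>.  The total turning
  is \<open>2 m \<pi>\<close>, and injectivity forces \<open>m = 1\<close>, which is \<open>\<gamma>(x0, L)\<close> with \<open>3 x0 < L\<close>.
  Conversely, for that curve \<open>\<delta>(F - \<lambda>A)\<close> reduces to the boundary terms, whose sign is determined by
  \<open>y > 0\<close>.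
\<close>

section \<open>Smooth functions on closed domains\<close>

text \<open>Testing in a fixed direction e rather than along the normal makes both the numerator of
  the curvature and the area exactly affine in t, as every quadratic term carries the cross product
  of e with itself. An area constraint can therefore be met by subtracting a multiple of one
  reference weight, with no implicit function argument. The obstacle is the condition y > 0:
  \<open>\<gamma> + t f e\<close> has to stay above the axis for both signs of t, so |f| must be
  bounded by a multiple of y, and y may vanish quadratically at an endpoint. Hence the weights s^i
  (2L - s)^j r(s) with i, j in {1, 2}, where order 1 is available only at a transversal end. The
  vertical direction alone yields the Euler-Lagrange equation, because the zeros of the horizontal
  tangent component are isolated. The conserved vector is the Noether integral belonging to
  translations. The bound 3 x0 < L comes from turning by exactly 2 \<pi>: the half range of the
  arcsine is then \<pi> sqrt(x0 / (L + x0)), and it must lie below \<pi>/2.\<close>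

lemma has_real_derivative_transform:
  assumes "x \<in> S" "\<And>y. y \<in> S \<Longrightarrow> g y = f y" "(f has_real_derivative f') (at x within S)"
  shows "(g has_real_derivative f') (at x within S)"
  using assms(3) has_derivative_transform[OF assms(1), where g = g and f = f] assms(2)
  unfolding has_field_derivative_def by blast

text \<open>Smoothness behaves like a greatest fixed point: once each member of a class has all its
  directional derivatives in that class, fixing one derivative per member and iterating over the
  list of directions produces the family \<open>D\<close>. Later smoothness proofs then only have to
  exhibit such a class.\<close>

lemma Cinf_on_coinduct:
  fixes P :: "('a::real_normed_vector \<Rightarrow> 'b::real_normed_vector) \<Rightarrow> bool"
  assumes "P f"
    and step: "\<And>f. P f \<Longrightarrow> \<exists>f'. (\<forall>x\<in>S. (f has_derivative f' x) (at x within S)) \<and> (\<forall>h. P (\<lambda>x. f' x h))"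
  shows "Cinf_on S f"
proof -
  obtain d where d: "\<And>f. P f \<Longrightarrow> (\<forall>x\<in>S. (f has_derivative d f x) (at x within S)) \<and> (\<forall>h. P (\<lambda>x. d f x h))"
    using step by metis
  \<comment> \<open>The innermost derivative belongs to the last entry of the list, in agreement
    with \<open>h # vs\<close> in \<open>Cinf_on\<close>.\<close>
  define F where "F = rec_list f (\<lambda>h vs G. (\<lambda>x. d G x h))"
  have F: "F [] = f" "\<And>h vs. F (h # vs) = (\<lambda>x. d (F vs) x h)"
    by (simp_all add: F_def)
  have P: "P (F vs)" for vs
    by (induction vs) (use F d \<open>P f\<close> in auto)
  show ?thesis
    unfolding Cinf_on_def
    by (rule exI[of _ "\<lambda>n x vs. F vs x"]) (use F d P in auto)
qed

lemma Cinf_on_derivative: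
  assumes "Cinf_on S f"
  obtains f' where "\<And>x. x \<in> S \<Longrightarrow> (f has_derivative f' x) (at x within S)"
    and "\<And>h. Cinf_on S (\<lambda>x. f' x h)"
proof -
  obtain D where D0: "\<And>x. x \<in> S \<Longrightarrow> D 0 x [] = f x"
    and D: "\<And>n vs x. length vs = n \<Longrightarrow> x \<in> S \<Longrightarrow>
        ((\<lambda>z. D n z vs) has_derivative (\<lambda>h. D (Suc n) x (h # vs))) (at x within S)"
    using assms unfolding Cinf_on_def by blast
  show ?thesis
  proof
    fix x assume "x \<in> S"
    have "((\<lambda>z. D 0 z []) has_derivative (\<lambda>h. D 1 x [h])) (at x within S)"
      using D[of "[]" 0 x] \<open>x \<in> S\<close> by simp
    then show "(f has_derivative (\<lambda>h. D 1 x [h])) (at x within S)"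
      by (rule has_derivative_transform[OF \<open>x \<in> S\<close>, rotated]) (simp add: D0)
  next
    fix h
    show "Cinf_on S (\<lambda>x. D 1 x [h])"
      unfolding Cinf_on_def
      \<comment> \<open>Later directions are consed in front, so the direction h of the first
        differentiation has to stand at the end of the list.\<close>
      by (rule exI[of _ "\<lambda>n x vs. D (Suc n) x (vs @ [h])"]) (use D[of "_ @ [h]"] in auto)
  qed
qed

lemma Cinf_on_continuous_on: "Cinf_on S f \<Longrightarrow> continuous_on S f"
  by (metis Cinf_on_derivative has_derivative_continuous_on)

lemma Cinf_on_linear:
  assumes "bounded_linear l" "Cinf_on S f"
  shows "Cinf_on S (\<lambda>x. l (f x))"
proof (rule Cinf_on_coinduct[where P = "\<lambda>g. \<exists>f. Cinf_on S f \<and> g = (\<lambda>x. l (f x))"])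
  fix g assume "\<exists>f. Cinf_on S f \<and> g = (\<lambda>x. l (f x))"
  then obtain f where f: "Cinf_on S f" and g: "g = (\<lambda>x. l (f x))" by blast
  obtain f' where f': "\<And>x. x \<in> S \<Longrightarrow> (f has_derivative f' x) (at x within S)"
    "\<And>h. Cinf_on S (\<lambda>x. f' x h)"
    using Cinf_on_derivative[OF f] by blast
  show "\<exists>g'. (\<forall>x\<in>S. (g has_derivative g' x) (at x within S)) \<and>
      (\<forall>h. \<exists>f. Cinf_on S f \<and> (\<lambda>x. g' x h) = (\<lambda>x. l (f x)))"
    unfolding g
    by (rule exI[of _ "\<lambda>x h. l (f' x h)"])
      (use f' bounded_linear.has_derivative[OF assms(1)] in blast)
qed (use assms in auto)

lemma Cinf_on_Pair:
  assumes "Cinf_on S f" "Cinf_on S g"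
  shows "Cinf_on S (\<lambda>x. (f x, g x))"
proof (rule Cinf_on_coinduct[where P = "\<lambda>F. \<exists>f g. Cinf_on S f \<and> Cinf_on S g \<and> F = (\<lambda>x. (f x, g x))"])
  fix F assume "\<exists>f g. Cinf_on S f \<and> Cinf_on S g \<and> F = (\<lambda>x. (f x, g x))"
  then obtain f g where f: "Cinf_on S f" and g: "Cinf_on S g" and F: "F = (\<lambda>x. (f x, g x))" by blast
  obtain f' where f': "\<And>x. x \<in> S \<Longrightarrow> (f has_derivative f' x) (at x within S)"
    "\<And>h. Cinf_on S (\<lambda>x. f' x h)"
    using Cinf_on_derivative[OF f] by blast
  obtain g' where g': "\<And>x. x \<in> S \<Longrightarrow> (g has_derivative g' x) (at x within S)"
    "\<And>h. Cinf_on S (\<lambda>x. g' x h)"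
    using Cinf_on_derivative[OF g] by blast
  show "\<exists>F'. (\<forall>x\<in>S. (F has_derivative F' x) (at x within S)) \<and>
      (\<forall>h. \<exists>f g. Cinf_on S f \<and> Cinf_on S g \<and> (\<lambda>x. F' x h) = (\<lambda>x. (f x, g x)))"
    unfolding F
    by (rule exI[of _ "\<lambda>x h. (f' x h, g' x h)"])
      (use f' g' has_derivative_Pair in blast)
qed (use assms in auto)

lemma Cinf_on_real_derivative:
  fixes f :: "real \<Rightarrow> real"
  assumes "Cinf_on S f"
  obtains f1 where "Cinf_on S f1"
    and "\<And>s. s \<in> S \<Longrightarrow> (f has_real_derivative f1 s) (at s within S)"
proof -
  obtain f' where f': "\<And>x. x \<in> S \<Longrightarrow> (f has_derivative f' x) (at x within S)"
    "\<And>h. Cinf_on S (\<lambda>x. f' x h)"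
    using Cinf_on_derivative[OF assms] by blast
  show ?thesis
  proof
    show "Cinf_on S (\<lambda>s. f' s 1)" by (rule f')
    fix s assume "s \<in> S"
    then have d: "(f has_derivative f' s) (at s within S)" by (rule f')
    have "f' s c = f' s 1 * c" for c
      using linear_scale[OF has_derivative_linear[OF d], of c 1] by simp
    then have "f' s = (*) (f' s 1)"
      by (rule ext)
    then show "(f has_real_derivative f' s 1) (at s within S)"
      using d unfolding has_field_derivative_def by simp
  qed
qed

text \<open>The partial derivatives are the total derivative applied to (1, 0) and (0, 1).
  Restricting it to the two slices through a point keeps the derivatives one-sided on the boundary
  of the rectangle.\<close>

lemma Cinf_on_partials:
  fixes W :: "real \<times> real \<Rightarrow> real"
  assumes "Cinf_on (I \<times> J) W"
  obtains Ws Wt where "Cinf_on (I \<times> J) Ws" and "Cinf_on (I \<times> J) Wt"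
    and "\<And>s t. s \<in> I \<Longrightarrow> t \<in> J \<Longrightarrow> ((\<lambda>s. W (s, t)) has_real_derivative Ws (s, t)) (at s within I)"
    and "\<And>s t. s \<in> I \<Longrightarrow> t \<in> J \<Longrightarrow> ((\<lambda>t. W (s, t)) has_real_derivative Wt (s, t)) (at t within J)"
proof -
  obtain W' where W': "\<And>x. x \<in> I \<times> J \<Longrightarrow> (W has_derivative W' x) (at x within I \<times> J)"
    "\<And>h. Cinf_on (I \<times> J) (\<lambda>x. W' x h)"
    using Cinf_on_derivative[OF assms] by blast
  have lin: "(\<lambda>c. W' p (c, 0)) = (*) (W' p (1, 0))" "(\<lambda>c. W' p (0, c)) = (*) (W' p (0, 1))"
    if "p \<in> I \<times> J" for p
  proof -
    have "W' p (c, 0) = W' p (1, 0) * c" "W' p (0, c) = W' p (0, 1) * c" for c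
      using linear_scale[OF has_derivative_linear[OF W'(1)[OF that]], of c "(1, 0)"]
        linear_scale[OF has_derivative_linear[OF W'(1)[OF that]], of c "(0, 1)"]
      by (simp_all del: mult_cancel_left1)
    note l = this
    show "(\<lambda>c. W' p (c, 0)) = (*) (W' p (1, 0))"
      by (rule ext) (rule l)
    show "(\<lambda>c. W' p (0, c)) = (*) (W' p (0, 1))"
      by (rule ext) (rule l)
  qed
  show ?thesis
  proof
    show "Cinf_on (I \<times> J) (\<lambda>p. W' p (1, 0))" "Cinf_on (I \<times> J) (\<lambda>p. W' p (0, 1))" by (rule W')+
    fix s t assume st: "s \<in> I" "t \<in> J"
    have "((\<lambda>s. W (s, t)) has_derivative (\<lambda>h. W' (s, t) (h, 0))) (at s within I)"
    proof (rule has_derivative_in_compose[where f = "\<lambda>s. (s, t)"])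
      show "((\<lambda>s. (s, t)) has_derivative (\<lambda>h. (h, 0))) (at s within I)"
        by (auto intro!: derivative_eq_intros)
      show "(W has_derivative W' (s, t)) (at (s, t) within (\<lambda>s. (s, t)) ` I)"
        by (rule has_derivative_subset[OF W'(1)]) (use st in auto)
    qed
    then show "((\<lambda>s. W (s, t)) has_real_derivative W' (s, t) (1, 0)) (at s within I)"
      unfolding has_field_derivative_def using lin(1)[of "(s, t)"] st by simp
    have "((\<lambda>t. W (s, t)) has_derivative (\<lambda>h. W' (s, t) (0, h))) (at t within J)"
    proof (rule has_derivative_in_compose[where f = "\<lambda>t. (s, t)"])
      show "((\<lambda>t. (s, t)) has_derivative (\<lambda>h. (0, h))) (at t within J)"
        by (auto intro!: derivative_eq_intros)
      show "(W has_derivative W' (s, t)) (at (s, t) within (\<lambda>t. (s, t)) ` J)"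
        by (rule has_derivative_subset[OF W'(1)]) (use st in auto)
    qed
    then show "((\<lambda>t. W (s, t)) has_real_derivative W' (s, t) (0, 1)) (at t within J)"
      unfolding has_field_derivative_def using lin(2)[of "(s, t)"] st by simp
  qed
qed

text \<open>A Schwarz theorem up to the boundary. W is recovered by integrating \<open>Ws\<close>
  from 0 to r, differentiation in t is moved under that integral, and the result is differentiated
  in r; the argument rests on the continuity of \<open>Wst\<close> on the closed rectangle.\<close>

lemma mixed_partials:
  fixes W :: "real \<times> real \<Rightarrow> real"
  assumes "M > 0" and J: "J = {c..d}" "c < d"
    and Ws: "\<And>s t. s \<in> {0..M} \<Longrightarrow> t \<in> J \<Longrightarrow> ((\<lambda>s. W (s, t)) has_real_derivative Ws (s, t)) (at s within {0..M})"
    and Wt: "\<And>s t. s \<in> {0..M} \<Longrightarrow> t \<in> J \<Longrightarrow> ((\<lambda>t. W (s, t)) has_real_derivative Wt (s, t)) (at t within J)"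
    and Wst: "\<And>s t. s \<in> {0..M} \<Longrightarrow> t \<in> J \<Longrightarrow> ((\<lambda>t. Ws (s, t)) has_real_derivative Wst (s, t)) (at t within J)"
    and contWs: "continuous_on ({0..M} \<times> J) Ws"
    and cont: "continuous_on ({0..M} \<times> J) Wst"
    and "s \<in> {0..M}" "t \<in> J"
  shows "((\<lambda>s. Wt (s, t)) has_real_derivative Wst (s, t)) (at s within {0..M})"
proof -
  have eq: "Wt (r, t) = Wt (0, t) + integral {0..r} (\<lambda>s. Wst (s, t))" if r: "r \<in> {0..M}" for r
  proof -
    have int: "((\<lambda>s. Ws (s, u)) has_integral W (r, u) - W (0, u)) {0..r}" if "u \<in> J" for u
    proof (rule fundamental_theorem_of_calculus)
      show "0 \<le> r" using r by simp
      fix s assume "s \<in> {0..r}"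
      then show "((\<lambda>s. W (s, u)) has_vector_derivative Ws (s, u)) (at s within {0..r})"
        unfolding has_real_derivative_iff_has_vector_derivative[symmetric]
        by (intro DERIV_subset[OF Ws]) (use r that in auto)
    qed
    have "((\<lambda>u. integral (cbox 0 r) (\<lambda>s. Ws (s, u))) has_real_derivative
        integral (cbox 0 r) (\<lambda>s. Wst (s, t))) (at t within J)"
    proof (rule leibniz_rule_field_derivative)
      show "continuous_on (J \<times> cbox 0 r) (\<lambda>(x, t). Wst (t, x))"
      proof -
        have "continuous_on (J \<times> cbox 0 r) (Wst \<circ> prod.swap)"
          by (intro continuous_on_compose continuous_intros continuous_on_swap continuous_on_subset[OF cont])
            (use r in auto)
        then show ?thesis by (simp add: comp_def case_prod_unfold prod.swap_def)
      qed
      show "convex J" using J by simp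
      show "(\<lambda>s. Ws (s, u)) integrable_on cbox 0 r" if "u \<in> J" for u
        using int[OF that] by (auto intro: has_integral_integrable)
    qed (use \<open>t \<in> J\<close> r in \<open>auto intro!: Wst\<close>)
    then have "((\<lambda>u. W (r, u) - W (0, u)) has_real_derivative
        integral {0..r} (\<lambda>s. Wst (s, t))) (at t within J)"
      unfolding cbox_interval by (rule has_real_derivative_transform[OF \<open>t \<in> J\<close>, rotated])
        (simp add: integral_unique[OF int] cbox_interval)
    moreover have "((\<lambda>u. W (r, u) - W (0, u)) has_real_derivative Wt (r, t) - Wt (0, t)) (at t within J)"
      by (intro DERIV_diff Wt) (use r \<open>t \<in> J\<close> \<open>M > 0\<close> in auto)
    moreover have "at t within J \<noteq> bot"
      using J \<open>t \<in> J\<close> by (simp add: trivial_limit_within islimpt_Icc)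
    ultimately have "integral {0..r} (\<lambda>s. Wst (s, t)) = Wt (r, t) - Wt (0, t)"
      by (rule has_field_derivative_unique)
    then show ?thesis by simp
  qed
  have "continuous_on {0..M} (\<lambda>s. Wst (s, t))"
    by (rule continuous_on_compose2[OF cont]) (use \<open>t \<in> J\<close> in \<open>auto intro!: continuous_intros\<close>)
  then have "((\<lambda>r. integral {0..r} (\<lambda>s. Wst (s, t))) has_real_derivative Wst (s, t)) (at s within {0..M})"
    using integral_has_real_derivative \<open>s \<in> {0..M}\<close> by blast
  then have "((\<lambda>r. Wt (0, t) + integral {0..r} (\<lambda>s. Wst (s, t))) has_real_derivative 0 + Wst (s, t)) (at s within {0..M})"
    by (intro DERIV_add) auto
  then show ?thesis
    unfolding add_0 by (rule has_real_derivative_transform[OF \<open>s \<in> {0..M}\<close>, rotated]) (rule eq)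
qed

section \<open>First variation\<close>

text \<open>Plain real functions in place of \<open>vector_derivative\<close>: once a curve has such
  a jet, \<open>curv\<close>, \<open>Ffun\<close> and \<open>area\<close> become explicit
  expressions in the coordinates and these four functions, to which the calculus of real derivatives
  applies.\<close>

definition jet2 :: "real \<Rightarrow> (real \<Rightarrow> real \<times> real) \<Rightarrow> (real \<Rightarrow> real) \<Rightarrow> (real \<Rightarrow> real) \<Rightarrow>
    (real \<Rightarrow> real) \<Rightarrow> (real \<Rightarrow> real) \<Rightarrow> bool" where
  "jet2 L \<gamma> x1 y1 x2 y2 \<longleftrightarrow> (\<forall>s\<in>{0..2*L}.
     ((\<lambda>s. fst (\<gamma> s)) has_real_derivative x1 s) (at s within {0..2*L}) \<and>
     ((\<lambda>s. snd (\<gamma> s)) has_real_derivative y1 s) (at s within {0..2*L}) \<and>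
     (x1 has_real_derivative x2 s) (at s within {0..2*L}) \<and>
     (y1 has_real_derivative y2 s) (at s within {0..2*L}))"

lemma jet2_cong:
  assumes "jet2 L \<gamma> x1 y1 x2 y2" "\<And>s. s \<in> {0..2*L} \<Longrightarrow> \<gamma>' s = \<gamma> s"
  shows "jet2 L \<gamma>' x1 y1 x2 y2"
proof -
  have "((\<lambda>s. fst (\<gamma>' s)) has_real_derivative x1 s) (at s within {0..2*L})"
    "((\<lambda>s. snd (\<gamma>' s)) has_real_derivative y1 s) (at s within {0..2*L})" if s: "s \<in> {0..2*L}" for s
  proof -
    have d: "((\<lambda>s. fst (\<gamma> s)) has_real_derivative x1 s) (at s within {0..2*L})"
      "((\<lambda>s. snd (\<gamma> s)) has_real_derivative y1 s) (at s within {0..2*L})"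
      using assms(1) s unfolding jet2_def by blast+
    show "((\<lambda>s. fst (\<gamma>' s)) has_real_derivative x1 s) (at s within {0..2*L})"
      by (rule has_real_derivative_transform[OF s _ d(1)]) (simp add: assms(2))
    show "((\<lambda>s. snd (\<gamma>' s)) has_real_derivative y1 s) (at s within {0..2*L})"
      by (rule has_real_derivative_transform[OF s _ d(2)]) (simp add: assms(2))
  qed
  with assms(1) show ?thesis unfolding jet2_def by blast
qed

lemma vector_derivative_PairI:
  assumes "0 < L" "s \<in> {0..2*L}"
    and "((\<lambda>s. fst (\<gamma> s)) has_real_derivative a) (at s within {0..2*L})"
    and "((\<lambda>s. snd (\<gamma> s)) has_real_derivative b) (at s within {0..2*L})"
  shows "vector_derivative \<gamma> (at s within {0..2*L}) = (a, b)"
proof (rule vector_derivative_within_cbox[of 0 "2*L", unfolded cbox_interval])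
  have "((\<lambda>s. (fst (\<gamma> s), snd (\<gamma> s))) has_derivative (\<lambda>h. (a * h, b * h))) (at s within {0..2*L})"
    using assms(3,4) unfolding has_field_derivative_def by (rule has_derivative_Pair)
  then show "(\<gamma> has_vector_derivative (a, b)) (at s within {0..2*L})"
    unfolding has_vector_derivative_def by (simp add: mult.commute)
qed (use assms in auto)

lemma jet2_dvec:
  assumes "0 < L" "jet2 L \<gamma> x1 y1 x2 y2" "s \<in> {0..2*L}"
  shows "dvec L \<gamma> s = (x1 s, y1 s)"
  unfolding dvec_def using assms unfolding jet2_def by (intro vector_derivative_PairI) auto

lemma jet2_ddvec:
  assumes "0 < L" "jet2 L \<gamma> x1 y1 x2 y2" and s: "s \<in> {0..2*L}"
  shows "ddvec L \<gamma> s = (x2 s, y2 s)"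
  unfolding ddvec_def
proof (rule vector_derivative_PairI[OF assms(1) s])
  have d: "(x1 has_real_derivative x2 s) (at s within {0..2*L})"
    "(y1 has_real_derivative y2 s) (at s within {0..2*L})"
    using assms(2) s unfolding jet2_def by blast+
  show "((\<lambda>s. fst (dvec L \<gamma> s)) has_real_derivative x2 s) (at s within {0..2*L})"
    by (rule has_real_derivative_transform[OF s _ d(1)]) (simp add: jet2_dvec[OF assms(1,2)])
  show "((\<lambda>s. snd (dvec L \<gamma> s)) has_real_derivative y2 s) (at s within {0..2*L})"
    by (rule has_real_derivative_transform[OF s _ d(2)]) (simp add: jet2_dvec[OF assms(1,2)])
qed

lemma jet2_unique:
  assumes "0 < L" "jet2 L \<gamma> x1 y1 x2 y2" "jet2 L \<gamma> x1' y1' x2' y2'" "s \<in> {0..2*L}"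
  shows "x1 s = x1' s" "y1 s = y1' s" "x2 s = x2' s" "y2 s = y2' s"
  using jet2_dvec[OF assms(1,2,4)] jet2_dvec[OF assms(1,3,4)]
    jet2_ddvec[OF assms(1,2,4)] jet2_ddvec[OF assms(1,3,4)] by auto

lemma jet2_curv:
  assumes "0 < L" "jet2 L \<gamma> x1 y1 x2 y2" "s \<in> {0..2*L}"
  shows "curv L \<gamma> s = (x1 s * y2 s - y1 s * x2 s) / sqrt ((x1 s)\<^sup>2 + (y1 s)\<^sup>2) ^ 3"
  by (simp add: curv_def jet2_dvec[OF assms] jet2_ddvec[OF assms] perp_def inner_prod_def norm_Pair)

lemma jet2_regular:
  assumes "0 < L" "jet2 L \<gamma> x1 y1 x2 y2" "s \<in> {0..2*L}"
  shows "dvec L \<gamma> s \<noteq> 0 \<longleftrightarrow> (x1 s)\<^sup>2 + (y1 s)\<^sup>2 > 0"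
  by (simp add: jet2_dvec[OF assms] sum_power2_gt_zero_iff zero_prod_def)

text \<open>A nonzero cross product excludes zero velocity, and for a regular curve
  \<open>curv\<close> divides it by a positive number. Regularity and strict convexity thus merge
  into one inequality that is polynomial in the jet.\<close>

lemma jet2_curv_pos:
  assumes "0 < L" "jet2 L \<gamma> x1 y1 x2 y2" "s \<in> {0..2*L}"
  shows "dvec L \<gamma> s \<noteq> 0 \<and> curv L \<gamma> s > 0 \<longleftrightarrow> x1 s * y2 s - y1 s * x2 s > 0"
proof
  assume *: "dvec L \<gamma> s \<noteq> 0 \<and> curv L \<gamma> s > 0"
  then have "sqrt ((x1 s)\<^sup>2 + (y1 s)\<^sup>2) ^ 3 > 0"
    by (simp add: jet2_regular[OF assms])
  then show "x1 s * y2 s - y1 s * x2 s > 0"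
    using * by (simp add: jet2_curv[OF assms] zero_less_divide_iff)
next
  assume *: "x1 s * y2 s - y1 s * x2 s > 0"
  then have p: "(x1 s)\<^sup>2 + (y1 s)\<^sup>2 > 0"
    by (auto simp: sum_power2_gt_zero_iff)
  then have "sqrt ((x1 s)\<^sup>2 + (y1 s)\<^sup>2) ^ 3 > 0" by simp
  with * p show "dvec L \<gamma> s \<noteq> 0 \<and> curv L \<gamma> s > 0"
    by (simp only: jet2_curv[OF assms] jet2_regular[OF assms] zero_less_divide_iff) simp
qed

text \<open>Speed over curvature is the fourth power of the speed over the cross product of velocity
  and acceleration, so the square roots disappear and the integrand becomes a rational function of
  the jet.\<close>

lemma jet2_Ffun:
  assumes "0 < L" "jet2 L \<gamma> x1 y1 x2 y2"
  shows "Ffun L \<gamma> = integral {0..2*L} (\<lambda>s. ((x1 s)\<^sup>2 + (y1 s)\<^sup>2)\<^sup>2 / (x1 s * y2 s - y1 s * x2 s))"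
  unfolding Ffun_def
proof (rule integral_cong)
  fix s assume s: "s \<in> {0..2*L}"
  define r where "r = sqrt ((x1 s)\<^sup>2 + (y1 s)\<^sup>2)"
  have r: "norm (dvec L \<gamma> s) = r" "0 \<le> r" "(x1 s)\<^sup>2 + (y1 s)\<^sup>2 = r\<^sup>2"
    by (simp_all add: r_def jet2_dvec[OF assms s] norm_Pair)
  show "norm (dvec L \<gamma> s) * inverse (curv L \<gamma> s) =
      ((x1 s)\<^sup>2 + (y1 s)\<^sup>2)\<^sup>2 / (x1 s * y2 s - y1 s * x2 s)"
    unfolding jet2_curv[OF assms s] r_def[symmetric] r(1,3) using r(2) by (simp add: power2_eq_square power3_eq_cube)
qed

lemma jet2_area:
  assumes "0 < L" "jet2 L \<gamma> x1 y1 x2 y2"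
  shows "area L \<gamma> = integral {0..2*L} (\<lambda>s. (fst (\<gamma> s) * y1 s - x1 s * snd (\<gamma> s)) / 2)"
proof -
  have "area L \<gamma> = 1/2 * integral {0..2*L} (\<lambda>s. fst (\<gamma> s) * y1 s - x1 s * snd (\<gamma> s))"
    unfolding area_def
    by (intro arg_cong[where f = "\<lambda>x. 1/2 * x"] integral_cong) (simp add: jet2_dvec[OF assms])
  then show ?thesis by simp
qed

lemma has_real_derivative_square_divide:
  assumes "(P has_real_derivative P') (at t within J)" "(D has_real_derivative D') (at t within J)" "D t \<noteq> 0"
  shows "((\<lambda>t. (P t)\<^sup>2 / D t) has_real_derivative 2 * P t * P' / D t - (P t)\<^sup>2 * D' / (D t)\<^sup>2) (at t within J)"
  by (rule derivative_eq_intros assms refl)+ (use assms(3) in \<open>simp add: divide_simps power2_eq_square\<close>)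

text \<open>Differentiation under the integral, with the admissibility of all curves of the family
  keeping the denominator away from zero. The function \<open>v1\<close> appears in two roles, as
  the derivative of v along the curve and as the rate of change of the vertical velocity; the second
  role later decides the sign of the boundary terms.\<close>

lemma first_variation_general:
  assumes L: "0 < L" and J: "J = {c..d}" "c < d" "0 \<in> J"
    and V: "is_variation x0 L \<gamma> V J"
    and \<gamma>: "jet2 L \<gamma> x1 y1 x2 y2"
  obtains u v u1 v1 u2 v2 where
    "\<And>s. s \<in> {0..2*L} \<Longrightarrow> ((\<lambda>t. fst (V s t)) has_real_derivative u s) (at 0 within J)"
    "\<And>s. s \<in> {0..2*L} \<Longrightarrow> ((\<lambda>t. snd (V s t)) has_real_derivative v s) (at 0 within J)"
    "\<And>s. s \<in> {0..2*L} \<Longrightarrow> ((\<lambda>t. snd (dvec L (\<lambda>s. V s t) s)) has_real_derivative v1 s) (at 0 within J)"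
    "jet2 L (\<lambda>s. (u s, v s)) u1 v1 u2 v2"
    "((\<lambda>t. Ffun L (\<lambda>s. V s t)) has_real_derivative integral {0..2*L} (\<lambda>s.
        4 * ((x1 s)\<^sup>2 + (y1 s)\<^sup>2) * (x1 s * u1 s + y1 s * v1 s) / (x1 s * y2 s - y1 s * x2 s)
        - ((x1 s)\<^sup>2 + (y1 s)\<^sup>2)\<^sup>2 * (u1 s * y2 s + x1 s * v2 s - v1 s * x2 s - y1 s * u2 s)
            / (x1 s * y2 s - y1 s * x2 s)\<^sup>2)) (at 0 within J)"
    "((\<lambda>t. area L (\<lambda>s. V s t)) has_real_derivative integral {0..2*L} (\<lambda>s.
        (u s * y1 s + fst (\<gamma> s) * v1 s - u1 s * snd (\<gamma> s) - x1 s * v s) / 2)) (at 0 within J)"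
proof -
  let ?I = "{0..2*L}"
  define X where "X = (\<lambda>p. fst (V (fst p) (snd p)))"
  define Y where "Y = (\<lambda>p. snd (V (fst p) (snd p)))"
  have CV: "Cinf_on (?I \<times> J) (\<lambda>p. V (fst p) (snd p))" and V0: "\<And>s. s \<in> ?I \<Longrightarrow> V s 0 = \<gamma> s"
    and adm: "\<And>t. t \<in> J \<Longrightarrow> admissible x0 L (\<lambda>s. V s t)"
    using V unfolding is_variation_def by auto
  have CX: "Cinf_on (?I \<times> J) X" and CY: "Cinf_on (?I \<times> J) Y"
    unfolding X_def Y_def
    using Cinf_on_linear[OF bounded_linear_fst CV] Cinf_on_linear[OF bounded_linear_snd CV] by auto
  obtain Xs Xt where X1: "Cinf_on (?I \<times> J) Xs" "Cinf_on (?I \<times> J) Xt"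
    "\<And>s t. s \<in> ?I \<Longrightarrow> t \<in> J \<Longrightarrow> ((\<lambda>s. X (s, t)) has_real_derivative Xs (s, t)) (at s within ?I)"
    "\<And>s t. s \<in> ?I \<Longrightarrow> t \<in> J \<Longrightarrow> ((\<lambda>t. X (s, t)) has_real_derivative Xt (s, t)) (at t within J)"
    using Cinf_on_partials[OF CX] by metis
  obtain Xss Xst where X2: "Cinf_on (?I \<times> J) Xss" "Cinf_on (?I \<times> J) Xst"
    "\<And>s t. s \<in> ?I \<Longrightarrow> t \<in> J \<Longrightarrow> ((\<lambda>s. Xs (s, t)) has_real_derivative Xss (s, t)) (at s within ?I)"
    "\<And>s t. s \<in> ?I \<Longrightarrow> t \<in> J \<Longrightarrow> ((\<lambda>t. Xs (s, t)) has_real_derivative Xst (s, t)) (at t within J)"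
    using Cinf_on_partials[OF X1(1)] by metis
  obtain Xsst where X3: "Cinf_on (?I \<times> J) Xsst"
    "\<And>s t. s \<in> ?I \<Longrightarrow> t \<in> J \<Longrightarrow> ((\<lambda>t. Xss (s, t)) has_real_derivative Xsst (s, t)) (at t within J)"
    using Cinf_on_partials[OF X2(1)] by metis
  obtain Ys Yt where Y1: "Cinf_on (?I \<times> J) Ys" "Cinf_on (?I \<times> J) Yt"
    "\<And>s t. s \<in> ?I \<Longrightarrow> t \<in> J \<Longrightarrow> ((\<lambda>s. Y (s, t)) has_real_derivative Ys (s, t)) (at s within ?I)"
    "\<And>s t. s \<in> ?I \<Longrightarrow> t \<in> J \<Longrightarrow> ((\<lambda>t. Y (s, t)) has_real_derivative Yt (s, t)) (at t within J)"
    using Cinf_on_partials[OF CY] by metis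
  obtain Yss Yst where Y2: "Cinf_on (?I \<times> J) Yss" "Cinf_on (?I \<times> J) Yst"
    "\<And>s t. s \<in> ?I \<Longrightarrow> t \<in> J \<Longrightarrow> ((\<lambda>s. Ys (s, t)) has_real_derivative Yss (s, t)) (at s within ?I)"
    "\<And>s t. s \<in> ?I \<Longrightarrow> t \<in> J \<Longrightarrow> ((\<lambda>t. Ys (s, t)) has_real_derivative Yst (s, t)) (at t within J)"
    using Cinf_on_partials[OF Y1(1)] by metis
  obtain Ysst where Y3: "Cinf_on (?I \<times> J) Ysst"
    "\<And>s t. s \<in> ?I \<Longrightarrow> t \<in> J \<Longrightarrow> ((\<lambda>t. Yss (s, t)) has_real_derivative Ysst (s, t)) (at t within J)"
    using Cinf_on_partials[OF Y2(1)] by metis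
  have jet: "jet2 L (\<lambda>s. V s t) (\<lambda>s. Xs (s, t)) (\<lambda>s. Ys (s, t)) (\<lambda>s. Xss (s, t)) (\<lambda>s. Yss (s, t))"
    if "t \<in> J" for t
    using that X1(3) Y1(3) X2(3) Y2(3) unfolding jet2_def by (simp add: X_def Y_def)
  \<comment> \<open>Derivatives within the interval are unique, so at t = 0 those of V coincide with
    the given jet of \<gamma>.\<close>
  have at0: "Xs (s, 0) = x1 s" "Ys (s, 0) = y1 s" "Xss (s, 0) = x2 s" "Yss (s, 0) = y2 s"
      "X (s, 0) = fst (\<gamma> s)" "Y (s, 0) = snd (\<gamma> s)" if "s \<in> ?I" for s
    using jet2_unique[OF L jet2_cong[OF \<gamma> V0] jet[OF J(3)] that] V0[OF that] by (simp_all add: X_def Y_def)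
  have pos: "Xs (s, t) * Yss (s, t) - Ys (s, t) * Xss (s, t) > 0" if "s \<in> ?I" "t \<in> J" for s t
    using jet2_curv_pos[OF L jet[OF that(2)] that(1)] adm[OF that(2)] that(1) unfolding admissible_def by blast
  have pos': "Xs (s, t) * Yss (s, t) - Ys (s, t) * Xss (s, t) \<noteq> 0" if "s \<in> ?I" "t \<in> J" for s t
    using pos[OF that] by simp
  note C = X1(1,2) X2(1,2) X3(1) Y1(1,2) Y2(1,2) Y3(1) CX CY
  \<comment> \<open>The Leibniz rule wants the parameter t as the first coordinate.\<close>
  have swap: "continuous_on (J \<times> ?I) (\<lambda>p. W (snd p, fst p))" if "Cinf_on (?I \<times> J) W" for W :: "real \<times> real \<Rightarrow> real"
    by (rule continuous_on_compose2[OF Cinf_on_continuous_on[OF that]]) (auto intro!: continuous_intros)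
  have row: "continuous_on ?I (\<lambda>s. W (s, t))" if "Cinf_on (?I \<times> J) W" "t \<in> J" for W :: "real \<times> real \<Rightarrow> real" and t
    by (rule continuous_on_compose2[OF Cinf_on_continuous_on[OF that(1)]]) (use that in \<open>auto intro!: continuous_intros\<close>)
  have "convex J" using J by simp
  have "((\<lambda>t. integral (cbox 0 (2*L)) (\<lambda>s. ((Xs (s, t))\<^sup>2 + (Ys (s, t))\<^sup>2)\<^sup>2 / (Xs (s, t) * Yss (s, t) - Ys (s, t) * Xss (s, t))))
      has_real_derivative integral (cbox 0 (2*L)) (\<lambda>s.
        4 * ((Xs (s, 0))\<^sup>2 + (Ys (s, 0))\<^sup>2) * (Xs (s, 0) * Xst (s, 0) + Ys (s, 0) * Yst (s, 0)) / (Xs (s, 0) * Yss (s, 0) - Ys (s, 0) * Xss (s, 0))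
        - ((Xs (s, 0))\<^sup>2 + (Ys (s, 0))\<^sup>2)\<^sup>2 * (Xst (s, 0) * Yss (s, 0) + Xs (s, 0) * Ysst (s, 0) - Yst (s, 0) * Xss (s, 0) - Ys (s, 0) * Xsst (s, 0))
            / (Xs (s, 0) * Yss (s, 0) - Ys (s, 0) * Xss (s, 0))\<^sup>2)) (at 0 within J)"
    (is "(_ has_real_derivative integral _ (?F1 0)) _")
  proof (rule leibniz_rule_field_derivative[where fx = ?F1])
    fix t s assume t: "t \<in> J" and "s \<in> cbox 0 (2*L)"
    then have s: "s \<in> ?I" by simp
    show "((\<lambda>t. ((Xs (s, t))\<^sup>2 + (Ys (s, t))\<^sup>2)\<^sup>2 / (Xs (s, t) * Yss (s, t) - Ys (s, t) * Xss (s, t))) has_real_derivative ?F1 t s) (at t within J)"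
    proof (rule DERIV_cong[OF has_real_derivative_square_divide[
          where P = "\<lambda>t. (Xs (s, t))\<^sup>2 + (Ys (s, t))\<^sup>2" and
            D = "\<lambda>t. Xs (s, t) * Yss (s, t) - Ys (s, t) * Xss (s, t)"]])
      show "((\<lambda>t. (Xs (s, t))\<^sup>2 + (Ys (s, t))\<^sup>2) has_real_derivative
          2 * (Xs (s, t) * Xst (s, t) + Ys (s, t) * Yst (s, t))) (at t within J)"
        by (rule derivative_eq_intros X2(4)[OF s t] Y2(4)[OF s t] refl)+ simp
      show "((\<lambda>t. Xs (s, t) * Yss (s, t) - Ys (s, t) * Xss (s, t)) has_real_derivative
          Xst (s, t) * Yss (s, t) + Xs (s, t) * Ysst (s, t) - Yst (s, t) * Xss (s, t) - Ys (s, t) * Xsst (s, t)) (at t within J)"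
        by (rule derivative_eq_intros X2(4)[OF s t] Y2(4)[OF s t] X3(2)[OF s t] Y3(2)[OF s t] refl)+ simp
    qed (use pos'[OF s t] in \<open>simp_all add: algebra_simps\<close>)
  next
    fix t assume t: "t \<in> J"
    show "(\<lambda>s. ((Xs (s, t))\<^sup>2 + (Ys (s, t))\<^sup>2)\<^sup>2 / (Xs (s, t) * Yss (s, t) - Ys (s, t) * Xss (s, t))) integrable_on cbox 0 (2*L)"
      unfolding cbox_interval
      by (intro integrable_continuous_real continuous_intros row C t ballI) (rule pos'[OF _ t])
  next
    show "continuous_on (J \<times> cbox 0 (2 * L)) (\<lambda>(t, s). ?F1 t s)"
      unfolding cbox_interval case_prod_unfold
      by (intro continuous_intros swap C) (use pos' in auto)
  qed fact+
  then have F: "((\<lambda>t. Ffun L (\<lambda>s. V s t)) has_real_derivative integral ?I (?F1 0)) (at 0 within J)"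
    unfolding cbox_interval
    by (rule has_real_derivative_transform[OF J(3), rotated]) (simp add: jet2_Ffun[OF L jet])
  have "((\<lambda>t. integral (cbox 0 (2*L)) (\<lambda>s. (X (s, t) * Ys (s, t) - Xs (s, t) * Y (s, t)) / 2))
      has_real_derivative integral (cbox 0 (2*L)) (\<lambda>s.
        (Xt (s, 0) * Ys (s, 0) + X (s, 0) * Yst (s, 0) - Xst (s, 0) * Y (s, 0) - Xs (s, 0) * Yt (s, 0)) / 2)) (at 0 within J)"
    (is "(_ has_real_derivative integral _ (?A1 0)) _")
  proof (rule leibniz_rule_field_derivative[where fx = ?A1])
    fix t s assume t: "t \<in> J" and "s \<in> cbox 0 (2*L)"
    then have s: "s \<in> ?I" by simp
    show "((\<lambda>t. (X (s, t) * Ys (s, t) - Xs (s, t) * Y (s, t)) / 2) has_real_derivative ?A1 t s) (at t within J)"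
      by (rule derivative_eq_intros X1(4)[OF s t] Y1(4)[OF s t] X2(4)[OF s t] Y2(4)[OF s t] refl)+ simp_all
  next
    fix t assume t: "t \<in> J"
    show "(\<lambda>s. (X (s, t) * Ys (s, t) - Xs (s, t) * Y (s, t)) / 2) integrable_on cbox 0 (2*L)"
      unfolding cbox_interval
      by (intro integrable_continuous_real continuous_intros row C t) auto
  next
    show "continuous_on (J \<times> cbox 0 (2 * L)) (\<lambda>(t, s). ?A1 t s)"
      unfolding cbox_interval case_prod_unfold
      by (intro continuous_intros swap C) auto
  qed fact+
  then have A: "((\<lambda>t. area L (\<lambda>s. V s t)) has_real_derivative integral ?I (?A1 0)) (at 0 within J)"
    unfolding cbox_interval
    by (rule has_real_derivative_transform[OF J(3), rotated]) (simp add: jet2_area[OF L jet] X_def Y_def)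
  have M: "2 * L > 0" using L by simp
  show ?thesis
  proof (rule that[of "\<lambda>s. Xt (s, 0)" "\<lambda>s. Yt (s, 0)" "\<lambda>s. Yst (s, 0)" "\<lambda>s. Xst (s, 0)" "\<lambda>s. Xsst (s, 0)" "\<lambda>s. Ysst (s, 0)"])
    fix s assume s: "s \<in> ?I"
    show "((\<lambda>t. fst (V s t)) has_real_derivative Xt (s, 0)) (at 0 within J)"
      using X1(4)[OF s J(3)] by (simp add: X_def)
    show "((\<lambda>t. snd (V s t)) has_real_derivative Yt (s, 0)) (at 0 within J)"
      using Y1(4)[OF s J(3)] by (simp add: Y_def)
    show "((\<lambda>t. snd (dvec L (\<lambda>s. V s t) s)) has_real_derivative Yst (s, 0)) (at 0 within J)"
      by (rule has_real_derivative_transform[OF J(3) _ Y2(4)[OF s J(3)]])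
        (simp add: jet2_dvec[OF L jet s])
  next
    show "jet2 L (\<lambda>s. (Xt (s, 0), Yt (s, 0))) (\<lambda>s. Xst (s, 0)) (\<lambda>s. Yst (s, 0)) (\<lambda>s. Xsst (s, 0)) (\<lambda>s. Ysst (s, 0))"
      unfolding jet2_def fst_conv snd_conv
    proof (intro ballI conjI)
      fix s assume s: "s \<in> ?I"
      show "((\<lambda>s. Xt (s, 0)) has_real_derivative Xst (s, 0)) (at s within ?I)"
        by (rule mixed_partials[OF M J(1,2) X1(3,4) X2(4) _ _ s J(3)]) (use C in \<open>auto intro: Cinf_on_continuous_on\<close>)
      show "((\<lambda>s. Yt (s, 0)) has_real_derivative Yst (s, 0)) (at s within ?I)"
        by (rule mixed_partials[OF M J(1,2) Y1(3,4) Y2(4) _ _ s J(3)]) (use C in \<open>auto intro: Cinf_on_continuous_on\<close>)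
      show "((\<lambda>s. Xst (s, 0)) has_real_derivative Xsst (s, 0)) (at s within ?I)"
        by (rule mixed_partials[OF M J(1,2) X2(3,4) X3(2) _ _ s J(3)]) (use C in \<open>auto intro: Cinf_on_continuous_on\<close>)
      show "((\<lambda>s. Yst (s, 0)) has_real_derivative Ysst (s, 0)) (at s within ?I)"
        by (rule mixed_partials[OF M J(1,2) Y2(3,4) Y3(2) _ _ s J(3)]) (use C in \<open>auto intro: Cinf_on_continuous_on\<close>)
    qed
  next
    note F
    also have "integral ?I (?F1 0) = integral ?I (\<lambda>s.
        4 * ((x1 s)\<^sup>2 + (y1 s)\<^sup>2) * (x1 s * Xst (s, 0) + y1 s * Yst (s, 0)) / (x1 s * y2 s - y1 s * x2 s)
        - ((x1 s)\<^sup>2 + (y1 s)\<^sup>2)\<^sup>2 * (Xst (s, 0) * y2 s + x1 s * Ysst (s, 0) - Yst (s, 0) * x2 s - y1 s * Xsst (s, 0))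
            / (x1 s * y2 s - y1 s * x2 s)\<^sup>2)"
      by (rule integral_cong) (simp add: at0)
    finally show "((\<lambda>t. Ffun L (\<lambda>s. V s t)) has_real_derivative \<dots>) (at 0 within J)" .
  next
    note A
    also have "integral ?I (?A1 0) = integral ?I (\<lambda>s.
        (Xt (s, 0) * y1 s + fst (\<gamma> s) * Yst (s, 0) - Xst (s, 0) * snd (\<gamma> s) - x1 s * Yt (s, 0)) / 2)"
      by (rule integral_cong) (simp add: at0)
    finally show "((\<lambda>t. area L (\<lambda>s. V s t)) has_real_derivative \<dots>) (at 0 within J)" .
  qed
qed

section \<open>Unit speed curves and their Frenet equations\<close>

locale unit_speed_curve =
  fixes x0 L :: real and \<gamma> :: "real \<Rightarrow> real \<times> real" and x1 y1 H H1 H2 :: "real \<Rightarrow> real"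
  assumes L_pos: "0 < L"
    and adm: "admissible x0 L \<gamma>"
    and jet: "jet2 L \<gamma> x1 y1 (\<lambda>s. - H s * y1 s) (\<lambda>s. H s * x1 s)"
    and dH: "\<And>s. s \<in> {0..2*L} \<Longrightarrow> (H has_real_derivative H1 s) (at s within {0..2*L})"
    and dH1: "\<And>s. s \<in> {0..2*L} \<Longrightarrow> (H1 has_real_derivative H2 s) (at s within {0..2*L})"
    and cont_H2: "continuous_on {0..2*L} H2"
    and unit: "\<And>s. s \<in> {0..2*L} \<Longrightarrow> (x1 s)\<^sup>2 + (y1 s)\<^sup>2 = 1"
    and H_pos: "\<And>s. s \<in> {0..2*L} \<Longrightarrow> H s > 0"

text \<open>Differentiating |T| = 1 shows that T' is orthogonal to T, hence T' = H n with H the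
  cross product of T and T'; this is the Frenet equation that the locale takes as its jet. Four
  derivatives of \<gamma> are extracted because the first variation involves the second derivative
  of H.\<close>

lemma unit_speed_curve_exists:
  assumes L: "0 < L" and adm: "admissible x0 L \<gamma>" and arc: "arclength L \<gamma>"
  obtains x1 y1 H H1 H2 where "unit_speed_curve x0 L \<gamma> x1 y1 H H1 H2"
proof -
  let ?I = "{0..2*L}"
  have C: "Cinf_on ?I \<gamma>" using adm by (simp add: admissible_def)
  have Cx: "Cinf_on ?I (\<lambda>s. fst (\<gamma> s))" and Cy: "Cinf_on ?I (\<lambda>s. snd (\<gamma> s))"
    using Cinf_on_linear[OF bounded_linear_fst C] Cinf_on_linear[OF bounded_linear_snd C] by auto
  obtain x1 where x1: "Cinf_on ?I x1"
    "\<And>s. s \<in> ?I \<Longrightarrow> ((\<lambda>s. fst (\<gamma> s)) has_real_derivative x1 s) (at s within ?I)"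
    using Cinf_on_real_derivative[OF Cx] by metis
  obtain x2 where x2: "Cinf_on ?I x2" "\<And>s. s \<in> ?I \<Longrightarrow> (x1 has_real_derivative x2 s) (at s within ?I)"
    using Cinf_on_real_derivative[OF x1(1)] by metis
  obtain x3 where x3: "Cinf_on ?I x3" "\<And>s. s \<in> ?I \<Longrightarrow> (x2 has_real_derivative x3 s) (at s within ?I)"
    using Cinf_on_real_derivative[OF x2(1)] by metis
  obtain x4 where x4: "Cinf_on ?I x4" "\<And>s. s \<in> ?I \<Longrightarrow> (x3 has_real_derivative x4 s) (at s within ?I)"
    using Cinf_on_real_derivative[OF x3(1)] by metis
  obtain y1 where y1: "Cinf_on ?I y1"
    "\<And>s. s \<in> ?I \<Longrightarrow> ((\<lambda>s. snd (\<gamma> s)) has_real_derivative y1 s) (at s within ?I)"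
    using Cinf_on_real_derivative[OF Cy] by metis
  obtain y2 where y2: "Cinf_on ?I y2" "\<And>s. s \<in> ?I \<Longrightarrow> (y1 has_real_derivative y2 s) (at s within ?I)"
    using Cinf_on_real_derivative[OF y1(1)] by metis
  obtain y3 where y3: "Cinf_on ?I y3" "\<And>s. s \<in> ?I \<Longrightarrow> (y2 has_real_derivative y3 s) (at s within ?I)"
    using Cinf_on_real_derivative[OF y2(1)] by metis
  obtain y4 where y4: "Cinf_on ?I y4" "\<And>s. s \<in> ?I \<Longrightarrow> (y3 has_real_derivative y4 s) (at s within ?I)"
    using Cinf_on_real_derivative[OF y3(1)] by metis
  have jet: "jet2 L \<gamma> x1 y1 x2 y2"
    unfolding jet2_def using x1(2) y1(2) x2(2) y2(2) by blast
  define H where "H = (\<lambda>s. x1 s * y2 s - y1 s * x2 s)"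
  have unit: "(x1 s)\<^sup>2 + (y1 s)\<^sup>2 = 1" if "s \<in> ?I" for s
  proof -
    have "norm (dvec L \<gamma> s) = 1" using arc that unfolding arclength_def by blast
    then show ?thesis by (simp add: jet2_dvec[OF L jet that] norm_Pair)
  qed
  have orth: "x1 s * x2 s + y1 s * y2 s = 0" if s: "s \<in> ?I" for s
  proof -
    have "((\<lambda>s. (x1 s)\<^sup>2 + (y1 s)\<^sup>2) has_real_derivative 2 * (x1 s * x2 s + y1 s * y2 s)) (at s within ?I)"
      by (rule derivative_eq_intros x2(2)[OF s] y2(2)[OF s] refl)+ simp
    moreover have "((\<lambda>s. (x1 s)\<^sup>2 + (y1 s)\<^sup>2) has_real_derivative 0) (at s within ?I)"
      by (rule has_real_derivative_transform[OF s unit]) simp_all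
    moreover have "at s within ?I \<noteq> bot"
      using s L by (simp add: trivial_limit_within)
    ultimately show ?thesis using has_field_derivative_unique by fastforce
  qed
  have x2H: "x2 s = - H s * y1 s" and y2H: "y2 s = H s * x1 s" if "s \<in> ?I" for s
    using unit[OF that] orth[OF that] unfolding H_def by algebra+
  show ?thesis
  proof
    \<comment> \<open>The terms \<open>x2 s * y2 s\<close> cancel in the derivative of H, which
      leaves only products of first and third derivatives.\<close>
    show "unit_speed_curve x0 L \<gamma> x1 y1 H (\<lambda>s. x1 s * y3 s - y1 s * x3 s)
        (\<lambda>s. x2 s * y3 s + x1 s * y4 s - y2 s * x3 s - y1 s * x4 s)"
    proof
      show "jet2 L \<gamma> x1 y1 (\<lambda>s. - H s * y1 s) (\<lambda>s. H s * x1 s)"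
        using jet x2H y2H unfolding jet2_def by simp
      show "continuous_on ?I (\<lambda>s. x2 s * y3 s + x1 s * y4 s - y2 s * x3 s - y1 s * x4 s)"
        by (intro continuous_intros Cinf_on_continuous_on) fact+
      fix s assume s: "s \<in> ?I"
      show "(H has_real_derivative x1 s * y3 s - y1 s * x3 s) (at s within ?I)"
        unfolding H_def
        by (rule derivative_eq_intros x2(2)[OF s] y2(2)[OF s] x3(2)[OF s] y3(2)[OF s] refl)+ simp
      show "((\<lambda>s. x1 s * y3 s - y1 s * x3 s) has_real_derivative
          x2 s * y3 s + x1 s * y4 s - y2 s * x3 s - y1 s * x4 s) (at s within ?I)"
        by (rule derivative_eq_intros x2(2)[OF s] y2(2)[OF s] x3(2)[OF s] y3(2)[OF s]
            x4(2)[OF s] y4(2)[OF s] refl)+ simp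
      show "H s > 0"
        using jet2_curv_pos[OF L jet s] adm s unfolding admissible_def H_def by blast
    qed (use L adm unit in auto)
  qed
qed

section \<open>The first variation in terms of the curvature\<close>

context unit_speed_curve
begin

abbreviation "I \<equiv> {0..2*L}"

lemma not_bot: "s \<in> I \<Longrightarrow> at s within I \<noteq> bot"
  using L_pos by (simp add: trivial_limit_within)

lemma dx: "s \<in> I \<Longrightarrow> ((\<lambda>s. fst (\<gamma> s)) has_real_derivative x1 s) (at s within I)"
  and dy: "s \<in> I \<Longrightarrow> ((\<lambda>s. snd (\<gamma> s)) has_real_derivative y1 s) (at s within I)"
  and dx1: "s \<in> I \<Longrightarrow> (x1 has_real_derivative - H s * y1 s) (at s within I)"
  and dy1: "s \<in> I \<Longrightarrow> (y1 has_real_derivative H s * x1 s) (at s within I)"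
  using jet unfolding jet2_def by blast+

lemma cont: "continuous_on I (\<lambda>s. fst (\<gamma> s))" "continuous_on I (\<lambda>s. snd (\<gamma> s))"
    "continuous_on I x1" "continuous_on I y1" "continuous_on I H" "continuous_on I H1"
  using DERIV_continuous_on[OF dx] DERIV_continuous_on[OF dy] DERIV_continuous_on[OF dx1]
    DERIV_continuous_on[OF dy1] DERIV_continuous_on[OF dH] DERIV_continuous_on[OF dH1] by blast+

lemma H_nz: "s \<in> I \<Longrightarrow> H s \<noteq> 0"
  using H_pos by fastforce

text \<open>With \<open>g = 1/H\<^sup>2\<close>, the function \<open>g2\<close> is \<open>g''\<close>, and \<open>(p, q) = 2 H\<^sup>-\<^sup>1 T + g' n\<close>,
  where \<open>T = (x1, y1)\<close> is the tangent and \<open>n = (- y1, x1)\<close> the inner normal.\<close>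

definition g2 :: "real \<Rightarrow> real" where
  "g2 s = 6 * (H1 s)\<^sup>2 / H s ^ 4 - 2 * H2 s / H s ^ 3"

definition p :: "real \<Rightarrow> real" where
  "p s = 2 * x1 s / H s + 2 * H1 s * y1 s / H s ^ 3"

definition q :: "real \<Rightarrow> real" where
  "q s = 2 * y1 s / H s - 2 * H1 s * x1 s / H s ^ 3"

lemma cont_g2: "continuous_on I g2"
  unfolding g2_def using H_nz by (intro continuous_intros cont cont_H2) auto

text \<open>The tangential parts of the derivative of (p, q) cancel, as the derivative of 2/H equals
  g' H, while T' = H n turns the first summand into 2 n. What remains is (2 + g'') n, a multiple of
  the derivative of the rotated curve as soon as g'' is constant.\<close>

lemma dg: "((\<lambda>s. 1 / (H s)\<^sup>2) has_real_derivative - 2 * H1 s / H s ^ 3) (at s within I)"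
  and dg1: "((\<lambda>s. - 2 * H1 s / H s ^ 3) has_real_derivative g2 s) (at s within I)"
  and dp: "(p has_real_derivative - (2 + g2 s) * y1 s) (at s within I)"
  and dq: "(q has_real_derivative (2 + g2 s) * x1 s) (at s within I)"
  if s: "s \<in> I"
proof -
  note nz = H_nz[OF s] power_not_zero[OF H_nz[OF s]]
  note der = dH[OF s] dH1[OF s] dx1[OF s] dy1[OF s]
  show "((\<lambda>s. 1 / (H s)\<^sup>2) has_real_derivative - 2 * H1 s / H s ^ 3) (at s within I)"
    by (rule derivative_eq_intros der nz refl)+
      (use nz in \<open>simp add: divide_simps power2_eq_square power3_eq_cube\<close>)
  show "((\<lambda>s. - 2 * H1 s / H s ^ 3) has_real_derivative g2 s) (at s within I)"
    unfolding g2_def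
    by (rule derivative_eq_intros der nz refl)+
      (use nz in \<open>simp add: divide_simps eval_nat_numeral algebra_simps\<close>)
  show "(p has_real_derivative - (2 + g2 s) * y1 s) (at s within I)"
    unfolding p_def g2_def
    by (rule derivative_eq_intros der nz refl)+
      (use nz in \<open>simp add: divide_simps eval_nat_numeral algebra_simps\<close>)
  show "(q has_real_derivative (2 + g2 s) * x1 s) (at s within I)"
    unfolding q_def g2_def
    by (rule derivative_eq_intros der nz refl)+
      (use nz in \<open>simp add: divide_simps eval_nat_numeral algebra_simps\<close>)
qed

text \<open>The integrations by parts are done at once by exhibiting antiderivatives. With \<eta> =
  (u, v) they are the inner product of (p, q) with \<eta> minus g times that of n with \<eta>' for
  F, and half the cross product of \<gamma> and \<eta> for the area. All curves of the family share
  their endpoints, so \<eta> vanishes there and only the term with \<eta>' survives.\<close>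

lemma first_variation:
  assumes J: "J = {c..d}" "c < d" "0 \<in> J" and V: "is_variation x0 L \<gamma> V J"
  obtains u v u1 v1 where
    "\<And>s. s \<in> I \<Longrightarrow> ((\<lambda>t. fst (V s t)) has_real_derivative u s) (at 0 within J)"
    "\<And>s. s \<in> I \<Longrightarrow> ((\<lambda>t. snd (V s t)) has_real_derivative v s) (at 0 within J)"
    "\<And>s. s \<in> I \<Longrightarrow> (u has_real_derivative u1 s) (at s within I)"
    "\<And>s. s \<in> I \<Longrightarrow> (v has_real_derivative v1 s) (at s within I)"
    "\<And>s. s \<in> I \<Longrightarrow> ((\<lambda>t. snd (dvec L (\<lambda>s. V s t) s)) has_real_derivative v1 s) (at 0 within J)"
    "((\<lambda>t. Ffun L (\<lambda>s. V s t)) has_real_derivative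
        (x1 0 * v1 0 - y1 0 * u1 0) / (H 0)\<^sup>2 - (x1 (2*L) * v1 (2*L) - y1 (2*L) * u1 (2*L)) / (H (2*L))\<^sup>2
        - integral I (\<lambda>s. (2 + g2 s) * (x1 s * v s - y1 s * u s))) (at 0 within J)"
    "((\<lambda>t. area L (\<lambda>s. V s t)) has_real_derivative
        - integral I (\<lambda>s. x1 s * v s - y1 s * u s)) (at 0 within J)"
proof -
  obtain u v u1 v1 u2 v2 where
    u: "\<And>s. s \<in> I \<Longrightarrow> ((\<lambda>t. fst (V s t)) has_real_derivative u s) (at 0 within J)"
    and v: "\<And>s. s \<in> I \<Longrightarrow> ((\<lambda>t. snd (V s t)) has_real_derivative v s) (at 0 within J)"
    and v1: "\<And>s. s \<in> I \<Longrightarrow> ((\<lambda>t. snd (dvec L (\<lambda>s. V s t) s)) has_real_derivative v1 s) (at 0 within J)"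
    and uv: "jet2 L (\<lambda>s. (u s, v s)) u1 v1 u2 v2"
    and F: "((\<lambda>t. Ffun L (\<lambda>s. V s t)) has_real_derivative integral I (\<lambda>s.
        4 * ((x1 s)\<^sup>2 + (y1 s)\<^sup>2) * (x1 s * u1 s + y1 s * v1 s) / (x1 s * (H s * x1 s) - y1 s * (- H s * y1 s))
        - ((x1 s)\<^sup>2 + (y1 s)\<^sup>2)\<^sup>2 * (u1 s * (H s * x1 s) + x1 s * v2 s - v1 s * (- H s * y1 s) - y1 s * u2 s)
            / (x1 s * (H s * x1 s) - y1 s * (- H s * y1 s))\<^sup>2)) (at 0 within J)" (is "(_ has_real_derivative integral I ?f) _")
    and A: "((\<lambda>t. area L (\<lambda>s. V s t)) has_real_derivative integral I (\<lambda>s.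
        (u s * y1 s + fst (\<gamma> s) * v1 s - u1 s * snd (\<gamma> s) - x1 s * v s) / 2)) (at 0 within J)" (is "(_ has_real_derivative integral I ?a) _")
    by (rule first_variation_general[OF L_pos J V jet]) (rule that)
  have du: "s \<in> I \<Longrightarrow> (u has_real_derivative u1 s) (at s within I)"
    and dv: "s \<in> I \<Longrightarrow> (v has_real_derivative v1 s) (at s within I)"
    and du1: "s \<in> I \<Longrightarrow> (u1 has_real_derivative u2 s) (at s within I)"
    and dv1: "s \<in> I \<Longrightarrow> (v1 has_real_derivative v2 s) (at s within I)" for s
    using uv unfolding jet2_def by auto
  note c = DERIV_continuous_on[OF du] DERIV_continuous_on[OF dv]
  have J0: "at 0 within J \<noteq> bot"
    using J by (simp add: trivial_limit_within)
  have ends: "V 0 t = V 0 0" "V (2*L) t = V (2*L) 0" if "t \<in> J" for t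
    using V that J(3) unfolding is_variation_def admissible_def by auto
  have zero: "u 0 = 0" "v 0 = 0" "u (2*L) = 0" "v (2*L) = 0"
  proof -
    have const: "((\<lambda>t. f (V s t)) has_real_derivative 0) (at 0 within J)" if "s = 0 \<or> s = 2*L"
      for s and f :: "real \<times> real \<Rightarrow> real"
      by (rule has_real_derivative_transform[OF J(3), of _ "\<lambda>t. f (V s 0)"]) (use that ends in auto)
    show "u 0 = 0" "v 0 = 0" "u (2*L) = 0" "v (2*L) = 0"
      using L_pos by (auto intro!: has_field_derivative_unique[OF u const J0] has_field_derivative_unique[OF v const J0])
  qed
  let ?w = "\<lambda>s. (2 + g2 s) * (x1 s * v s - y1 s * u s)"
  let ?P = "\<lambda>s. p s * u s + q s * v s - (x1 s * v1 s - y1 s * u1 s) * (1 / (H s)\<^sup>2)"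
  have "((\<lambda>s. ?f s + ?w s) has_integral ?P (2*L) - ?P 0) I"
  proof (rule fundamental_theorem_of_calculus)
    fix s assume s: "s \<in> I"
    have "(?P has_real_derivative ?f s + ?w s) (at s within I)"
    proof (rule DERIV_cong)
      show "(?P has_real_derivative
          (- (2 + g2 s) * y1 s * u s + u1 s * p s) + ((2 + g2 s) * x1 s * v s + v1 s * q s)
          - (((- H s * y1 s * v1 s + v2 s * x1 s) - (H s * x1 s * u1 s + u2 s * y1 s)) * (1 / (H s)\<^sup>2)
             + (- 2 * H1 s / H s ^ 3) * (x1 s * v1 s - y1 s * u1 s))) (at s within I)"
        by (intro DERIV_diff DERIV_add DERIV_mult dp[OF s] dq[OF s] dg[OF s] dx1[OF s] dy1[OF s]
            du[OF s] dv[OF s] du1[OF s] dv1[OF s])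
      have D: "x1 s * (H s * x1 s) - y1 s * (- H s * y1 s) = H s"
        using unit[OF s] by algebra
      have f: "?f s = 4 * (x1 s * u1 s + y1 s * v1 s) / H s
          - (u1 s * (H s * x1 s) + x1 s * v2 s - v1 s * (- H s * y1 s) - y1 s * u2 s) / (H s)\<^sup>2"
        unfolding D unit[OF s] by simp
      \<comment> \<open>\<open>algebra\<close> works with polynomial identities, so H and its
        inverse enter as two unknowns tied by this equation.\<close>
      have h: "H s * inverse (H s) = 1" using H_nz[OF s] by simp
      show "(- (2 + g2 s) * y1 s * u s + u1 s * p s) + ((2 + g2 s) * x1 s * v s + v1 s * q s)
          - (((- H s * y1 s * v1 s + v2 s * x1 s) - (H s * x1 s * u1 s + u2 s * y1 s)) * (1 / (H s)\<^sup>2)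
             + (- 2 * H1 s / H s ^ 3) * (x1 s * v1 s - y1 s * u1 s)) = ?f s + ?w s"
        unfolding f p_def q_def using h
        by (simp only: divide_inverse power_inverse[symmetric] mult_1_left) algebra
    qed
    then show "(?P has_vector_derivative ?f s + ?w s) (at s within I)"
      by (simp add: has_real_derivative_iff_has_vector_derivative)
  qed (use L_pos in simp)
  moreover have "(?w has_integral integral I ?w) I"
    by (intro integrable_integral integrable_continuous_real continuous_intros cont cont_g2 c)
  ultimately have "((\<lambda>s. ?f s + ?w s - ?w s) has_integral ?P (2*L) - ?P 0 - integral I ?w) I"
    by (rule has_integral_diff)
  then have "integral I ?f = ?P (2*L) - ?P 0 - integral I ?w"
    by (simp add: integral_unique)
  also have "?P (2*L) - ?P 0 = (x1 0 * v1 0 - y1 0 * u1 0) / (H 0)\<^sup>2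
      - (x1 (2*L) * v1 (2*L) - y1 (2*L) * u1 (2*L)) / (H (2*L))\<^sup>2"
    by (simp add: zero)
  finally have F': "integral I ?f = (x1 0 * v1 0 - y1 0 * u1 0) / (H 0)\<^sup>2
      - (x1 (2*L) * v1 (2*L) - y1 (2*L) * u1 (2*L)) / (H (2*L))\<^sup>2 - integral I ?w" .
  let ?n = "\<lambda>s. x1 s * v s - y1 s * u s"
  let ?Q = "\<lambda>s. (fst (\<gamma> s) * v s - snd (\<gamma> s) * u s) / 2"
  have "((\<lambda>s. ?a s + ?n s) has_integral ?Q (2*L) - ?Q 0) I"
  proof (rule fundamental_theorem_of_calculus)
    fix s assume s: "s \<in> I"
    have "(?Q has_real_derivative ?a s + ?n s) (at s within I)"
      by (rule DERIV_cong[OF DERIV_cdivide[OF DERIV_diff[OF DERIV_mult[OF dx[OF s] dv[OF s]]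
              DERIV_mult[OF dy[OF s] du[OF s]]]]]) (simp add: field_simps)
    then show "(?Q has_vector_derivative ?a s + ?n s) (at s within I)"
      by (simp add: has_real_derivative_iff_has_vector_derivative)
  qed (use L_pos in simp)
  moreover have "(?n has_integral integral I ?n) I"
    by (intro integrable_integral integrable_continuous_real continuous_intros cont c)
  ultimately have "((\<lambda>s. ?a s + ?n s - ?n s) has_integral ?Q (2*L) - ?Q 0 - integral I ?n) I"
    by (rule has_integral_diff)
  then have "(?a has_integral - integral I ?n) I"
    by (simp add: zero)
  then have A': "integral I ?a = - integral I ?n"
    by (rule integral_unique)
  show ?thesis
    using that[OF u v du dv v1 F[unfolded F'] A[unfolded A']] by simp
qed

end

section \<open>Sufficiency of the Euler-Lagrange equation\<close>

lemma derivative_nonneg_right: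
  assumes "(f has_real_derivative d) (at a within {c..b})" "c \<le> a" "a < b"
    and "\<And>t. t \<in> {a..b} \<Longrightarrow> f t \<ge> f a"
  shows "d \<ge> (0::real)"
proof (rule ccontr)
  assume "\<not> d \<ge> 0"
  then obtain e where e: "e > 0" "\<And>h. h > 0 \<Longrightarrow> a + h \<in> {c..b} \<Longrightarrow> h < e \<Longrightarrow> f (a + h) < f a"
    using has_real_derivative_neg_dec_right[OF assms(1)] by force
  define h where "h = min (b - a) (e / 2)"
  have "h > 0" "h < e" "h \<le> b - a" using e(1) assms(3) by (auto simp: h_def)
  then show False using e(2)[of h] assms(2) assms(4)[of "a + h"] by auto
qed

lemma derivative_nonpos_left:
  assumes "(f has_real_derivative d) (at a within {c..b})" "c < a" "a \<le> b"
    and "\<And>t. t \<in> {c..a} \<Longrightarrow> f t \<ge> f a"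
  shows "d \<le> (0::real)"
proof (rule ccontr)
  assume "\<not> d \<le> 0"
  then obtain e where e: "e > 0" "\<And>h. h > 0 \<Longrightarrow> a - h \<in> {c..b} \<Longrightarrow> h < e \<Longrightarrow> f (a - h) < f a"
    using has_real_derivative_pos_inc_left[OF assms(1)] by force
  define h where "h = min (a - c) (e / 2)"
  have "h > 0" "h < e" "h \<le> a - c" using e(1) assms(2) by (auto simp: h_def)
  then show False using e(2)[of h] assms(3) assms(4)[of "a - h"] by auto
qed

text \<open>The height is nonnegative on the interval and zero at both ends, so its one-sided
  difference quotients have a sign there. Applied to every curve of a variation, this supplies the
  sign of the boundary terms.\<close>

lemma admissible_end_slopes:
  assumes L: "0 < L" and adm: "admissible x0 L \<gamma>"
  shows "0 \<le> snd (dvec L \<gamma> 0)" "snd (dvec L \<gamma> (2*L)) \<le> 0"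
proof -
  let ?I = "{0..2*L}"
  have C: "Cinf_on ?I \<gamma>" and e: "\<gamma> 0 = (x0, 0)" "\<gamma> (2*L) = (- x0, 0)"
    and pos: "\<And>s. s \<in> {0<..<2*L} \<Longrightarrow> snd (\<gamma> s) > 0"
    using adm by (auto simp: admissible_def)
  have Cx: "Cinf_on ?I (\<lambda>s. fst (\<gamma> s))" and Cy: "Cinf_on ?I (\<lambda>s. snd (\<gamma> s))"
    using Cinf_on_linear[OF bounded_linear_fst C] Cinf_on_linear[OF bounded_linear_snd C] by auto
  obtain x1 where x1: "\<And>s. s \<in> ?I \<Longrightarrow> ((\<lambda>s. fst (\<gamma> s)) has_real_derivative x1 s) (at s within ?I)"
    using Cinf_on_real_derivative[OF Cx] by metis
  obtain y1 where y1: "\<And>s. s \<in> ?I \<Longrightarrow> ((\<lambda>s. snd (\<gamma> s)) has_real_derivative y1 s) (at s within ?I)"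
    using Cinf_on_real_derivative[OF Cy] by metis
  have nonneg: "snd (\<gamma> s) \<ge> 0" if "s \<in> ?I" for s
    using that pos[of s] e by (cases "s = 0 \<or> s = 2*L") auto
  have d: "dvec L \<gamma> s = (x1 s, y1 s)" if "s \<in> ?I" for s
    unfolding dvec_def by (rule vector_derivative_PairI[OF L that x1[OF that] y1[OF that]])
  show "0 \<le> snd (dvec L \<gamma> 0)"
    using derivative_nonneg_right[OF y1[of 0]] nonneg e L by (simp add: d)
  show "snd (dvec L \<gamma> (2*L)) \<le> 0"
    using derivative_nonpos_left[OF y1[of "2*L"]] nonneg e L by (simp add: d)
qed

text \<open>Along an area-preserving variation, \<open>Ffun\<close> and
  \<open>Ffun - lam * area\<close> differ by a constant in t.\<close>

lemma lagr_crit_imp_area_crit: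
  assumes "lagr_crit x0 L lam \<gamma>"
  shows "area_crit x0 L \<gamma>"
proof -
  have *: "((\<lambda>t. Ffun L (\<lambda>s. V s t)) has_real_derivative d) (at 0 within J)"
    if "((\<lambda>t. Ffun L (\<lambda>s. V s t) - lam * area L (\<lambda>s. V s t)) has_real_derivative d) (at 0 within J)"
      "area_preserving L V J" "0 \<in> J" for V J d
  proof (rule has_real_derivative_transform[OF that(3)])
    show "((\<lambda>t. Ffun L (\<lambda>s. V s t) - lam * area L (\<lambda>s. V s t) + lam * area L (\<lambda>s. V s 0))
        has_real_derivative d) (at 0 within J)"
      using DERIV_add[OF that(1) DERIV_const] by simp
  qed (use that(2) in \<open>simp add: area_preserving_def\<close>)
  show ?thesis
    unfolding area_crit_def
  proof (intro conjI allI impI)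
    fix V T assume "T > 0 \<and> is_variation x0 L \<gamma> V {-T..T} \<and> area_preserving L V {-T..T}"
    then show "((\<lambda>t. Ffun L (\<lambda>s. V s t)) has_real_derivative 0) (at 0 within {-T..T})"
      using assms unfolding lagr_crit_def by (intro *) auto
  next
    fix V T assume a: "T > 0 \<and> is_variation x0 L \<gamma> V {0..T} \<and> area_preserving L V {0..T}"
    then obtain d where "d \<ge> 0"
      "((\<lambda>t. Ffun L (\<lambda>s. V s t) - lam * area L (\<lambda>s. V s t)) has_real_derivative d) (at 0 within {0..T})"
      using assms unfolding lagr_crit_def by blast
    then show "\<exists>d\<ge>0. ((\<lambda>t. Ffun L (\<lambda>s. V s t)) has_real_derivative d) (at 0 within {0..T})"
      using *[of V d "{0..T}"] a by auto
  qed (use assms in \<open>simp add: lagr_crit_def\<close>)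
qed

context unit_speed_curve
begin

text \<open>With g'' = lam - 2 the interior integral cancels against lam times the variation of
  area. Tangency at the ends reduces the boundary part to
  \<open>a / (H 0)\<^sup>2 - b / (H (2*L))\<^sup>2\<close>, where a and b are the rates of change of
  the end slopes. These slopes are zero at t = 0 and have fixed signs for all t, hence a = b = 0 for
  two-sided variations, and a \<ge> 0, b \<le> 0 for one-sided ones.\<close>

lemma lagr_critI:
  assumes g2: "\<And>s. s \<in> I \<Longrightarrow> g2 s = lam - 2"
    and ends: "x1 0 = 1" "y1 0 = 0" "x1 (2*L) = 1" "y1 (2*L) = 0"
  shows "lagr_crit x0 L lam \<gamma>"
proof -
  have "\<exists>a b. ((\<lambda>t. Ffun L (\<lambda>s. V s t) - lam * area L (\<lambda>s. V s t)) has_real_derivative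
          a / (H 0)\<^sup>2 - b / (H (2*L))\<^sup>2) (at 0 within {c..d}) \<and>
        ((\<lambda>t. snd (dvec L (\<lambda>s. V s t) 0)) has_real_derivative a) (at 0 within {c..d}) \<and>
        ((\<lambda>t. snd (dvec L (\<lambda>s. V s t) (2*L))) has_real_derivative b) (at 0 within {c..d})"
    if cd: "c < d" "0 \<in> {c..d}" and V: "is_variation x0 L \<gamma> V {c..d}" for V c d
  proof -
    obtain u v u1 v1 where
      du: "\<And>s. s \<in> I \<Longrightarrow> (u has_real_derivative u1 s) (at s within I)"
      and dv: "\<And>s. s \<in> I \<Longrightarrow> (v has_real_derivative v1 s) (at s within I)"
      and v1: "\<And>s. s \<in> I \<Longrightarrow> ((\<lambda>t. snd (dvec L (\<lambda>s. V s t) s)) has_real_derivative v1 s) (at 0 within {c..d})"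
      and F: "((\<lambda>t. Ffun L (\<lambda>s. V s t)) has_real_derivative
        (x1 0 * v1 0 - y1 0 * u1 0) / (H 0)\<^sup>2 - (x1 (2*L) * v1 (2*L) - y1 (2*L) * u1 (2*L)) / (H (2*L))\<^sup>2
        - integral I (\<lambda>s. (2 + g2 s) * (x1 s * v s - y1 s * u s))) (at 0 within {c..d})"
      and A: "((\<lambda>t. area L (\<lambda>s. V s t)) has_real_derivative
        - integral I (\<lambda>s. x1 s * v s - y1 s * u s)) (at 0 within {c..d})"
      by (rule first_variation[OF refl cd V]) (rule that)
    have "integral I (\<lambda>s. (2 + g2 s) * (x1 s * v s - y1 s * u s)) = integral I (\<lambda>s. lam * (x1 s * v s - y1 s * u s))"
      by (rule integral_cong) (simp add: g2)
    also have "\<dots> = lam * integral I (\<lambda>s. x1 s * v s - y1 s * u s)"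
      by simp
    finally have "((\<lambda>t. Ffun L (\<lambda>s. V s t) - lam * area L (\<lambda>s. V s t)) has_real_derivative
        v1 0 / (H 0)\<^sup>2 - v1 (2*L) / (H (2*L))\<^sup>2) (at 0 within {c..d})"
      using DERIV_diff[OF F DERIV_cmult[OF A, of lam]] by (simp add: ends)
    then show ?thesis
      using v1[of 0] v1[of "2*L"] L_pos by auto
  qed note var = this
  have slope: "0 \<le> snd (dvec L (\<lambda>s. V s t) 0)" "snd (dvec L (\<lambda>s. V s t) (2*L)) \<le> 0"
    if "is_variation x0 L \<gamma> V J" "t \<in> J" for V J t
    using that admissible_end_slopes[OF L_pos] unfolding is_variation_def by blast+
  have slope0: "snd (dvec L (\<lambda>s. V s 0) 0) = 0" "snd (dvec L (\<lambda>s. V s 0) (2*L)) = 0"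
    if V: "is_variation x0 L \<gamma> V J" for V J
  proof -
    have "jet2 L (\<lambda>s. V s 0) x1 y1 (\<lambda>s. - H s * y1 s) (\<lambda>s. H s * x1 s)"
      by (rule jet2_cong[OF jet]) (use V in \<open>auto simp: is_variation_def\<close>)
    from jet2_dvec[OF L_pos this] show "snd (dvec L (\<lambda>s. V s 0) 0) = 0" "snd (dvec L (\<lambda>s. V s 0) (2*L)) = 0"
      using L_pos by (simp_all add: ends)
  qed
  have H: "H 0 > 0" "H (2*L) > 0"
    using H_pos L_pos by auto
  have sgn: "a \<ge> 0 \<and> b \<le> 0" if "T > 0" "c \<le> 0" and V: "is_variation x0 L \<gamma> V {c..T}"
    and a: "((\<lambda>t. snd (dvec L (\<lambda>s. V s t) 0)) has_real_derivative a) (at 0 within {c..T})"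
    and b: "((\<lambda>t. snd (dvec L (\<lambda>s. V s t) (2*L))) has_real_derivative b) (at 0 within {c..T})"
    for V T c a b
  proof
    show "a \<ge> 0"
      by (rule derivative_nonneg_right[OF a]) (use that slope[OF V] slope0[OF V] in auto)
    have "- b \<ge> 0"
      by (rule derivative_nonneg_right[OF DERIV_minus[OF b]]) (use that slope[OF V] slope0[OF V] in auto)
    then show "b \<le> 0" by simp
  qed
  show ?thesis
    unfolding lagr_crit_def
  proof (intro conjI allI impI)
    fix V T assume a: "T > 0 \<and> is_variation x0 L \<gamma> V {-T..T}"
    then have V: "is_variation x0 L \<gamma> V {-T..T}" and T: "-T < T" "-T < 0" "0 < T" "-T \<le> 0" "0 \<in> {-T..T}" by auto
    obtain a b where ab: "((\<lambda>t. Ffun L (\<lambda>s. V s t) - lam * area L (\<lambda>s. V s t)) has_real_derivative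
          a / (H 0)\<^sup>2 - b / (H (2*L))\<^sup>2) (at 0 within {-T..T})"
        "((\<lambda>t. snd (dvec L (\<lambda>s. V s t) 0)) has_real_derivative a) (at 0 within {-T..T})"
        "((\<lambda>t. snd (dvec L (\<lambda>s. V s t) (2*L))) has_real_derivative b) (at 0 within {-T..T})"
      using var[OF T(1,5) V] by blast
    have "a \<le> 0"
      by (rule derivative_nonpos_left[OF ab(2)]) (use T slope[OF V] slope0[OF V] in auto)
    moreover have "- b \<le> 0"
      by (rule derivative_nonpos_left[OF DERIV_minus[OF ab(3)]]) (use T slope[OF V] slope0[OF V] in auto)
    ultimately have "a = 0" "b = 0"
      using sgn[OF T(3,4) V ab(2,3)] by auto
    then show "((\<lambda>t. Ffun L (\<lambda>s. V s t) - lam * area L (\<lambda>s. V s t)) has_real_derivative 0) (at 0 within {-T..T})"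
      using ab(1) by simp
  next
    fix V T assume a: "T > 0 \<and> is_variation x0 L \<gamma> V {0..T}"
    then have V: "is_variation x0 L \<gamma> V {0..T}" and T: "0 < T" "0 \<le> (0::real)" "0 \<in> {0..T}" by auto
    obtain a b where ab: "((\<lambda>t. Ffun L (\<lambda>s. V s t) - lam * area L (\<lambda>s. V s t)) has_real_derivative
          a / (H 0)\<^sup>2 - b / (H (2*L))\<^sup>2) (at 0 within {0..T})"
        "((\<lambda>t. snd (dvec L (\<lambda>s. V s t) 0)) has_real_derivative a) (at 0 within {0..T})"
        "((\<lambda>t. snd (dvec L (\<lambda>s. V s t) (2*L))) has_real_derivative b) (at 0 within {0..T})"
      using var[OF T(1,3) V] by blast
    have "a / (H 0)\<^sup>2 - b / (H (2*L))\<^sup>2 \<ge> 0"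
      using sgn[OF T(1,2) V ab(2,3)] by (smt (verit) divide_nonneg_nonneg divide_nonpos_nonneg zero_le_power2)
    then show "\<exists>d\<ge>0. ((\<lambda>t. Ffun L (\<lambda>s. V s t) - lam * area L (\<lambda>s. V s t)) has_real_derivative d) (at 0 within {0..T})"
      using ab(1) by blast
  qed (rule adm)
qed

end

section \<open>Linear variations\<close>

lemma Cinf_on_add_polynomial:
  fixes \<gamma> :: "real \<Rightarrow> 'a::real_normed_vector"
  assumes "Cinf_on A \<gamma>" "real_polynomial_function f"
  shows "Cinf_on A (\<lambda>s. \<gamma> s + f s *\<^sub>R e)"
proof (rule Cinf_on_coinduct[where P = "\<lambda>F. \<exists>\<gamma> f. Cinf_on A \<gamma> \<and> real_polynomial_function f \<and>
    F = (\<lambda>s. \<gamma> s + f s *\<^sub>R e)"])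
  fix F assume "\<exists>\<gamma> f. Cinf_on A \<gamma> \<and> real_polynomial_function f \<and> F = (\<lambda>s. \<gamma> s + f s *\<^sub>R e)"
  then obtain \<gamma> :: "real \<Rightarrow> 'a" and f where C: "Cinf_on A \<gamma>" and f: "real_polynomial_function f"
    and F: "F = (\<lambda>s. \<gamma> s + f s *\<^sub>R e)" by blast
  obtain \<gamma>' where \<gamma>': "\<And>s. s \<in> A \<Longrightarrow> (\<gamma> has_derivative \<gamma>' s) (at s within A)"
    "\<And>h. Cinf_on A (\<lambda>s. \<gamma>' s h)"
    using Cinf_on_derivative[OF C] by blast
  obtain f' where f': "real_polynomial_function f'" "\<And>s. (f has_real_derivative f' s) (at s)"
    using has_real_derivative_polynomial_function[OF f] by blast
  show "\<exists>F'. (\<forall>x\<in>A. (F has_derivative F' x) (at x within A)) \<and>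
      (\<forall>h. \<exists>\<gamma> f. Cinf_on A \<gamma> \<and> real_polynomial_function f \<and> (\<lambda>x. F' x h) = (\<lambda>s. \<gamma> s + f s *\<^sub>R e))"
  proof (rule exI[of _ "\<lambda>s h. \<gamma>' s h + (f' s * h) *\<^sub>R e"], intro conjI ballI allI)
    fix s assume "s \<in> A"
    have "(f has_derivative (\<lambda>h. f' s * h)) (at s within A)"
      using f'(2)[of s] unfolding has_field_derivative_def by (rule has_derivative_at_withinI)
    then show "(F has_derivative (\<lambda>h. \<gamma>' s h + (f' s * h) *\<^sub>R e)) (at s within A)"
      unfolding F by (intro has_derivative_add \<gamma>' \<open>s \<in> A\<close> has_derivative_scaleR_left)
  next
    fix h
    show "\<exists>\<gamma> f. Cinf_on A \<gamma> \<and> real_polynomial_function f \<and>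
        (\<lambda>s. \<gamma>' s h + (f' s * h) *\<^sub>R e) = (\<lambda>s. \<gamma> s + f s *\<^sub>R e)"
      using \<gamma>'(2)[of h] real_polynomial_function.intros(4)[OF f'(1) real_polynomial_function.intros(2)[of h]]
      by blast
  qed
qed (use assms in blast)

text \<open>Differentiating in t removes the factor t and leaves a term constant in t. The class
  closed under derivatives therefore consists of \<gamma> + (t f + r) e with both f and r
  polynomial.\<close>

lemma Cinf_on_linear_family:
  fixes \<gamma> :: "real \<Rightarrow> 'a::real_normed_vector"
  assumes "Cinf_on A \<gamma>" "real_polynomial_function f"
  shows "Cinf_on (A \<times> J) (\<lambda>p. \<gamma> (fst p) + (snd p * f (fst p)) *\<^sub>R e)"
proof -
  define Q where "Q F \<longleftrightarrow> (\<exists>\<gamma> f r. Cinf_on A \<gamma> \<and> real_polynomial_function f \<and> real_polynomial_function r \<and>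
    F = (\<lambda>p. \<gamma> (fst p) + (snd p * f (fst p) + r (fst p)) *\<^sub>R e))" for F :: "real \<times> real \<Rightarrow> 'a"
  show ?thesis
  proof (rule Cinf_on_coinduct[where P = Q])
    have "real_polynomial_function (\<lambda>s. 0 :: real)" by (rule real_polynomial_function.intros)
    then show "Q (\<lambda>p. \<gamma> (fst p) + (snd p * f (fst p)) *\<^sub>R e)"
      unfolding Q_def using assms by (intro exI[of _ \<gamma>] exI[of _ f] exI[of _ "\<lambda>s. 0"]) simp
  next
    fix F assume "Q F"
    then obtain \<gamma> f r where C: "Cinf_on A \<gamma>" and f: "real_polynomial_function f"
      and r: "real_polynomial_function r" and F: "F = (\<lambda>p. \<gamma> (fst p) + (snd p * f (fst p) + r (fst p)) *\<^sub>R e)"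
      unfolding Q_def by blast
    obtain \<gamma>' where \<gamma>': "\<And>s. s \<in> A \<Longrightarrow> (\<gamma> has_derivative \<gamma>' s) (at s within A)"
      "\<And>h. Cinf_on A (\<lambda>s. \<gamma>' s h)"
      using Cinf_on_derivative[OF C] by blast
    obtain f' where f': "real_polynomial_function f'" "\<And>s. (f has_real_derivative f' s) (at s)"
      using has_real_derivative_polynomial_function[OF f] by blast
    obtain r' where r': "real_polynomial_function r'" "\<And>s. (r has_real_derivative r' s) (at s)"
      using has_real_derivative_polynomial_function[OF r] by blast
    let ?D = "\<lambda>p h. \<gamma>' (fst p) (fst h) +
        (snd p * (f' (fst p) * fst h) + snd h * f (fst p) + r' (fst p) * fst h) *\<^sub>R e"
    show "\<exists>F'. (\<forall>x\<in>A \<times> J. (F has_derivative F' x) (at x within A \<times> J)) \<and> (\<forall>h. Q (\<lambda>x. F' x h))"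
    proof (rule exI[of _ ?D], intro conjI ballI allI)
      fix p assume p: "p \<in> A \<times> J"
      have c: "((\<lambda>p. g (fst p)) has_derivative (\<lambda>h. g' (fst p) * fst h)) (at p within A \<times> J)"
        if "\<And>s. (g has_real_derivative g' s) (at s)" for g g' :: "real \<Rightarrow> real"
        using has_derivative_compose[OF has_derivative_fst[OF has_derivative_ident]
            that[of "fst p", unfolded has_field_derivative_def]] .
      have "((\<lambda>p. \<gamma> (fst p)) has_derivative (\<lambda>h. \<gamma>' (fst p) (fst h))) (at p within A \<times> J)"
        by (rule has_derivative_in_compose[OF has_derivative_fst[OF has_derivative_ident]
              has_derivative_subset[OF \<gamma>'(1)]]) (use p in auto)
      then show "(F has_derivative ?D p) (at p within A \<times> J)"
        unfolding F
        by (intro has_derivative_add has_derivative_scaleR_left has_derivative_mult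
            has_derivative_snd has_derivative_ident c f' r')
    next
      fix h :: "real \<times> real"
      have "real_polynomial_function (\<lambda>s. fst h * f' s)" "real_polynomial_function (\<lambda>s. snd h * f s + fst h * r' s)"
        using f f' r' by (auto intro!: real_polynomial_function.intros(2-4))
      then show "Q (\<lambda>p. ?D p h)"
        unfolding Q_def using \<gamma>'(2)[of "fst h"]
        by (intro exI[of _ "\<lambda>s. \<gamma>' s (fst h)"] exI[of _ "\<lambda>s. fst h * f' s"] exI[of _ "\<lambda>s. snd h * f s + fst h * r' s"])
          (simp add: algebra_simps)
    qed
  qed
qed

section \<open>Stability of admissibility under small perturbations\<close>

context unit_speed_curve
begin

lemma abs_le_1: "\<bar>x1 s\<bar> \<le> 1" "\<bar>y1 s\<bar> \<le> 1" if "s \<in> I"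
proof -
  have "(x1 s)\<^sup>2 \<le> 1" "(y1 s)\<^sup>2 \<le> 1"
    using unit[OF that] by (smt (verit) zero_le_power2)+
  then show "\<bar>x1 s\<bar> \<le> 1" "\<bar>y1 s\<bar> \<le> 1"
    by (simp_all only: abs_square_le_1)
qed

lemma cont_curve: "continuous_on I \<gamma>"
  using adm Cinf_on_continuous_on by (auto simp: admissible_def)

text \<open>Injectivity itself is not stable under perturbation, so it is replaced by a quantitative
  form that survives adding a function of small Lipschitz constant. Close to the diagonal the
  projection to a tangent line moves at speed at least 1/2; away from it, compactness and
  injectivity give a positive minimum of the distance.\<close>

lemma bi_lipschitz:
  obtains c where "c > 0" "\<And>s r. s \<in> I \<Longrightarrow> r \<in> I \<Longrightarrow> c * \<bar>s - r\<bar> \<le> norm (\<gamma> s - \<gamma> r)"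
proof -
  have "uniformly_continuous_on I x1" "uniformly_continuous_on I y1"
    by (intro compact_uniformly_continuous cont compact_Icc)+
  then obtain d1 d2 where d: "d1 > 0" "d2 > 0"
    "\<And>s r. s \<in> I \<Longrightarrow> r \<in> I \<Longrightarrow> dist s r < d1 \<Longrightarrow> dist (x1 s) (x1 r) < 1/4"
    "\<And>s r. s \<in> I \<Longrightarrow> r \<in> I \<Longrightarrow> dist s r < d2 \<Longrightarrow> dist (y1 s) (y1 r) < 1/4"
    using uniformly_continuous_onE[of I x1 "1/4"] uniformly_continuous_onE[of I y1 "1/4"]
    by (smt (verit) zero_less_divide_1_iff zero_less_numeral dist_commute)
  define d where "d = min d1 d2"
  have "d > 0" using d by (simp add: d_def)
  have close: "\<bar>s - r\<bar> / 2 \<le> norm (\<gamma> s - \<gamma> r)" if sr: "r < s" "r \<in> I" "s \<in> I" "s - r < d" for s r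
  proof -
    \<comment> \<open>The projection to the tangent at r has as derivative the inner product of T(t)
      and T(r), which uniform continuity of T keeps close to 1.\<close>
    have "((\<lambda>t. fst (\<gamma> t) * x1 r + snd (\<gamma> t) * y1 r) has_derivative (\<lambda>h. (x1 t * x1 r + y1 t * y1 r) * h))
        (at t within {r..s})" if "t \<in> {r..s}" for t
    proof -
      have "((\<lambda>t. fst (\<gamma> t) * x1 r + snd (\<gamma> t) * y1 r) has_real_derivative x1 t * x1 r + y1 t * y1 r) (at t within I)"
        by (intro DERIV_add DERIV_cmult_right dx dy) (use that sr in auto)
      then have "((\<lambda>t. fst (\<gamma> t) * x1 r + snd (\<gamma> t) * y1 r) has_real_derivative x1 t * x1 r + y1 t * y1 r) (at t within {r..s})"
        by (rule DERIV_subset) (use sr in auto)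
      then show ?thesis by (simp add: has_field_derivative_def)
    qed
    then obtain t where t: "t \<in> {r<..<s}"
      "fst (\<gamma> s) * x1 r + snd (\<gamma> s) * y1 r - (fst (\<gamma> r) * x1 r + snd (\<gamma> r) * y1 r) = (x1 t * x1 r + y1 t * y1 r) * (s - r)"
      using mvt_simple[OF sr(1), of "\<lambda>t. fst (\<gamma> t) * x1 r + snd (\<gamma> t) * y1 r" "\<lambda>t h. (x1 t * x1 r + y1 t * y1 r) * h"]
      by auto
    have tI: "t \<in> I" using t sr by auto
    have "\<bar>x1 t - x1 r\<bar> \<le> 1/4" "\<bar>y1 t - y1 r\<bar> \<le> 1/4"
      using d(3)[OF tI sr(2)] d(4)[OF tI sr(2)] t sr(4) by (auto simp: dist_real_def d_def)
    then have "\<bar>(x1 t - x1 r) * x1 r\<bar> \<le> 1/4 * 1" "\<bar>(y1 t - y1 r) * y1 r\<bar> \<le> 1/4 * 1"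
      unfolding abs_mult using abs_le_1[OF sr(2)] by (intro mult_mono; simp)+
    then have "x1 t * x1 r + y1 t * y1 r \<ge> 1/2"
      using unit[OF sr(2)] unfolding left_diff_distrib power2_eq_square by linarith
    then have "(s - r) / 2 \<le> (x1 t * x1 r + y1 t * y1 r) * (s - r)"
      using sr(1) mult_right_mono[of "1/2" _ "s - r"] by simp
    also have "\<dots> = inner (\<gamma> s - \<gamma> r) (x1 r, y1 r)"
      unfolding t(2)[symmetric] by (simp add: inner_prod_def algebra_simps)
    also have "\<dots> \<le> norm (\<gamma> s - \<gamma> r) * norm (x1 r, y1 r)"
      by (rule norm_cauchy_schwarz)
    also have "norm (x1 r, y1 r) = 1" using unit[OF sr(2)] by (simp add: norm_Pair)
    finally show ?thesis using sr(1) by simp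
  qed
  define K where "K = {p \<in> I \<times> I. d \<le> \<bar>fst p - snd p\<bar>}"
  obtain m where m: "m > 0" "\<And>p. p \<in> K \<Longrightarrow> m \<le> norm (\<gamma> (fst p) - \<gamma> (snd p))"
  proof (cases "K = {}")
    case False
    have "closed {p. d \<le> \<bar>fst p - snd p :: real\<bar>}"
      by (intro closed_Collect_le continuous_intros)
    then have "compact K"
      unfolding K_def Collect_conj_eq Collect_mem_eq by (intro compact_Int_closed compact_Times compact_Icc)
    moreover have "continuous_on K (\<lambda>p. norm (\<gamma> (fst p) - \<gamma> (snd p)))"
      by (intro continuous_intros continuous_on_compose2[OF cont_curve]) (auto simp: K_def)
    ultimately obtain p where p: "p \<in> K" "\<And>p'. p' \<in> K \<Longrightarrow> norm (\<gamma> (fst p) - \<gamma> (snd p)) \<le> norm (\<gamma> (fst p') - \<gamma> (snd p'))"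
      using continuous_attains_inf[OF _ False] by blast
    have "\<gamma> (fst p) \<noteq> \<gamma> (snd p)"
      using p(1) \<open>d > 0\<close> adm unfolding K_def admissible_def inj_on_def by fastforce
    then show ?thesis using that[of "norm (\<gamma> (fst p) - \<gamma> (snd p))"] p(2) by simp
  qed (use that[of 1] in auto)
  \<comment> \<open>For distant parameters the factor m / (2L) suffices, as |s - r| is at most
    2L.\<close>
  define c where "c = min (1/2) (m / (2*L))"
  show ?thesis
  proof
    show "c > 0" using m(1) L_pos by (simp add: c_def)
    fix s r assume sr: "s \<in> I" "r \<in> I"
    show "c * \<bar>s - r\<bar> \<le> norm (\<gamma> s - \<gamma> r)"
    proof (cases "d \<le> \<bar>s - r\<bar>")
      case True
      then have "m \<le> norm (\<gamma> s - \<gamma> r)" using m(2)[of "(s, r)"] sr by (simp add: K_def)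
      moreover have "c * \<bar>s - r\<bar> \<le> m / (2*L) * (2*L)"
        by (rule mult_mono) (use sr m(1) L_pos in \<open>auto simp: c_def\<close>)
      ultimately show ?thesis using L_pos by simp
    next
      case False
      have "c * \<bar>s - r\<bar> \<le> 1/2 * \<bar>s - r\<bar>"
        by (rule mult_right_mono) (auto simp: c_def)
      also have "\<dots> \<le> norm (\<gamma> s - \<gamma> r)"
        using close[of r s] close[of s r] sr False
        by (cases s r rule: linorder_cases) (auto simp: norm_minus_commute abs_if)
      finally show ?thesis .
    qed
  qed
qed

text \<open>Positive cross product, injectivity and positive height have to persist for small t. The
  margins are the minimum h of H, the constant b of the bi-Lipschitz bound, and c; the last one
  replaces a positive minimum of y, which does not exist because y vanishes at the ends.\<close>

lemma linear_variation:
  assumes f: "real_polynomial_function f" "f 0 = 0" "f (2*L) = 0"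
    and c: "c > 0" "\<And>s. s \<in> I \<Longrightarrow> c * \<bar>f s\<bar> \<le> snd (\<gamma> s)"
  obtains T where "T > 0" "is_variation x0 L \<gamma> (\<lambda>s t. \<gamma> s + (t * f s) *\<^sub>R e) {-T..T}"
proof -
  obtain f1 where f1: "real_polynomial_function f1" "\<And>s. (f has_real_derivative f1 s) (at s)"
    using has_real_derivative_polynomial_function[OF f(1)] by blast
  obtain f2 where f2: "real_polynomial_function f2" "\<And>s. (f1 has_real_derivative f2 s) (at s)"
    using has_real_derivative_polynomial_function[OF f1(1)] by blast
  have contf: "continuous_on I f1" "continuous_on I f2"
    using f1(1) f2(1) continuous_on_polymonial_function by (auto simp: real_polynomial_function_eq)
  obtain b where b: "b > 0" "\<And>s r. s \<in> I \<Longrightarrow> r \<in> I \<Longrightarrow> b * \<bar>s - r\<bar> \<le> norm (\<gamma> s - \<gamma> r)"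
    using bi_lipschitz by blast
  obtain h where h: "h > 0" "\<And>s. s \<in> I \<Longrightarrow> h \<le> H s"
  proof -
    obtain s where "s \<in> I" "\<And>r. r \<in> I \<Longrightarrow> H s \<le> H r"
      using continuous_attains_inf[OF compact_Icc _ cont(5)] L_pos by fastforce
    then show ?thesis using that[of "H s"] H_pos by blast
  qed
  \<comment> \<open>The coefficient of t in the cross product of velocity and acceleration. There is
    no t^2 term, since f1 e and f2 e are parallel.\<close>
  define a where "a = (\<lambda>s. x1 s * (f2 s * snd e) + f1 s * fst e * (H s * x1 s)
      - y1 s * (f2 s * fst e) + f1 s * snd e * (H s * y1 s))"
  have "continuous_on I a"
    unfolding a_def by (intro continuous_intros cont contf)
  then obtain K1 where K1: "\<And>s. s \<in> I \<Longrightarrow> \<bar>a s\<bar> \<le> K1"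
    using compact_imp_bounded[OF compact_continuous_image[OF _ compact_Icc]]
    by (force simp: bounded_iff)
  obtain K2 where K2: "\<And>s. s \<in> I \<Longrightarrow> \<bar>f1 s\<bar> \<le> K2"
    using compact_imp_bounded[OF compact_continuous_image[OF contf(1) compact_Icc]]
    by (force simp: bounded_iff)
  have "K1 \<ge> 0" "K2 \<ge> 0" using K1[of 0] K2[of 0] L_pos by auto
  have lip: "\<bar>f s - f r\<bar> \<le> K2 * \<bar>s - r\<bar>" if "s \<in> I" "r \<in> I" for s r
    using field_differentiable_bound[of I f f1 K2 s r] f1(2) K2 that
    by (auto intro: has_field_derivative_at_within)
  \<comment> \<open>K strictly exceeds \<open>K1\<close>, \<open>K2 * norm e\<close> and
    \<open>norm e\<close>, so that the single bound |t| \<le> T gives a strict inequality in all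
    three places.\<close>
  define K where "K = 1 + K1 + K2 * norm e + norm e"
  have K: "K > 0" "K1 < K" "K2 * norm e < K" "norm e < K"
    using \<open>K1 \<ge> 0\<close> \<open>K2 \<ge> 0\<close> by (auto simp: K_def add_pos_nonneg add_strict_increasing)
  define T where "T = min h (min b c) / K"
  have "T > 0" using h(1) b(1) c(1) K(1) by (simp add: T_def)
  have T: "\<bar>t\<bar> * k < h" "\<bar>t\<bar> * k < b" "\<bar>t\<bar> * k < c" if "\<bar>t\<bar> \<le> T" "0 \<le> k" "k < K" for t k
  proof -
    have "\<bar>t\<bar> * k \<le> T * k" using that by (intro mult_right_mono)
    also have "\<dots> < T * K" using that \<open>T > 0\<close> by simp
    also have "\<dots> = min h (min b c)" using K(1) by (simp add: T_def)
    finally show "\<bar>t\<bar> * k < h" "\<bar>t\<bar> * k < b" "\<bar>t\<bar> * k < c" by auto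
  qed
  have C: "Cinf_on I \<gamma>" and pos: "\<And>s. s \<in> {0<..<2*L} \<Longrightarrow> snd (\<gamma> s) > 0"
    and ends: "\<gamma> 0 = (x0, 0)" "\<gamma> (2*L) = (- x0, 0)"
    using adm by (auto simp: admissible_def)
  have admt: "admissible x0 L (\<lambda>s. \<gamma> s + (t * f s) *\<^sub>R e)" if t: "t \<in> {-T..T}" for t
  proof -
    have t': "\<bar>t\<bar> \<le> T" using t by auto
    have jet_t: "jet2 L (\<lambda>s. \<gamma> s + (t * f s) *\<^sub>R e) (\<lambda>s. x1 s + t * (f1 s * fst e)) (\<lambda>s. y1 s + t * (f1 s * snd e))
        (\<lambda>s. - H s * y1 s + t * (f2 s * fst e)) (\<lambda>s. H s * x1 s + t * (f2 s * snd e))"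
      unfolding jet2_def fst_add snd_add fst_scaleR snd_scaleR real_scaleR_def mult.assoc
      by (intro ballI conjI DERIV_add DERIV_cmult DERIV_cmult_right dx dy dx1 dy1
          has_field_derivative_at_within[OF f1(2)] has_field_derivative_at_within[OF f2(2)])
    have curv: "dvec L (\<lambda>s. \<gamma> s + (t * f s) *\<^sub>R e) s \<noteq> 0 \<and> curv L (\<lambda>s. \<gamma> s + (t * f s) *\<^sub>R e) s > 0"
      if s: "s \<in> I" for s
    proof -
      have eq: "(x1 s + t * (f1 s * fst e)) * (H s * x1 s + t * (f2 s * snd e))
          - (y1 s + t * (f1 s * snd e)) * (- H s * y1 s + t * (f2 s * fst e)) = H s + t * a s"
        using unit[OF s] unfolding a_def by algebra
      have "\<bar>t * a s\<bar> \<le> \<bar>t\<bar> * K1" unfolding abs_mult using K1[OF s] by (intro mult_left_mono) auto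
      also have "\<dots> < h" using T(1)[OF t' \<open>K1 \<ge> 0\<close> K(2)] .
      also have "\<dots> \<le> H s" using h(2)[OF s] .
      finally have "H s + t * a s > 0" by (simp add: abs_less_iff)
      then show ?thesis
        using jet2_curv_pos[OF L_pos jet_t s] unfolding eq by blast
    qed
    have inj: "inj_on (\<lambda>s. \<gamma> s + (t * f s) *\<^sub>R e) I"
    proof (rule inj_onI, rule ccontr)
      fix s r assume sr: "s \<in> I" "r \<in> I" "\<gamma> s + (t * f s) *\<^sub>R e = \<gamma> r + (t * f r) *\<^sub>R e" "s \<noteq> r"
      then have "\<gamma> s - \<gamma> r = (t * (f r - f s)) *\<^sub>R e"
        by (simp add: algebra_simps)
      then have "norm (\<gamma> s - \<gamma> r) = \<bar>t\<bar> * \<bar>f s - f r\<bar> * norm e"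
        by (simp add: abs_mult abs_minus_commute)
      also have "\<dots> \<le> \<bar>t\<bar> * (K2 * \<bar>s - r\<bar>) * norm e"
        by (intro mult_right_mono mult_left_mono lip sr) auto
      also have "\<dots> = \<bar>t\<bar> * (K2 * norm e) * \<bar>s - r\<bar>" by simp
      also have "\<dots> < b * \<bar>s - r\<bar>"
        using T(2)[OF t' _ K(3)] \<open>K2 \<ge> 0\<close> sr(4) by simp
      finally show False using b(2)[OF sr(1,2)] by simp
    qed
    have "snd (\<gamma> s + (t * f s) *\<^sub>R e) > 0" if s: "s \<in> {0<..<2*L}" for s
    proof -
      have sI: "s \<in> I" using s by auto
      have "\<bar>snd e\<bar> \<le> norm e" using norm_snd_le[of "snd e" "fst e"] by simp
      then have "\<bar>(t * f s) * snd e\<bar> \<le> \<bar>t\<bar> * norm e * \<bar>f s\<bar>"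
        unfolding abs_mult by (simp add: mult_left_mono mult_right_mono mult.assoc mult.commute[of "\<bar>f s\<bar>"])
      also have "\<dots> \<le> \<bar>t\<bar> * norm e * (snd (\<gamma> s) / c)"
        using c(2)[OF sI] c(1) by (intro mult_left_mono) (auto simp: field_simps)
      also have "\<dots> < c * (snd (\<gamma> s) / c)"
        using T(3)[OF t' _ K(4)] pos[OF s] c(1) by (intro mult_strict_right_mono) auto
      also have "\<dots> = snd (\<gamma> s)" using c(1) by simp
      finally show ?thesis by (simp add: abs_less_iff)
    qed
    moreover have "Cinf_on I (\<lambda>s. \<gamma> s + (t * f s) *\<^sub>R e)"
      by (rule Cinf_on_add_polynomial[OF C]) (intro real_polynomial_function.intros(2-4) f)
    ultimately show ?thesis
      unfolding admissible_def using curv inj ends f by simp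
  qed
  have "Cinf_on (I \<times> {-T..T}) (\<lambda>p. \<gamma> (fst p) + (snd p * f (fst p)) *\<^sub>R e)"
    by (rule Cinf_on_linear_family[OF C f(1)])
  then have "is_variation x0 L \<gamma> (\<lambda>s t. \<gamma> s + (t * f s) *\<^sub>R e) {-T..T}"
    unfolding is_variation_def using admt by simp
  with that \<open>T > 0\<close> show ?thesis by blast
qed

end

section \<open>Polynomial test functions and growth bounds near the endpoints\<close>

lemma zero_if_orthogonal_to_polynomials:
  fixes \<phi> :: "real \<Rightarrow> real"
  assumes "a < b" and cont: "continuous_on {a..b} \<phi>"
    and orth: "\<And>r. real_polynomial_function r \<Longrightarrow> integral {a..b} (\<lambda>s. r s * \<phi> s) = 0"
    and "s \<in> {a..b}"
  shows "\<phi> s = 0"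
proof -
  let ?K = "integral {a..b} (\<lambda>s. \<bar>\<phi> s\<bar>)"
  \<comment> \<open>If the polynomial r is within e of \<phi>, orthogonality turns the integral of
    \<phi>^2 into that of (\<phi> - r) \<phi>, which is at most e times the integral of
    |\<phi>|.\<close>
  have sq: "integral {a..b} (\<lambda>s. (\<phi> s)\<^sup>2) \<le> e * ?K" if "e > 0" for e
  proof -
    obtain r where r: "real_polynomial_function r" "\<And>s. s \<in> {a..b} \<Longrightarrow> \<bar>\<phi> s - r s\<bar> < e"
      using Stone_Weierstrass_real_polynomial_function[OF compact_Icc cont \<open>e > 0\<close>] by blast
    have cr: "continuous_on {a..b} r"
      using r(1) continuous_on_polymonial_function real_polynomial_function_eq by blast
    have "integral {a..b} (\<lambda>s. (\<phi> s)\<^sup>2) = integral {a..b} (\<lambda>s. (\<phi> s)\<^sup>2) - integral {a..b} (\<lambda>s. r s * \<phi> s)"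
      using orth[OF r(1)] by simp
    also have "\<dots> = integral {a..b} (\<lambda>s. (\<phi> s)\<^sup>2 - r s * \<phi> s)"
      by (intro integral_diff[symmetric] integrable_continuous_real continuous_intros cont cr)
    also have "\<dots> \<le> integral {a..b} (\<lambda>s. e * \<bar>\<phi> s\<bar>)"
    proof (intro integral_le integrable_continuous_real continuous_intros cont cr)
      fix s assume "s \<in> {a..b}"
      have "(\<phi> s)\<^sup>2 - r s * \<phi> s \<le> \<bar>\<phi> s - r s\<bar> * \<bar>\<phi> s\<bar>"
        unfolding abs_mult[symmetric] by (rule order_trans[OF _ abs_ge_self]) (simp add: algebra_simps power2_eq_square)
      also have "\<dots> \<le> e * \<bar>\<phi> s\<bar>"
        using r(2)[OF \<open>s \<in> {a..b}\<close>] by (intro mult_right_mono) auto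
      finally show "(\<phi> s)\<^sup>2 - r s * \<phi> s \<le> e * \<bar>\<phi> s\<bar>" .
    qed
    also have "\<dots> = e * ?K" by simp
    finally show ?thesis .
  qed
  have "?K \<ge> 0" by (intro integral_nonneg integrable_continuous_real continuous_intros cont) auto
  have "integral {a..b} (\<lambda>s. (\<phi> s)\<^sup>2) \<le> 0"
  proof (rule field_le_epsilon)
    fix e :: real assume "e > 0"
    \<comment> \<open>Adding 1 keeps the denominator positive when the integral of |\<phi>| is
      zero.\<close>
    then have "integral {a..b} (\<lambda>s. (\<phi> s)\<^sup>2) \<le> e / (?K + 1) * ?K"
      using \<open>?K \<ge> 0\<close> by (intro sq) simp
    also have "\<dots> \<le> e" using \<open>?K \<ge> 0\<close> \<open>e > 0\<close> by (simp add: field_simps)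
    finally show "integral {a..b} (\<lambda>s. (\<phi> s)\<^sup>2) \<le> 0 + e" by simp
  qed
  moreover have "integral {a..b} (\<lambda>s. (\<phi> s)\<^sup>2) \<ge> 0"
    by (intro integral_nonneg integrable_continuous_real continuous_intros cont) auto
  ultimately have "\<forall>s\<in>{a..b}. (\<phi> s)\<^sup>2 = 0"
    using integral_eq_0_iff[of a b "\<lambda>s. (\<phi> s)\<^sup>2"] cont \<open>a < b\<close> by (auto intro!: continuous_intros)
  with \<open>s \<in> {a..b}\<close> show ?thesis by simp
qed

lemma mvt_within:
  assumes "\<And>s. s \<in> {0..M} \<Longrightarrow> (f has_real_derivative f' s) (at s within {0..M})" "0 \<le> a" "a < b" "b \<le> M"
  obtains t where "t \<in> {a<..<b}" "f b - f a = f' t * (b - a)"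
proof -
  have "(f has_derivative (\<lambda>h. f' t * h)) (at t within {a..b})" if "a \<le> t" "t \<le> b" for t
    using DERIV_subset[OF assms(1), of t "{a..b}"] that assms(2-4)
    by (auto simp: has_field_derivative_def)
  then show ?thesis
    using mvt_simple[OF assms(3), of f "\<lambda>t h. f' t * h"] that by auto
qed

lemma continuous_gt_near_0:
  fixes f :: "real \<Rightarrow> real"
  assumes "continuous_on {0..M} f" "M > 0" "c < f 0"
  obtains \<delta> where "\<delta> > 0" "\<delta> \<le> M" "\<And>s. s \<in> {0..\<delta>} \<Longrightarrow> c < f s"
proof -
  obtain d where d: "d > 0" "\<And>s. s \<in> {0..M} \<Longrightarrow> dist s 0 < d \<Longrightarrow> dist (f s) (f 0) < f 0 - c"
    using assms unfolding continuous_on_iff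
    by (metis atLeastAtMost_iff diff_gt_0_iff_gt less_imp_le order_refl)
  have "c < f s" if "s \<in> {0..min M (d / 2)}" for s
    using d(2)[of s] that d(1) by (auto simp: dist_real_def abs_if split: if_splits)
  then show ?thesis using that[of "min M (d / 2)"] d(1) assms(2) by auto
qed

text \<open>Meant for the height of a curve near an endpoint on the axis: its order of growth
  decides to which order a weight must vanish in order to be dominated by it. Nonnegativity excludes
  a negative first nonvanishing derivative, and the mean value theorem turns a positive derivative
  into a lower bound.\<close>

lemma endpoint_growth:
  fixes y :: "real \<Rightarrow> real"
  assumes M: "M > 0" and y0: "y 0 = 0"
    and dy: "\<And>s. s \<in> {0..M} \<Longrightarrow> (y has_real_derivative y1 s) (at s within {0..M})"
    and dy1: "\<And>s. s \<in> {0..M} \<Longrightarrow> (y1 has_real_derivative y2 s) (at s within {0..M})"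
    and cont: "continuous_on {0..M} y2"
    and nonneg: "\<And>s. s \<in> {0..M} \<Longrightarrow> y s \<ge> 0"
  shows "y1 0 \<ge> 0" "y1 0 = 0 \<Longrightarrow> y2 0 \<ge> 0"
    "y1 0 > 0 \<Longrightarrow> \<exists>\<delta>>0. \<exists>c>0. \<forall>s\<in>{0..\<delta>}. \<delta> \<le> M \<and> c * s \<le> y s"
    "y1 0 > 0 \<or> y2 0 > 0 \<Longrightarrow> \<exists>\<delta>>0. \<exists>c>0. \<forall>s\<in>{0..\<delta>}. \<delta> \<le> M \<and> c * s\<^sup>2 \<le> y s"
proof -
  show nn: "y1 0 \<ge> 0"
    by (rule derivative_nonneg_right[OF dy]) (use M y0 nonneg in auto)
  have cont1: "continuous_on {0..M} y1" by (rule DERIV_continuous_on[OF dy1])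
  show "y2 0 \<ge> 0" if z: "y1 0 = 0"
  proof (rule ccontr)
    assume "\<not> y2 0 \<ge> 0"
    then obtain \<delta> where \<delta>: "\<delta> > 0" "\<delta> \<le> M" "\<And>s. s \<in> {0..\<delta>} \<Longrightarrow> 0 < - y2 s"
      using continuous_gt_near_0[of M "\<lambda>s. - y2 s" 0] cont M by (auto intro: continuous_intros)
    obtain t where t: "t \<in> {0<..<\<delta>}" "y \<delta> - y 0 = y1 t * (\<delta> - 0)"
      by (rule mvt_within[OF dy, of 0 \<delta>]) (use \<delta> in auto)
    obtain r where r: "r \<in> {0<..<t}" "y1 t - y1 0 = y2 r * (t - 0)"
      by (rule mvt_within[OF dy1, of 0 t]) (use \<delta> t in auto)
    have "y1 t < 0" using r \<delta>(3)[of r] t z by (auto simp: mult_neg_pos)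
    then have "y \<delta> < 0" using t(2) \<delta>(1) y0 by (simp add: mult_neg_pos)
    then show False using nonneg[of \<delta>] \<delta> by auto
  qed
  have linear: "\<exists>\<delta>>0. \<exists>c>0. \<forall>s\<in>{0..\<delta>}. \<delta> \<le> M \<and> c * s \<le> y s" if p: "y1 0 > 0"
  proof -
    obtain \<delta> where \<delta>: "\<delta> > 0" "\<delta> \<le> M" "\<And>s. s \<in> {0..\<delta>} \<Longrightarrow> y1 0 / 2 < y1 s"
      using continuous_gt_near_0[OF cont1 M, of "y1 0 / 2"] p by auto
    have "y1 0 / 2 * s \<le> y s" if s: "s \<in> {0..\<delta>}" for s
    proof (cases "s = 0")
      case False
      obtain t where t: "t \<in> {0<..<s}" "y s - y 0 = y1 t * (s - 0)"
        by (rule mvt_within[OF dy, of 0 s]) (use \<delta> s False in auto)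
      then show ?thesis using y0 \<delta>(3)[of t] s by (auto intro!: mult_right_mono)
    qed (use y0 in simp)
    with \<delta> p show ?thesis by (intro exI[of _ \<delta>] exI[of _ "y1 0 / 2"] conjI ballI) auto
  qed
  then show "y1 0 > 0 \<Longrightarrow> \<exists>\<delta>>0. \<exists>c>0. \<forall>s\<in>{0..\<delta>}. \<delta> \<le> M \<and> c * s \<le> y s" .
  show "\<exists>\<delta>>0. \<exists>c>0. \<forall>s\<in>{0..\<delta>}. \<delta> \<le> M \<and> c * s\<^sup>2 \<le> y s" if "y1 0 > 0 \<or> y2 0 > 0"
  proof (cases "y1 0 > 0")
    case True
    then obtain \<delta> c where \<delta>: "\<delta> > 0" "c > 0" "\<And>s. s \<in> {0..\<delta>} \<Longrightarrow> \<delta> \<le> M \<and> c * s \<le> y s"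
      using linear by blast
    \<comment> \<open>From s \<le> \<delta> follows s^2 \<le> \<delta> s, so the linear bound
      implies a quadratic one.\<close>
    have "c / \<delta> * s\<^sup>2 \<le> y s" if s: "s \<in> {0..\<delta>}" for s
    proof -
      have "c / \<delta> * s\<^sup>2 \<le> c / \<delta> * (\<delta> * s)"
        unfolding power2_eq_square using s \<delta>(1,2) by (intro mult_left_mono mult_right_mono) auto
      also have "\<dots> = c * s" using \<delta>(1) by simp
      finally show ?thesis using \<delta>(3)[OF s] by simp
    qed
    with \<delta> show ?thesis by (intro exI[of _ \<delta>] exI[of _ "c / \<delta>"] conjI ballI) auto
  next
    case False
    then have z: "y1 0 = 0" and p: "y2 0 > 0" using nn that by auto
    obtain \<delta> where \<delta>: "\<delta> > 0" "\<delta> \<le> M" "\<And>s. s \<in> {0..\<delta>} \<Longrightarrow> y2 0 / 2 < y2 s"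
      using continuous_gt_near_0[OF cont M, of "y2 0 / 2"] p by auto
    \<comment> \<open>The comparison function has half the Taylor coefficient
      \<open>y2 0 / 2\<close>, which leaves room for the variation of \<open>y2\<close> near
      0.\<close>
    have der: "((\<lambda>s. y s - y2 0 / 4 * s\<^sup>2) has_real_derivative y1 s - y2 0 / 2 * s) (at s within {0..M})"
      if "s \<in> {0..M}" for s
      by (rule derivative_eq_intros dy[OF that] refl)+ (simp add: field_simps)
    have "y2 0 / 4 * s\<^sup>2 \<le> y s" if s: "s \<in> {0..\<delta>}" for s
    proof (cases "s = 0")
      case False
      obtain t where t: "t \<in> {0<..<s}" "(y s - y2 0 / 4 * s\<^sup>2) - (y 0 - y2 0 / 4 * 0\<^sup>2) = (y1 t - y2 0 / 2 * t) * (s - 0)"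
        by (rule mvt_within[OF der, of 0 s]) (use \<delta> s False in auto)
      obtain r where r: "r \<in> {0<..<t}" "y1 t - y1 0 = y2 r * (t - 0)"
        by (rule mvt_within[OF dy1, of 0 t]) (use \<delta> s t in auto)
      have "y2 0 / 2 * t \<le> y1 t" using r z \<delta>(3)[of r] t s by (auto intro!: mult_right_mono)
      then have "0 \<le> (y1 t - y2 0 / 2 * t) * (s - 0)" using s by (intro mult_nonneg_nonneg) auto
      then show ?thesis unfolding t(2)[symmetric] using y0 by simp
    qed (use y0 in simp)
    with \<delta> p show ?thesis by (intro exI[of _ \<delta>] exI[of _ "y2 0 / 4"] conjI ballI) auto
  qed
qed

text \<open>The bounds next to the two ends are combined with a positive minimum of y on the compact
  middle part, where it is enough that f is bounded. The denominator K + 1 in the choice of b cannot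
  vanish.\<close>

lemma lower_bound_from_endpoints:
  fixes y f :: "real \<Rightarrow> real"
  assumes M: "M > 0" and y: "continuous_on {0..M} y" and f: "continuous_on {0..M} f"
    and pos: "\<And>s. s \<in> {0<..<M} \<Longrightarrow> y s > 0"
    and left: "\<delta> > 0" "c > 0" "\<And>s. s \<in> {0..\<delta>} \<Longrightarrow> \<delta> \<le> M \<and> c * \<bar>f s\<bar> \<le> y s"
    and right: "\<delta>' > 0" "c' > 0" "\<And>s. s \<in> {0..\<delta>'} \<Longrightarrow> \<delta>' \<le> M \<and> c' * \<bar>f (M - s)\<bar> \<le> y (M - s)"
  obtains b where "b > 0" "\<And>s. s \<in> {0..M} \<Longrightarrow> b * \<bar>f s\<bar> \<le> y s"
proof -
  obtain K where K: "\<And>s. s \<in> {0..M} \<Longrightarrow> \<bar>f s\<bar> \<le> K"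
    using compact_imp_bounded[OF compact_continuous_image[OF f compact_Icc]] by (force simp: bounded_iff)
  have "K \<ge> 0" using K[of 0] M by auto
  obtain m where m: "m > 0" "\<And>s. s \<in> {\<delta>..M - \<delta>'} \<Longrightarrow> m \<le> y s"
  proof (cases "{\<delta>..M - \<delta>'} = {}")
    case False
    have "continuous_on {\<delta>..M - \<delta>'} y" by (rule continuous_on_subset[OF y]) (use left(1) right(1) in auto)
    then obtain s where s: "s \<in> {\<delta>..M - \<delta>'}" "\<And>r. r \<in> {\<delta>..M - \<delta>'} \<Longrightarrow> y s \<le> y r"
      using continuous_attains_inf[OF compact_Icc False] by blast
    then show ?thesis using that[of "y s"] pos[of s] left(1) right(1) by auto
  qed (use that[of 1] in auto)
  define b where "b = min (min c c') (m / (K + 1))"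
  show ?thesis
  proof
    show "b > 0" using left(2) right(2) m(1) \<open>K \<ge> 0\<close> by (simp add: b_def)
    fix s assume s: "s \<in> {0..M}"
    consider "s \<in> {0..\<delta>}" | "M - s \<in> {0..\<delta>'}" | "s \<in> {\<delta>..M - \<delta>'}" using s by fastforce
    then show "b * \<bar>f s\<bar> \<le> y s"
    proof cases
      case 1
      have "b * \<bar>f s\<bar> \<le> c * \<bar>f s\<bar>" by (rule mult_right_mono) (auto simp: b_def)
      then show ?thesis using left(3)[OF 1] by simp
    next
      case 2
      have "b * \<bar>f s\<bar> \<le> c' * \<bar>f s\<bar>" by (rule mult_right_mono) (auto simp: b_def)
      then show ?thesis using right(3)[OF 2] by simp
    next
      case 3
      have "b * \<bar>f s\<bar> \<le> m / (K + 1) * (K + 1)"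
        using K[OF s] m(1) \<open>K \<ge> 0\<close> by (intro mult_mono) (auto simp: b_def)
      then show ?thesis using m(2)[OF 3] \<open>K \<ge> 0\<close> by simp
    qed
  qed
qed

text \<open>A bounded factor r costs only the constant K + 1, so growth bounds for the pure power w
  carry over to its polynomial multiples.\<close>

lemma lower_bound_multiple:
  fixes y r w f :: "real \<Rightarrow> real"
  assumes "\<And>s. s \<in> {0..M} \<Longrightarrow> \<bar>r s\<bar> \<le> K" "\<exists>\<delta>>0. \<exists>c>0. \<forall>s\<in>{0..\<delta>}. \<delta> \<le> M \<and> c * w s \<le> y s"
    and "\<And>s. s \<in> {0..M} \<Longrightarrow> w s \<ge> 0" "\<And>s. f s = w s * r s"
  obtains \<delta> c where "\<delta> > 0" "c > 0" "\<And>s. s \<in> {0..\<delta>} \<Longrightarrow> \<delta> \<le> M \<and> c * \<bar>f s\<bar> \<le> y s"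
proof -
  obtain \<delta> c where \<delta>: "\<delta> > 0" "c > 0" "\<And>s. s \<in> {0..\<delta>} \<Longrightarrow> \<delta> \<le> M \<and> c * w s \<le> y s"
    using assms(2) by blast
  have "\<delta> \<le> M" using \<delta>(3)[of 0] \<delta>(1) by simp
  then have "K \<ge> 0" using assms(1)[of 0] \<delta>(1) by auto
  have "\<delta> \<le> M \<and> c / (K + 1) * \<bar>f s\<bar> \<le> y s" if s: "s \<in> {0..\<delta>}" for s
  proof -
    have sM: "s \<in> {0..M}" using s \<open>\<delta> \<le> M\<close> by auto
    have "c / (K + 1) * \<bar>f s\<bar> \<le> c / (K + 1) * (w s * (K + 1))"
      unfolding assms(4) abs_mult using assms(1,3)[OF sM] \<delta>(2) \<open>K \<ge> 0\<close>
      by (intro mult_left_mono mult_mono) auto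
    also have "\<dots> = c * w s" using \<open>K \<ge> 0\<close> by simp
    finally show ?thesis using \<delta>(3)[OF s] by simp
  qed
  then show ?thesis using that[of \<delta> "c / (K + 1)"] \<delta>(1,2) \<open>K \<ge> 0\<close> by simp
qed

section \<open>Necessary conditions for critical points\<close>

context unit_speed_curve
begin

definition normal_part :: "real \<times> real \<Rightarrow> real \<Rightarrow> real" where
  "normal_part e s = x1 s * snd e - y1 s * fst e"

text \<open>The last clause keeps \<open>\<gamma> s + (t * f s) *\<^sub>R e\<close> above the axis
  for small t of either sign, uniformly up to the ends, where y tends to 0.\<close>

definition variation_weight :: "(real \<Rightarrow> real) \<Rightarrow> bool" where
  "variation_weight f \<longleftrightarrow> real_polynomial_function f \<and> f 0 = 0 \<and> f (2*L) = 0 \<and>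
     (\<exists>c>0. \<forall>s\<in>I. c * \<bar>f s\<bar> \<le> snd (\<gamma> s))"

lemma cont_normal_part: "continuous_on I (normal_part e)"
  unfolding normal_part_def by (intro continuous_intros cont)

lemma cont_polynomial: "real_polynomial_function f \<Longrightarrow> continuous_on A f" for f :: "real \<Rightarrow> real"
  using continuous_on_polymonial_function real_polynomial_function_eq by blast

text \<open>The quadratic term of the area carries the cross product of e with itself, so the area
  is affine in t on the whole line. Its slope \<open>integral I a1\<close> is not integrated by
  parts again but identified by comparison with the first variation of area at t = 0.\<close>

lemma linear_variation_derivatives:
  assumes f: "variation_weight f" and f1: "\<And>s. (f has_real_derivative f1 s) (at s)"
  obtains T where "T > 0" "is_variation x0 L \<gamma> (\<lambda>s t. \<gamma> s + (t * f s) *\<^sub>R e) {-T..T}"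
    "((\<lambda>t. Ffun L (\<lambda>s. \<gamma> s + (t * f s) *\<^sub>R e)) has_real_derivative
        f1 0 * normal_part e 0 / (H 0)\<^sup>2 - f1 (2*L) * normal_part e (2*L) / (H (2*L))\<^sup>2
        - integral I (\<lambda>s. (2 + g2 s) * (f s * normal_part e s))) (at 0 within {-T..T})"
    "\<And>t. area L (\<lambda>s. \<gamma> s + (t * f s) *\<^sub>R e) = area L \<gamma> - t * integral I (\<lambda>s. f s * normal_part e s)"
proof -
  obtain c where c: "c > 0" "\<And>s. s \<in> I \<Longrightarrow> c * \<bar>f s\<bar> \<le> snd (\<gamma> s)"
    using f unfolding variation_weight_def by blast
  have fp: "real_polynomial_function f" "f 0 = 0" "f (2*L) = 0"
    using f unfolding variation_weight_def by auto
  obtain T where T: "T > 0" and V: "is_variation x0 L \<gamma> (\<lambda>s t. \<gamma> s + (t * f s) *\<^sub>R e) {-T..T}"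
    using linear_variation[OF fp c] by blast
  have J: "-T < T" "0 \<in> {-T..T}" using T by auto
  have J0: "at 0 within {-T..T} \<noteq> bot"
    using T by (simp add: trivial_limit_within)
  obtain u v u1 v1 where
    u: "\<And>s. s \<in> I \<Longrightarrow> ((\<lambda>t. fst (\<gamma> s + (t * f s) *\<^sub>R e)) has_real_derivative u s) (at 0 within {-T..T})"
    and v: "\<And>s. s \<in> I \<Longrightarrow> ((\<lambda>t. snd (\<gamma> s + (t * f s) *\<^sub>R e)) has_real_derivative v s) (at 0 within {-T..T})"
    and du: "\<And>s. s \<in> I \<Longrightarrow> (u has_real_derivative u1 s) (at s within I)"
    and dv: "\<And>s. s \<in> I \<Longrightarrow> (v has_real_derivative v1 s) (at s within I)"
    and F: "((\<lambda>t. Ffun L (\<lambda>s. \<gamma> s + (t * f s) *\<^sub>R e)) has_real_derivative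
        (x1 0 * v1 0 - y1 0 * u1 0) / (H 0)\<^sup>2 - (x1 (2*L) * v1 (2*L) - y1 (2*L) * u1 (2*L)) / (H (2*L))\<^sup>2
        - integral I (\<lambda>s. (2 + g2 s) * (x1 s * v s - y1 s * u s))) (at 0 within {-T..T})"
    and A: "((\<lambda>t. area L (\<lambda>s. \<gamma> s + (t * f s) *\<^sub>R e)) has_real_derivative
        - integral I (\<lambda>s. x1 s * v s - y1 s * u s)) (at 0 within {-T..T})"
    by (rule first_variation[OF refl J V]) (rule that)
  have lin: "((\<lambda>t. a + t * f s * b) has_real_derivative f s * b) (at 0 within {-T..T})" for s a b
    by (rule derivative_eq_intros refl)+ simp
  have ueq: "u s = f s * fst e" and veq: "v s = f s * snd e" if "s \<in> I" for s
  proof -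
    have d: "((\<lambda>t. fst (\<gamma> s + (t * f s) *\<^sub>R e)) has_real_derivative f s * fst e) (at 0 within {-T..T})"
      "((\<lambda>t. snd (\<gamma> s + (t * f s) *\<^sub>R e)) has_real_derivative f s * snd e) (at 0 within {-T..T})"
      unfolding fst_add snd_add fst_scaleR snd_scaleR real_scaleR_def by (rule lin)+
    show "u s = f s * fst e" by (rule has_field_derivative_unique[OF u[OF that] d(1) J0])
    show "v s = f s * snd e" by (rule has_field_derivative_unique[OF v[OF that] d(2) J0])
  qed
  have u1eq: "u1 s = f1 s * fst e" and v1eq: "v1 s = f1 s * snd e" if "s \<in> I" for s
  proof -
    have "(u has_real_derivative f1 s * fst e) (at s within I)"
      by (rule has_real_derivative_transform[OF that ueq DERIV_cmult_right[OF has_field_derivative_at_within[OF f1]]])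
    then show "u1 s = f1 s * fst e"
      by (rule has_field_derivative_unique[OF du[OF that] _ not_bot[OF that]])
    have "(v has_real_derivative f1 s * snd e) (at s within I)"
      by (rule has_real_derivative_transform[OF that veq DERIV_cmult_right[OF has_field_derivative_at_within[OF f1]]])
    then show "v1 s = f1 s * snd e"
      by (rule has_field_derivative_unique[OF dv[OF that] _ not_bot[OF that]])
  qed
  have n: "x1 s * v s - y1 s * u s = f s * normal_part e s" if "s \<in> I" for s
    unfolding ueq[OF that] veq[OF that] normal_part_def by (simp add: algebra_simps)
  have n1: "x1 s * v1 s - y1 s * u1 s = f1 s * normal_part e s" if "s \<in> I" for s
    unfolding u1eq[OF that] v1eq[OF that] normal_part_def by (simp add: algebra_simps)
  have ends: "0 \<in> I" "2*L \<in> I" using L_pos by auto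
  have i1: "integral I (\<lambda>s. (2 + g2 s) * (x1 s * v s - y1 s * u s)) = integral I (\<lambda>s. (2 + g2 s) * (f s * normal_part e s))"
    by (rule integral_cong) (simp only: n)
  have i2: "integral I (\<lambda>s. x1 s * v s - y1 s * u s) = integral I (\<lambda>s. f s * normal_part e s)"
    by (rule integral_cong) (simp only: n)
  obtain f2 where f2: "\<And>s. (f1 has_real_derivative f2 s) (at s)" and contf: "continuous_on I f" "continuous_on I f1"
  proof -
    obtain f1' where f1': "real_polynomial_function f1'" "\<And>s. (f has_real_derivative f1' s) (at s)"
      using has_real_derivative_polynomial_function[OF fp(1)] by blast
    have "f1' = f1" by (rule ext) (rule DERIV_unique[OF f1'(2) f1])
    obtain f2 where "\<And>s. (f1' has_real_derivative f2 s) (at s)"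
      using has_real_derivative_polynomial_function[OF f1'(1)] by blast
    then have f2: "\<And>s. (f1 has_real_derivative f2 s) (at s)"
      unfolding \<open>f1' = f1\<close> .
    show ?thesis
      by (rule that[OF f2 cont_polynomial[OF fp(1)] cont_polynomial[OF f1'(1), unfolded \<open>f1' = f1\<close>]])
  qed
  define a0 where "a0 = (\<lambda>s. (fst (\<gamma> s) * y1 s - x1 s * snd (\<gamma> s)) / 2)"
  define a1 where "a1 = (\<lambda>s. (f s * fst e * y1 s + fst (\<gamma> s) * (f1 s * snd e)
      - x1 s * (f s * snd e) - f1 s * fst e * snd (\<gamma> s)) / 2)"
  have "continuous_on I a0"
    unfolding a0_def by (intro continuous_intros cont(3,4) cont_curve) simp
  moreover have "continuous_on I a1"
    unfolding a1_def by (intro continuous_intros cont(3,4) cont_curve contf) simp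
  ultimately have int: "a0 integrable_on I" "a1 integrable_on I"
    by (auto intro: integrable_continuous_real)
  have area: "area L (\<lambda>s. \<gamma> s + (t * f s) *\<^sub>R e) = area L \<gamma> + t * integral I a1" for t
  proof -
    have jet_t: "jet2 L (\<lambda>s. \<gamma> s + (t * f s) *\<^sub>R e) (\<lambda>s. x1 s + t * (f1 s * fst e)) (\<lambda>s. y1 s + t * (f1 s * snd e))
        (\<lambda>s. - H s * y1 s + t * (f2 s * fst e)) (\<lambda>s. H s * x1 s + t * (f2 s * snd e))"
      unfolding jet2_def fst_add snd_add fst_scaleR snd_scaleR real_scaleR_def mult.assoc
      by (intro ballI conjI DERIV_add DERIV_cmult DERIV_cmult_right dx dy dx1 dy1
          has_field_derivative_at_within[OF f1] has_field_derivative_at_within[OF f2])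
    have "area L (\<lambda>s. \<gamma> s + (t * f s) *\<^sub>R e) = integral I (\<lambda>s. a0 s + t * a1 s)"
      unfolding jet2_area[OF L_pos jet_t]
      by (rule integral_cong) (simp add: a0_def a1_def field_simps)
    also have "\<dots> = integral I a0 + t * integral I a1"
      using int by (subst integral_add) (auto intro: integrable_on_mult_right)
    also have "integral I a0 = area L \<gamma>"
      unfolding jet2_area[OF L_pos jet] a0_def ..
    finally show ?thesis .
  qed
  have "((\<lambda>t. area L (\<lambda>s. \<gamma> s + (t * f s) *\<^sub>R e)) has_real_derivative integral I a1) (at 0 within {-T..T})"
    unfolding area by (rule derivative_eq_intros refl)+ simp
  then have "integral I a1 = - integral I (\<lambda>s. f s * normal_part e s)"
    using has_field_derivative_unique[OF A _ J0] i2 by simp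
  then have area': "area L (\<lambda>s. \<gamma> s + (t * f s) *\<^sub>R e) = area L \<gamma> - t * integral I (\<lambda>s. f s * normal_part e s)" for t
    unfolding area by simp
  show ?thesis
    using that[OF T V F[unfolded i1 n1[OF ends(1)] n1[OF ends(2)]] area'] .
qed

text \<open>Since the area is affine in t, a vanishing slope makes the variation area-preserving for
  all t, and the two-sided condition applies to it directly.\<close>

lemma area_crit_linear:
  assumes "area_crit x0 L \<gamma>" "variation_weight f" "\<And>s. (f has_real_derivative f1 s) (at s)"
    and "integral I (\<lambda>s. f s * normal_part e s) = 0"
  shows "f1 0 * normal_part e 0 / (H 0)\<^sup>2 - f1 (2*L) * normal_part e (2*L) / (H (2*L))\<^sup>2
        = integral I (\<lambda>s. (2 + g2 s) * (f s * normal_part e s))"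
proof -
  obtain T where T: "T > 0" and V: "is_variation x0 L \<gamma> (\<lambda>s t. \<gamma> s + (t * f s) *\<^sub>R e) {-T..T}"
    and F: "((\<lambda>t. Ffun L (\<lambda>s. \<gamma> s + (t * f s) *\<^sub>R e)) has_real_derivative
        f1 0 * normal_part e 0 / (H 0)\<^sup>2 - f1 (2*L) * normal_part e (2*L) / (H (2*L))\<^sup>2
        - integral I (\<lambda>s. (2 + g2 s) * (f s * normal_part e s))) (at 0 within {-T..T})"
    and A: "\<And>t. area L (\<lambda>s. \<gamma> s + (t * f s) *\<^sub>R e) = area L \<gamma> - t * integral I (\<lambda>s. f s * normal_part e s)"
    by (rule linear_variation_derivatives[OF assms(2,3)]) (rule that)
  have "area_preserving L (\<lambda>s t. \<gamma> s + (t * f s) *\<^sub>R e) {-T..T}"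
    unfolding area_preserving_def A assms(4) by simp
  then have "((\<lambda>t. Ffun L (\<lambda>s. \<gamma> s + (t * f s) *\<^sub>R e)) has_real_derivative 0) (at 0 within {-T..T})"
    using assms(1) V T unfolding area_crit_def by blast
  moreover have "at 0 within {-T..T} \<noteq> bot"
    using T by (simp add: trivial_limit_within)
  ultimately show ?thesis
    using has_field_derivative_unique[OF F] by fastforce
qed

lemma lagr_crit_linear:
  assumes "lagr_crit x0 L lam \<gamma>" "variation_weight f" "\<And>s. (f has_real_derivative f1 s) (at s)"
  shows "f1 0 * normal_part e 0 / (H 0)\<^sup>2 - f1 (2*L) * normal_part e (2*L) / (H (2*L))\<^sup>2
        = integral I (\<lambda>s. (2 + g2 s) * (f s * normal_part e s)) - lam * integral I (\<lambda>s. f s * normal_part e s)"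
proof -
  obtain T where T: "T > 0" and V: "is_variation x0 L \<gamma> (\<lambda>s t. \<gamma> s + (t * f s) *\<^sub>R e) {-T..T}"
    and F: "((\<lambda>t. Ffun L (\<lambda>s. \<gamma> s + (t * f s) *\<^sub>R e)) has_real_derivative
        f1 0 * normal_part e 0 / (H 0)\<^sup>2 - f1 (2*L) * normal_part e (2*L) / (H (2*L))\<^sup>2
        - integral I (\<lambda>s. (2 + g2 s) * (f s * normal_part e s))) (at 0 within {-T..T})"
    and A: "\<And>t. area L (\<lambda>s. \<gamma> s + (t * f s) *\<^sub>R e) = area L \<gamma> - t * integral I (\<lambda>s. f s * normal_part e s)"
    by (rule linear_variation_derivatives[OF assms(2,3)]) (rule that)
  have "((\<lambda>t. area L (\<lambda>s. \<gamma> s + (t * f s) *\<^sub>R e)) has_real_derivative - integral I (\<lambda>s. f s * normal_part e s))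
      (at 0 within {-T..T})"
    unfolding A by (rule derivative_eq_intros refl)+ simp
  from DERIV_diff[OF F DERIV_cmult[OF this, of lam]]
  have "((\<lambda>t. Ffun L (\<lambda>s. \<gamma> s + (t * f s) *\<^sub>R e) - lam * area L (\<lambda>s. \<gamma> s + (t * f s) *\<^sub>R e)) has_real_derivative
      f1 0 * normal_part e 0 / (H 0)\<^sup>2 - f1 (2*L) * normal_part e (2*L) / (H (2*L))\<^sup>2
        - integral I (\<lambda>s. (2 + g2 s) * (f s * normal_part e s)) + lam * integral I (\<lambda>s. f s * normal_part e s)) (at 0 within {-T..T})"
    by simp
  moreover have "((\<lambda>t. Ffun L (\<lambda>s. \<gamma> s + (t * f s) *\<^sub>R e) - lam * area L (\<lambda>s. \<gamma> s + (t * f s) *\<^sub>R e))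
      has_real_derivative 0) (at 0 within {-T..T})"
    using assms(1) V T unfolding lagr_crit_def by blast
  moreover have "at 0 within {-T..T} \<noteq> bot"
    using T by (simp add: trivial_limit_within)
  ultimately show ?thesis
    using has_field_derivative_unique by fastforce
qed

lemma y_ends: "snd (\<gamma> 0) = 0" "snd (\<gamma> (2*L)) = 0"
  and y_pos: "s \<in> {0<..<2*L} \<Longrightarrow> snd (\<gamma> s) > 0"
  and y_nonneg: "s \<in> I \<Longrightarrow> snd (\<gamma> s) \<ge> 0"
proof -
  show e: "snd (\<gamma> 0) = 0" "snd (\<gamma> (2*L)) = 0"
    and p: "s \<in> {0<..<2*L} \<Longrightarrow> snd (\<gamma> s) > 0" for s
    using adm by (auto simp: admissible_def)
  show "s \<in> I \<Longrightarrow> snd (\<gamma> s) \<ge> 0"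
    using e p[of s] by (cases "s = 0 \<or> s = 2*L") auto
qed

lemma has_real_derivative_reflect:
  assumes "\<And>s. s \<in> I \<Longrightarrow> (f has_real_derivative f' s) (at s within I)" "s \<in> I"
  shows "((\<lambda>s. f (2*L - s)) has_real_derivative - f' (2*L - s)) (at s within I)"
proof -
  have "(f \<circ> (-) (2*L) has_real_derivative f' (2*L - s) * -1) (at s within I)"
  proof (rule DERIV_image_chain)
    show "((-) (2*L) has_real_derivative -1) (at s within I)"
      by (auto intro!: derivative_eq_intros)
    show "(f has_real_derivative f' (2*L - s)) (at (2*L - s) within (-) (2*L) ` I)"
      by (rule DERIV_subset[OF assms(1)]) (use assms(2) in auto)
  qed
  then show ?thesis by (simp add: o_def)
qed

text \<open>If the curve leaves the axis tangentially, y'' = H x' and y \<ge> 0 force x' = 1 there,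
  hence y'' = H > 0. So y grows at least quadratically in every case.\<close>

lemma start_growth:
  "y1 0 \<ge> 0" "y1 0 = 0 \<Longrightarrow> x1 0 = 1"
  "y1 0 > 0 \<Longrightarrow> \<exists>\<delta>>0. \<exists>c>0. \<forall>s\<in>{0..\<delta>}. \<delta> \<le> 2*L \<and> c * s \<le> snd (\<gamma> s)"
  "\<exists>\<delta>>0. \<exists>c>0. \<forall>s\<in>{0..\<delta>}. \<delta> \<le> 2*L \<and> c * s\<^sup>2 \<le> snd (\<gamma> s)"
proof -
  have M: "2*L > 0" and O: "0 \<in> I" using L_pos by auto
  have c: "continuous_on I (\<lambda>s. H s * x1 s)" by (intro continuous_intros cont)
  note g = endpoint_growth[OF M y_ends(1) dy dy1 c y_nonneg]
  show *: "y1 0 \<ge> 0" by (rule g(1))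
  show **: "x1 0 = 1" if "y1 0 = 0"
  proof -
    have "H 0 * x1 0 \<ge> 0" by (rule g(2)[OF _ _ _ that])
    then have "x1 0 \<ge> 0" using H_pos[OF O] by (simp add: zero_le_mult_iff)
    then show ?thesis using unit[OF O] that by (simp add: power2_eq_1_iff)
  qed
  show "y1 0 > 0 \<Longrightarrow> \<exists>\<delta>>0. \<exists>c>0. \<forall>s\<in>{0..\<delta>}. \<delta> \<le> 2*L \<and> c * s \<le> snd (\<gamma> s)"
    by (rule g(3))
  have "y1 0 > 0 \<or> H 0 * x1 0 > 0"
    using * ** H_pos[OF O] by (cases "y1 0 = 0") auto
  then show "\<exists>\<delta>>0. \<exists>c>0. \<forall>s\<in>{0..\<delta>}. \<delta> \<le> 2*L \<and> c * s\<^sup>2 \<le> snd (\<gamma> s)"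
    by (rule g(4)[rotated 3])
qed

text \<open>The reversed height, s mapped to y(2L - s), starts at 0 and is nonnegative, so the
  growth bounds at the left end apply to it.\<close>

lemma end_growth:
  "y1 (2*L) \<le> 0" "y1 (2*L) = 0 \<Longrightarrow> x1 (2*L) = 1"
  "y1 (2*L) < 0 \<Longrightarrow> \<exists>\<delta>>0. \<exists>c>0. \<forall>s\<in>{0..\<delta>}. \<delta> \<le> 2*L \<and> c * s \<le> snd (\<gamma> (2*L - s))"
  "\<exists>\<delta>>0. \<exists>c>0. \<forall>s\<in>{0..\<delta>}. \<delta> \<le> 2*L \<and> c * s\<^sup>2 \<le> snd (\<gamma> (2*L - s))"
proof -
  have M: "2*L > 0" and O: "2*L \<in> I" using L_pos by auto
  have d1: "((\<lambda>s. snd (\<gamma> (2*L - s))) has_real_derivative - y1 (2*L - s)) (at s within I)" if "s \<in> I" for s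
    by (rule has_real_derivative_reflect[OF dy that])
  have d2: "((\<lambda>s. - y1 (2*L - s)) has_real_derivative H (2*L - s) * x1 (2*L - s)) (at s within I)" if "s \<in> I" for s
    using DERIV_minus[OF has_real_derivative_reflect[OF dy1 that]] by simp
  have z: "snd (\<gamma> (2*L - 0)) = 0" using y_ends by simp
  have c: "continuous_on I (\<lambda>s. H (2*L - s) * x1 (2*L - s))"
    by (intro continuous_intros continuous_on_compose2[OF cont(5)] continuous_on_compose2[OF cont(3)]) auto
  have nn: "s \<in> I \<Longrightarrow> snd (\<gamma> (2*L - s)) \<ge> 0" for s by (rule y_nonneg) auto
  note g = endpoint_growth[OF M z d1 d2 c nn]
  show *: "y1 (2*L) \<le> 0" using g(1) by simp
  show **: "x1 (2*L) = 1" if "y1 (2*L) = 0"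
  proof -
    have "H (2*L) * x1 (2*L) \<ge> 0" using g(2) that by simp
    then have "x1 (2*L) \<ge> 0" using H_pos[OF O] by (simp add: zero_le_mult_iff)
    then show ?thesis using unit[OF O] that by (simp add: power2_eq_1_iff)
  qed
  show "y1 (2*L) < 0 \<Longrightarrow> \<exists>\<delta>>0. \<exists>c>0. \<forall>s\<in>{0..\<delta>}. \<delta> \<le> 2*L \<and> c * s \<le> snd (\<gamma> (2*L - s))"
    using g(3) by simp
  have "y1 (2*L) < 0 \<or> H (2*L) * x1 (2*L) > 0"
    using * ** H_pos[OF O] by (cases "y1 (2*L) = 0") auto
  then show "\<exists>\<delta>>0. \<exists>c>0. \<forall>s\<in>{0..\<delta>}. \<delta> \<le> 2*L \<and> c * s\<^sup>2 \<le> snd (\<gamma> (2*L - s))"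
    using g(4) by simp
qed

text \<open>Vanishing to order 2 is always dominated by the quadratic growth of y; order 1 is
  matched by the linear growth at a transversal end. Only there does the slope of the weight remain
  free.\<close>

lemma variation_weightI:
  assumes r: "real_polynomial_function r"
    and i: "i = 2 \<or> i = 1 \<and> y1 0 > 0" and j: "j = 2 \<or> j = 1 \<and> y1 (2*L) < 0"
  shows "variation_weight (\<lambda>s. s ^ i * (2*L - s) ^ j * r s)"
proof -
  let ?f = "\<lambda>s. s ^ i * (2*L - s) ^ j * r s"
  have M: "2*L > 0" using L_pos by simp
  have id: "real_polynomial_function (\<lambda>s::real. s)"
    by (rule real_polynomial_function.intros(1)) (rule bounded_linear_ident)
  have pf: "real_polynomial_function ?f"
    by (intro real_polynomial_function.intros(2-4) real_polynomial_function_power real_polynomial_function_diff id r)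
  have cr: "continuous_on A r" for A by (rule cont_polynomial[OF r])
  have bdd: "\<exists>K. \<forall>s\<in>I. \<bar>h s\<bar> \<le> K" if "continuous_on I h" for h :: "real \<Rightarrow> real"
    using compact_imp_bounded[OF compact_continuous_image[OF that compact_Icc]] by (force simp: bounded_iff)
  have "continuous_on I (\<lambda>s. (2*L - s) ^ j * r s)"
    by (intro continuous_intros cr)
  from bdd[OF this] obtain K1 where K1: "\<And>s. s \<in> I \<Longrightarrow> \<bar>(2*L - s) ^ j * r s\<bar> \<le> K1" by blast
  have "continuous_on I (\<lambda>s. (2*L - s) ^ i * r (2*L - s))"
    by (intro continuous_intros continuous_on_compose2[OF cr]) auto
  from bdd[OF this] obtain K2 where K2: "\<And>s. s \<in> I \<Longrightarrow> \<bar>(2*L - s) ^ i * r (2*L - s)\<bar> \<le> K2" by blast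
  have nonneg: "s \<in> I \<Longrightarrow> s ^ k \<ge> 0" for s :: real and k by simp
  have f_left: "?f s = s ^ i * ((2*L - s) ^ j * r s)"
    and f_right: "?f (2*L - s) = s ^ j * ((2*L - s) ^ i * r (2*L - s))" for s
    by (simp_all add: mult_ac)
  have E1: "\<exists>\<delta>>0. \<exists>c>0. \<forall>s\<in>{0..\<delta>}. \<delta> \<le> 2*L \<and> c * s ^ i \<le> snd (\<gamma> s)"
    using i by (elim disjE conjE) (simp_all add: start_growth(3,4))
  obtain \<delta> c where 1: "\<delta> > 0" "c > 0" "\<And>s. s \<in> {0..\<delta>} \<Longrightarrow> \<delta> \<le> 2*L \<and> c * \<bar>?f s\<bar> \<le> snd (\<gamma> s)"
    by (rule lower_bound_multiple[OF K1 E1 nonneg f_left]) (assumption | rule that)+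
  have E2: "\<exists>\<delta>>0. \<exists>c>0. \<forall>s\<in>{0..\<delta>}. \<delta> \<le> 2*L \<and> c * s ^ j \<le> snd (\<gamma> (2*L - s))"
    using j by (elim disjE conjE) (simp_all add: end_growth(3,4))
  obtain \<delta>' c' where 2: "\<delta>' > 0" "c' > 0" "\<And>s. s \<in> {0..\<delta>'} \<Longrightarrow> \<delta>' \<le> 2*L \<and> c' * \<bar>?f (2*L - s)\<bar> \<le> snd (\<gamma> (2*L - s))"
    by (rule lower_bound_multiple[OF K2 E2 nonneg f_right]) (assumption | rule that)+
  obtain b where "b > 0" "\<And>s. s \<in> I \<Longrightarrow> b * \<bar>?f s\<bar> \<le> snd (\<gamma> s)"
    by (rule lower_bound_from_endpoints[OF M cont(2) cont_polynomial[OF pf] y_pos 1 2]) (assumption | rule that)+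
  then show ?thesis
    unfolding variation_weight_def using pf i j by (intro conjI) auto
qed

abbreviation weight :: "nat \<Rightarrow> nat \<Rightarrow> (real \<Rightarrow> real) \<Rightarrow> real \<Rightarrow> real" where
  "weight i j r \<equiv> \<lambda>s. s ^ i * (2*L - s) ^ j * r s"

lemma weight_derivative:
  assumes "real_polynomial_function r" "i \<in> {1, 2}" "j \<in> {1, 2}"
  obtains f1 where "\<And>s. (weight i j r has_real_derivative f1 s) (at s)"
    "f1 0 = (if i = 1 then (2*L) ^ j * r 0 else 0)"
    "f1 (2*L) = (if j = 1 then - ((2*L) ^ i * r (2*L)) else 0)"
proof -
  obtain r1 where r1: "\<And>s. (r has_real_derivative r1 s) (at s)"
    using has_real_derivative_polynomial_function[OF assms(1)] by blast
  have "(weight i j r has_real_derivative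
      real i * s ^ (i - 1) * (2*L - s) ^ j * r s - s ^ i * (real j * (2*L - s) ^ (j - 1)) * r s
      + s ^ i * (2*L - s) ^ j * r1 s) (at s)" for s
    by (rule derivative_eq_intros r1 refl)+ (simp add: algebra_simps)
  then show ?thesis
    by (rule that) (use assms(2,3) L_pos in auto)
qed

text \<open>The factor s^2 (2L - s)^2 is moved from the weight to h, so that arbitrary polynomials
  test the product. It is nonzero inside the interval, and continuity carries the conclusion to the
  ends.\<close>

lemma zero_if_orthogonal_to_weights:
  assumes h: "continuous_on I h"
    and orth: "\<And>r. real_polynomial_function r \<Longrightarrow> integral I (\<lambda>s. weight 2 2 r s * h s) = 0"
    and s: "s \<in> I"
  shows "h s = 0"
proof -
  have M: "0 < 2*L" using L_pos by simp
  have "(r\<^sup>2 * (2*L - r)\<^sup>2) * h r = 0" if "r \<in> I" for r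
  proof (rule zero_if_orthogonal_to_polynomials[OF M _ _ that])
    show "continuous_on I (\<lambda>r. (r\<^sup>2 * (2*L - r)\<^sup>2) * h r)"
      by (intro continuous_intros h)
    fix p :: "real \<Rightarrow> real" assume p: "real_polynomial_function p"
    have "(\<lambda>s. p s * (s\<^sup>2 * (2*L - s)\<^sup>2 * h s)) = (\<lambda>s. weight 2 2 p s * h s)"
      by (auto simp: mult_ac)
    then show "integral I (\<lambda>s. p s * (s\<^sup>2 * (2*L - s)\<^sup>2 * h s)) = 0"
      using orth[OF p] by simp
  qed
  then have "h r = 0" if "r \<in> {0<..<2*L}" for r
    using that by (metis atLeastAtMost_iff diff_eq_eq add_0 greaterThanLessThan_iff less_eq_real_def
        less_irrefl mult_eq_0_iff power_eq_0_iff)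
  then show ?thesis
    using continuous_constant_on_closure[of "{0<..<2*L}" h 0 s] h s M by simp
qed

text \<open>The zeros of \<open>x1\<close> are isolated because the tangent rotates strictly.\<close>

lemma zero_if_times_x1_zero:
  assumes m: "continuous_on I m" and z: "\<And>s. s \<in> I \<Longrightarrow> m s * x1 s = 0" and s: "s \<in> I"
  shows "m s = 0"
proof (rule ccontr)
  assume nz: "m s \<noteq> 0"
  then have x1s: "x1 s = 0" using z[OF s] by simp
  have "(m \<longlongrightarrow> m s) (at s within I)" using m s by (simp add: continuous_on_def)
  then have "\<forall>\<^sub>F r in at s within I. m r \<noteq> 0"
    using nz by (rule tendsto_imp_eventually_ne)
  moreover have "\<forall>\<^sub>F r in at s within I. r \<in> I"
    by (simp add: eventually_at_filter)
  ultimately have ev: "\<forall>\<^sub>F r in at s within I. x1 r = 0"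
    by eventually_elim (use z in auto)
  have "((\<lambda>r. 0::real) has_derivative (*) (- H s * y1 s)) (at s within I)"
    by (rule has_derivative_transform_eventually[OF dx1[OF s, unfolded has_field_derivative_def] ev])
      (use x1s s in auto)
  then have "((\<lambda>r. 0::real) has_real_derivative - H s * y1 s) (at s within I)"
    unfolding has_field_derivative_def .
  then have "- H s * y1 s = 0"
    by (rule has_field_derivative_unique[OF _ _ not_bot[OF s]]) simp
  then show False
    using H_nz[OF s] unit[OF s] x1s by simp
qed

section \<open>The Euler-Lagrange equation and tangency at the endpoints\<close>

lemma cont_weight: "real_polynomial_function r \<Longrightarrow> continuous_on A (weight i j r)"
  by (intro continuous_intros cont_polynomial)

lemma polynomial_const: "real_polynomial_function (\<lambda>s. c)"
  by (rule real_polynomial_function.intros)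

text \<open>A Lagrange multiplier argument with vertical variations, whose normal part is
  \<open>x1\<close>. Each weight is corrected by a multiple of a fixed one so that the area is kept;
  stationarity then says that (2 + g'' - lam) x1 is orthogonal to all weights, hence zero, and x1
  can be divided out because its zeros are isolated.\<close>

lemma area_crit_g2:
  assumes crit: "area_crit x0 L \<gamma>"
  obtains lam where "\<And>s. s \<in> I \<Longrightarrow> g2 s = lam - 2"
proof -
  have n: "normal_part (0, 1) = x1" by (auto simp: normal_part_def)
  \<comment> \<open>Without such an \<open>r0\<close> all area slopes would vanish, forcing
    \<open>x1\<close> to be zero throughout, against the rotation of the tangent.\<close>
  obtain r0 where r0: "real_polynomial_function r0" "integral I (\<lambda>s. weight 2 2 r0 s * x1 s) \<noteq> 0"
  proof (rule ccontr)
    assume "\<not> thesis"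
    then have "\<And>r. real_polynomial_function r \<Longrightarrow> integral I (\<lambda>s. weight 2 2 r s * x1 s) = 0"
      using that by blast
    then have "x1 s = 0" if "s \<in> I" for s
      by (rule zero_if_orthogonal_to_weights[OF cont(3) _ that])
    then have "(1::real) = 0"
      using zero_if_times_x1_zero[of "\<lambda>_. 1" 0] L_pos by simp
    then show False by simp
  qed
  let ?b = "integral I (\<lambda>s. weight 2 2 r0 s * x1 s)"
  \<comment> \<open>The value for which the reference weight itself satisfies the stationarity
    relation.\<close>
  define lam where "lam = integral I (\<lambda>s. (2 + g2 s) * (weight 2 2 r0 s * x1 s)) / ?b"
  have "integral I (\<lambda>s. weight 2 2 r s * ((2 + g2 s - lam) * x1 s)) = 0" if r: "real_polynomial_function r" for r
  proof -
    \<comment> \<open>Chosen so that the weight built from \<open>r - \<mu> * r0\<close> has zero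
      area slope.\<close>
    define \<mu> where "\<mu> = integral I (\<lambda>s. weight 2 2 r s * x1 s) / ?b"
    let ?r = "\<lambda>s. r s - \<mu> * r0 s"
    have pr: "real_polynomial_function ?r"
      by (intro real_polynomial_function_diff real_polynomial_function.intros(4) polynomial_const r r0)
    note c = cont_weight[OF r] cont_weight[OF r0(1)] cont(3) cont_g2
    have i1: "(\<lambda>s. weight 2 2 r s * x1 s) integrable_on I" "(\<lambda>s. weight 2 2 r0 s * x1 s) integrable_on I"
      "(\<lambda>s. (2 + g2 s) * (weight 2 2 r s * x1 s)) integrable_on I"
      "(\<lambda>s. (2 + g2 s) * (weight 2 2 r0 s * x1 s)) integrable_on I"
      by (intro integrable_continuous_real continuous_on_mult continuous_on_add continuous_on_const c)+
    have "integral I (\<lambda>s. weight 2 2 ?r s * normal_part (0, 1) s)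
        = integral I (\<lambda>s. weight 2 2 r s * x1 s - \<mu> * (weight 2 2 r0 s * x1 s))"
      by (rule integral_cong) (simp add: n algebra_simps)
    also have "\<dots> = integral I (\<lambda>s. weight 2 2 r s * x1 s) - \<mu> * ?b"
      using i1 by (subst integral_diff) (auto intro: integrable_on_mult_right)
    also have "\<dots> = 0" using r0(2) by (simp add: \<mu>_def)
    finally have zero: "integral I (\<lambda>s. weight 2 2 ?r s * normal_part (0, 1) s) = 0" .
    obtain f1 where f1: "\<And>s. (weight 2 2 ?r has_real_derivative f1 s) (at s)" "f1 0 = 0" "f1 (2*L) = 0"
      using weight_derivative[OF pr, of 2 2] by auto
    have "0 = integral I (\<lambda>s. (2 + g2 s) * (weight 2 2 ?r s * normal_part (0, 1) s))"
      using area_crit_linear[OF crit variation_weightI[OF pr] f1(1) zero] f1(2,3) by simp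
    also have "\<dots> = integral I (\<lambda>s. (2 + g2 s) * (weight 2 2 r s * x1 s) - \<mu> * ((2 + g2 s) * (weight 2 2 r0 s * x1 s)))"
      by (rule integral_cong) (simp add: n algebra_simps)
    also have "\<dots> = integral I (\<lambda>s. (2 + g2 s) * (weight 2 2 r s * x1 s)) - \<mu> * (lam * ?b)"
      using i1 r0(2) by (subst integral_diff) (auto intro: integrable_on_mult_right simp: lam_def)
    also have "\<mu> * (lam * ?b) = lam * integral I (\<lambda>s. weight 2 2 r s * x1 s)"
      using r0(2) by (simp add: \<mu>_def)
    also have "integral I (\<lambda>s. (2 + g2 s) * (weight 2 2 r s * x1 s)) - \<dots> =
        integral I (\<lambda>s. (2 + g2 s) * (weight 2 2 r s * x1 s) - lam * (weight 2 2 r s * x1 s))"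
      using i1 by (subst integral_diff) (auto intro: integrable_on_mult_right)
    also have "\<dots> = integral I (\<lambda>s. weight 2 2 r s * ((2 + g2 s - lam) * x1 s))"
      by (rule integral_cong) (simp add: algebra_simps)
    finally show ?thesis by simp
  qed
  then have "(2 + g2 s - lam) * x1 s = 0" if "s \<in> I" for s
    by (rule zero_if_orthogonal_to_weights[where h = "\<lambda>s. (2 + g2 s - lam) * x1 s", OF _ _ that, rotated])
      (assumption | intro continuous_intros cont cont_g2)+
  then have "2 + g2 s - lam = 0" if "s \<in> I" for s
    by (rule zero_if_times_x1_zero[where m = "\<lambda>s. 2 + g2 s - lam", OF _ _ that, rotated])
      (assumption | intro continuous_intros cont_g2)+
  then show ?thesis using that[of lam] by fastforce
qed

text \<open>The same test functions as under the area constraint, but uncorrected, and with the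
  multiplier given instead of constructed.\<close>

lemma lagr_crit_g2:
  assumes crit: "lagr_crit x0 L lam \<gamma>" and s: "s \<in> I"
  shows "g2 s = lam - 2"
proof -
  have n: "normal_part (0, 1) = x1" by (auto simp: normal_part_def)
  have "integral I (\<lambda>s. weight 2 2 r s * ((2 + g2 s - lam) * x1 s)) = 0" if r: "real_polynomial_function r" for r
  proof -
    note c = cont_weight[OF r] cont(3) cont_g2
    have i1: "(\<lambda>s. weight 2 2 r s * x1 s) integrable_on I"
      "(\<lambda>s. (2 + g2 s) * (weight 2 2 r s * x1 s)) integrable_on I"
      by (intro integrable_continuous_real continuous_on_mult continuous_on_add continuous_on_const c)+
    obtain f1 where f1: "\<And>s. (weight 2 2 r has_real_derivative f1 s) (at s)" "f1 0 = 0" "f1 (2*L) = 0"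
      using weight_derivative[OF r, of 2 2] by auto
    have "0 = integral I (\<lambda>s. (2 + g2 s) * (weight 2 2 r s * x1 s)) - lam * integral I (\<lambda>s. weight 2 2 r s * x1 s)"
      using lagr_crit_linear[OF crit variation_weightI[OF r] f1(1), of "(0, 1)"] f1(2,3) by (simp add: n)
    also have "\<dots> = integral I (\<lambda>s. (2 + g2 s) * (weight 2 2 r s * x1 s) - lam * (weight 2 2 r s * x1 s))"
      using i1 by (subst integral_diff) (auto intro: integrable_on_mult_right)
    also have "\<dots> = integral I (\<lambda>s. weight 2 2 r s * ((2 + g2 s - lam) * x1 s))"
      by (rule integral_cong) (simp add: algebra_simps)
    finally show ?thesis by simp
  qed
  then have "(2 + g2 s - lam) * x1 s = 0" if "s \<in> I" for s
    by (rule zero_if_orthogonal_to_weights[where h = "\<lambda>s. (2 + g2 s - lam) * x1 s", OF _ _ that, rotated])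
      (assumption | intro continuous_intros cont cont_g2)+
  then have "2 + g2 s - lam = 0"
    by (rule zero_if_times_x1_zero[where m = "\<lambda>s. 2 + g2 s - lam", OF _ _ s, rotated])
      (assumption | intro continuous_intros cont_g2)+
  then show ?thesis by simp
qed

text \<open>If the curve meets the axis transversally at an endpoint, then the slope of a variation is
  free there and the boundary term of the first variation cannot vanish.\<close>

lemma area_crit_boundary:
  assumes crit: "area_crit x0 L \<gamma>"
    and i: "i = 2 \<or> i = 1 \<and> y1 0 > 0" and j: "j = 2 \<or> j = 1 \<and> y1 (2*L) < 0"
    and ij: "i = 2 \<or> j = 2"
    and e: "normal_part e s0 \<noteq> 0" "s0 \<in> I"
  shows "(if i = 1 then (2*L) ^ j * normal_part e 0 / (H 0)\<^sup>2 else 0)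
    + (if j = 1 then (2*L) ^ i * normal_part e (2*L) / (H (2*L))\<^sup>2 else 0) = 0"
proof -
  obtain lam where lam: "\<And>s. s \<in> I \<Longrightarrow> g2 s = lam - 2"
    using area_crit_g2[OF crit] by blast
  obtain r0 where r0: "real_polynomial_function r0" "integral I (\<lambda>s. weight 2 2 r0 s * normal_part e s) \<noteq> 0"
  proof (rule ccontr)
    assume "\<not> thesis"
    then have "\<And>r. real_polynomial_function r \<Longrightarrow> integral I (\<lambda>s. weight 2 2 r s * normal_part e s) = 0"
      using that by blast
    then have "normal_part e s0 = 0"
      by (rule zero_if_orthogonal_to_weights[OF cont_normal_part _ e(2)])
    then show False using e by simp
  qed
  let ?b = "integral I (\<lambda>s. weight 2 2 r0 s * normal_part e s)"
  let ?a = "integral I (\<lambda>s. weight i j (\<lambda>_. 1) s * normal_part e s)"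
  define \<mu> where "\<mu> = ?a / ?b"
  \<comment> \<open>The exponents 2 - i and 2 - j make the correction equal to \<mu> times
    \<open>weight 2 2 r0\<close>. It vanishes to second order at both ends and so leaves the slope
    of \<open>weight i j\<close> at a transversal end unchanged.\<close>
  let ?r = "\<lambda>s. 1 - \<mu> * (s ^ (2 - i) * (2*L - s) ^ (2 - j) * r0 s)"
  have id: "real_polynomial_function (\<lambda>s::real. s)"
    by (rule real_polynomial_function.intros(1)) (rule bounded_linear_ident)
  have pr: "real_polynomial_function ?r"
    by (intro real_polynomial_function_diff real_polynomial_function.intros(4) polynomial_const
        real_polynomial_function_power id r0)
  have split: "weight i j ?r s = weight i j (\<lambda>_. 1) s - \<mu> * weight 2 2 r0 s" for s
    using i j by (auto simp: algebra_simps power2_eq_square)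
  have i1: "(\<lambda>s. weight i j (\<lambda>_. 1) s * normal_part e s) integrable_on I" "(\<lambda>s. weight 2 2 r0 s * normal_part e s) integrable_on I"
    by (intro integrable_continuous_real continuous_on_mult cont_normal_part cont_weight[OF r0(1)] cont_weight[OF polynomial_const])+
  have "integral I (\<lambda>s. weight i j ?r s * normal_part e s)
      = integral I (\<lambda>s. weight i j (\<lambda>_. 1) s * normal_part e s - \<mu> * (weight 2 2 r0 s * normal_part e s))"
    unfolding split by (simp only: left_diff_distrib mult.assoc)
  also have "\<dots> = ?a - \<mu> * ?b"
    using i1 by (subst integral_diff) (auto intro: integrable_on_mult_right)
  also have "\<dots> = 0" using r0(2) by (simp add: \<mu>_def)
  finally have zero: "integral I (\<lambda>s. weight i j ?r s * normal_part e s) = 0" .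
  have ij': "i \<in> {1, 2}" "j \<in> {1, 2}" using i j by auto
  obtain f1 where f1: "\<And>s. (weight i j ?r has_real_derivative f1 s) (at s)"
    "f1 0 = (if i = 1 then (2*L) ^ j * ?r 0 else 0)"
    "f1 (2*L) = (if j = 1 then - ((2*L) ^ i * ?r (2*L)) else 0)"
    by (rule weight_derivative[OF pr ij']) (rule that)
  have "integral I (\<lambda>s. (2 + g2 s) * (weight i j ?r s * normal_part e s)) = integral I (\<lambda>s. lam * (weight i j ?r s * normal_part e s))"
    by (rule integral_cong) (simp add: lam)
  also have "\<dots> = 0" unfolding integral_mult_right zero by simp
  finally have "f1 0 * normal_part e 0 / (H 0)\<^sup>2 - f1 (2*L) * normal_part e (2*L) / (H (2*L))\<^sup>2 = 0"
    using area_crit_linear[OF crit variation_weightI[OF pr i j] f1(1) zero] by simp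
  then show ?thesis
    unfolding f1(2,3) using ij by (cases "i = 1"; cases "j = 1") (auto simp: zero_power)
qed

text \<open>At a transversal end, testing with e equal to the inner normal there turns the boundary
  term into (2L)^2 / H^2, which cannot vanish. Once the end is tangential, the sign of the
  horizontal component comes from y \<ge> 0.\<close>

lemma area_crit_tangential:
  assumes crit: "area_crit x0 L \<gamma>"
  shows "y1 0 = 0" "x1 0 = 1" "y1 (2*L) = 0" "x1 (2*L) = 1"
proof -
  have nn: "normal_part (- y1 s, x1 s) s = 1" if "s \<in> I" for s
    using unit[OF that] by (simp add: normal_part_def power2_eq_square)
  have O: "0 \<in> I" "2*L \<in> I" using L_pos by auto
  show y0: "y1 0 = 0"
  proof (rule ccontr)
    assume "y1 0 \<noteq> 0"
    then have "y1 0 > 0" using start_growth(1) by simp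
    then show False
      using area_crit_boundary[OF crit, of 1 2 "(- y1 0, x1 0)" 0] nn[OF O(1)] O H_nz[OF O(1)] L_pos by simp
  qed
  show y2L: "y1 (2*L) = 0"
  proof (rule ccontr)
    assume "y1 (2*L) \<noteq> 0"
    then have "y1 (2*L) < 0" using end_growth(1) by simp
    then show False
      using area_crit_boundary[OF crit, of 2 1 "(- y1 (2*L), x1 (2*L))" "2*L"] nn[OF O(2)] O H_nz[OF O(2)] L_pos by simp
  qed
  show "x1 0 = 1" "x1 (2*L) = 1"
    using start_growth(2) end_growth(2) y0 y2L by auto
qed

end

section \<open>The curve gamma0\<close>

text \<open>Up to factors, \<open>profile_x\<close> and \<open>profile_y\<close> are the coordinates
  of a unit speed curve with tangent angle p b, where s - L = k sin b. Then ds = k cos b db, so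
  cos(p b) cos b and sin(p b) cos b have to be integrated; the product formulas split them into the
  frequencies p + 1 and p - 1.\<close>

definition profile_x :: "real \<Rightarrow> real \<Rightarrow> real" where
  "profile_x p b = sin ((p + 1) * b) / (p + 1) + sin ((p - 1) * b) / (p - 1)"

definition profile_y :: "real \<Rightarrow> real \<Rightarrow> real" where
  "profile_y p b = cos ((p + 1) * b) / (p + 1) + cos ((p - 1) * b) / (p - 1)"

lemma profile_x_minus [simp]: "profile_x p (- b) = - profile_x p b" and profile_y_minus [simp]: "profile_y p (- b) = profile_y p b"
  by (simp_all add: profile_x_def profile_y_def)

lemma DERIV_profile_x: "p > 1 \<Longrightarrow> (profile_x p has_real_derivative 2 * cos (p * b) * cos b) (at b)"
  and DERIV_profile_y: "p > 1 \<Longrightarrow> (profile_y p has_real_derivative - 2 * sin (p * b) * cos b) (at b)"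
proof -
  assume p: "p > 1"
  have "(profile_x p has_real_derivative cos ((p + 1) * b) + cos ((p - 1) * b)) (at b)"
    unfolding profile_x_def by (rule derivative_eq_intros refl | use p in simp)+
  moreover have "cos ((p + 1) * b) + cos ((p - 1) * b) = 2 * cos (p * b) * cos b"
    by (simp add: distrib_right left_diff_distrib cos_add cos_diff)
  ultimately show "(profile_x p has_real_derivative 2 * cos (p * b) * cos b) (at b)"
    by simp
  have "(profile_y p has_real_derivative - sin ((p + 1) * b) - sin ((p - 1) * b)) (at b)"
    unfolding profile_y_def by (rule derivative_eq_intros refl | use p in simp)+
  moreover have "- sin ((p + 1) * b) - sin ((p - 1) * b) = - 2 * sin (p * b) * cos b"
    by (simp add: distrib_right left_diff_distrib sin_add sin_diff)
  ultimately show "(profile_y p has_real_derivative - 2 * sin (p * b) * cos b) (at b)"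
    by simp
qed

text \<open>These are the parameters with p b = \<pi>/2 and p b = 3 \<pi>/2, where the tangent is
  vertical. If both are below \<pi>/2, the two values have opposite signs, which produces the
  self-intersection that excludes more than one full turn.\<close>

lemma profile_x_quarter:
  assumes "p > 1"
  shows "profile_x p (pi / (2 * p)) = cos (pi / (2 * p)) * (1 / (p + 1) + 1 / (p - 1))"
    "profile_x p (3 * pi / (2 * p)) = - (cos (3 * pi / (2 * p)) * (1 / (p + 1) + 1 / (p - 1)))"
proof -
  have e: "(p + 1) * (pi / (2 * p)) = pi / 2 + pi / (2 * p)" "(p - 1) * (pi / (2 * p)) = pi / 2 - pi / (2 * p)"
    "(p + 1) * (3 * pi / (2 * p)) = (pi + pi / 2) + 3 * pi / (2 * p)"
    "(p - 1) * (3 * pi / (2 * p)) = (pi + pi / 2) - 3 * pi / (2 * p)"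
    using assms by (simp_all add: field_simps)
  have t: "sin ((pi + pi / 2) + x) = - cos x" "sin ((pi + pi / 2) - x) = - cos x" for x
    by (simp_all only: sin_add sin_diff cos_add cos_diff sin_pi cos_pi sin_pi_half cos_pi_half) simp_all
  show "profile_x p (pi / (2 * p)) = cos (pi / (2 * p)) * (1 / (p + 1) + 1 / (p - 1))"
    unfolding profile_x_def e by (simp add: sin_add sin_diff distrib_left)
  show "profile_x p (3 * pi / (2 * p)) = - (cos (3 * pi / (2 * p)) * (1 / (p + 1) + 1 / (p - 1)))"
    unfolding profile_x_def e t by (simp add: distrib_left)
qed

text \<open>At p b = \<pi> the explicit curve reaches an endpoint; these values account for its half
  width x0 and for the additive constant in its height.\<close>

lemma profile_x_half:
  assumes "p > 1"
  shows "profile_x p (pi / p) = 2 * sin (pi / p) / (p\<^sup>2 - 1)" "profile_y p (pi / p) = - 2 * p * cos (pi / p) / (p\<^sup>2 - 1)"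
proof -
  have e: "(p + 1) * (pi / p) = pi + pi / p" "(p - 1) * (pi / p) = pi - pi / p"
    using assms by (simp_all add: field_simps)
  have t: "sin (pi + x) = - sin x" "sin (pi - x) = sin x" "cos (pi + x) = - cos x" "cos (pi - x) = - cos x" for x
    by (simp_all add: sin_add cos_add sin_diff cos_diff)
  have f: "p\<^sup>2 - 1 = (p + 1) * (p - 1)" by (simp add: power2_eq_square algebra_simps)
  show "profile_x p (pi / p) = 2 * sin (pi / p) / (p\<^sup>2 - 1)"
    unfolding profile_x_def e f t using assms by (simp add: divide_simps) (simp add: algebra_simps)
  show "profile_y p (pi / p) = - 2 * p * cos (pi / p) / (p\<^sup>2 - 1)"
    unfolding profile_y_def e f t using assms by (simp add: divide_simps) (simp add: algebra_simps)
qed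

lemma arcsin_ratio:
  fixes k L s :: real
  assumes "k > 0" "\<bar>s - L\<bar> < k"
  shows "sin (arcsin ((s - L) / k)) = (s - L) / k" "cos (arcsin ((s - L) / k)) > 0"
    "((\<lambda>s. arcsin ((s - L) / k)) has_real_derivative 1 / (k * cos (arcsin ((s - L) / k)))) (at s)"
    "(k * cos (arcsin ((s - L) / k)))\<^sup>2 = k\<^sup>2 - (s - L)\<^sup>2"
proof -
  let ?r = "(s - L) / k"
  have r: "-1 < ?r" "?r < 1" using assms by (auto simp: field_simps abs_less_iff)
  then have r2: "?r\<^sup>2 < 1" using abs_square_less_1[of ?r] by (simp add: abs_less_iff)
  show "sin (arcsin ?r) = ?r" using r by simp
  have c: "cos (arcsin ?r) = sqrt (1 - ?r\<^sup>2)" using r by (simp add: cos_arcsin)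
  show "cos (arcsin ?r) > 0" unfolding c using r2 by simp
  have "((\<lambda>s. arcsin ((s - L) / k)) has_real_derivative inverse (sqrt (1 - ?r\<^sup>2)) * (1 / k)) (at s)"
    by (rule DERIV_chain2[where f = arcsin and g = "\<lambda>s. (s - L) / k", OF DERIV_arcsin[OF r]])
      (use assms(1) in \<open>auto intro!: derivative_eq_intros\<close>)
  then show "((\<lambda>s. arcsin ((s - L) / k)) has_real_derivative 1 / (k * cos (arcsin ((s - L) / k)))) (at s)"
    unfolding c by (simp add: field_simps)
  show "(k * cos (arcsin ?r))\<^sup>2 = k\<^sup>2 - (s - L)\<^sup>2"
    unfolding c using r2 assms(1) by (simp add: power_mult_distrib power_divide field_simps)
qed

text \<open>A class closed under differentiation in s. The derivative of a = arcsin((s - L)/k) is 1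
  / (k cos a), so the secant has to be among the generators; its own derivative is again sin a times
  powers of the secant.\<close>

inductive arcsine_algebra :: "real \<Rightarrow> real \<Rightarrow> (real \<Rightarrow> real) \<Rightarrow> bool" for L k where
  const: "arcsine_algebra L k (\<lambda>s. c)"
| sin: "arcsine_algebra L k (\<lambda>s. sin (c * arcsin ((s - L) / k)))"
| cos: "arcsine_algebra L k (\<lambda>s. cos (c * arcsin ((s - L) / k)))"
| sec: "arcsine_algebra L k (\<lambda>s. inverse (cos (arcsin ((s - L) / k))))"
| add: "arcsine_algebra L k f \<Longrightarrow> arcsine_algebra L k g \<Longrightarrow> arcsine_algebra L k (\<lambda>s. f s + g s)"
| mult: "arcsine_algebra L k f \<Longrightarrow> arcsine_algebra L k g \<Longrightarrow> arcsine_algebra L k (\<lambda>s. f s * g s)"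

lemma arcsine_algebra_derivative:
  assumes "arcsine_algebra L k f" "k > 0"
  shows "\<exists>f'. arcsine_algebra L k f' \<and> (\<forall>s. \<bar>s - L\<bar> < k \<longrightarrow> (f has_real_derivative f' s) (at s))"
  using assms(1)
proof induction
  case (const c)
  show ?case by (intro exI[of _ "\<lambda>s. 0"]) (auto intro: arcsine_algebra.const)
next
  case (sin c)
  have "arcsine_algebra L k (\<lambda>s. cos (c * arcsin ((s - L) / k)) * (c / k * inverse (cos (arcsin ((s - L) / k)))))"
    by (intro arcsine_algebra.intros)
  moreover have "((\<lambda>s. sin (c * arcsin ((s - L) / k))) has_real_derivative
      cos (c * arcsin ((s - L) / k)) * (c / k * inverse (cos (arcsin ((s - L) / k))))) (at s)" if "\<bar>s - L\<bar> < k" for s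
    by (rule derivative_eq_intros arcsin_ratio(3)[OF assms(2) that] refl)+ (simp add: divide_inverse)
  ultimately show ?case by blast
next
  case (cos c)
  have "arcsine_algebra L k (\<lambda>s. sin (c * arcsin ((s - L) / k)) * (- c / k * inverse (cos (arcsin ((s - L) / k)))))"
    by (intro arcsine_algebra.intros)
  moreover have "((\<lambda>s. cos (c * arcsin ((s - L) / k))) has_real_derivative
      sin (c * arcsin ((s - L) / k)) * (- c / k * inverse (cos (arcsin ((s - L) / k))))) (at s)" if "\<bar>s - L\<bar> < k" for s
    by (rule derivative_eq_intros arcsin_ratio(3)[OF assms(2) that] refl)+ (simp add: divide_inverse)
  ultimately show ?case by blast
next
  case sec
  let ?c = "\<lambda>s. inverse (cos (arcsin ((s - L) / k)))"
  have "arcsine_algebra L k (\<lambda>s. sin (1 * arcsin ((s - L) / k)) * (1 / k * (?c s * (?c s * ?c s))))"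
    by (intro arcsine_algebra.intros)
  moreover have "(?c has_real_derivative sin (1 * arcsin ((s - L) / k)) * (1 / k * (?c s * (?c s * ?c s)))) (at s)"
    if "\<bar>s - L\<bar> < k" for s
    by (rule derivative_eq_intros arcsin_ratio(3)[OF assms(2) that] refl
        arcsin_ratio(2)[OF assms(2) that, THEN less_imp_neq, THEN not_sym])+ (simp add: divide_inverse)
  ultimately show ?case by blast
next
  case (add f g)
  then obtain f' g' where "arcsine_algebra L k f'" "arcsine_algebra L k g'"
    "\<And>s. \<bar>s - L\<bar> < k \<Longrightarrow> (f has_real_derivative f' s) (at s)"
    "\<And>s. \<bar>s - L\<bar> < k \<Longrightarrow> (g has_real_derivative g' s) (at s)" by blast
  then show ?case
    by (intro exI[of _ "\<lambda>s. f' s + g' s"]) (auto intro: arcsine_algebra.add DERIV_add)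
next
  case (mult f g)
  then obtain f' g' where *: "arcsine_algebra L k f'" "arcsine_algebra L k g'"
    "\<And>s. \<bar>s - L\<bar> < k \<Longrightarrow> (f has_real_derivative f' s) (at s)"
    "\<And>s. \<bar>s - L\<bar> < k \<Longrightarrow> (g has_real_derivative g' s) (at s)" by blast
  show ?case
    using mult.hyps *
    by (intro exI[of _ "\<lambda>s. f' s * g s + g' s * f s"])
      (auto intro!: arcsine_algebra.add arcsine_algebra.mult DERIV_mult)
qed

lemma arcsine_algebra_Cinf_on:
  assumes f: "arcsine_algebra L k f" and k: "k > 0" and S: "\<And>s. s \<in> S \<Longrightarrow> \<bar>s - L\<bar> < k"
  shows "Cinf_on S f"
proof (rule Cinf_on_coinduct[where P = "arcsine_algebra L k", OF f])
  fix g assume "arcsine_algebra L k g"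
  then obtain g' where g': "arcsine_algebra L k g'" "\<And>s. \<bar>s - L\<bar> < k \<Longrightarrow> (g has_real_derivative g' s) (at s)"
    using arcsine_algebra_derivative k by blast
  show "\<exists>g'. (\<forall>x\<in>S. (g has_derivative g' x) (at x within S)) \<and> (\<forall>h. arcsine_algebra L k (\<lambda>x. g' x h))"
  proof (intro exI[of _ "\<lambda>s h. g' s * h"] conjI ballI allI)
    fix s assume "s \<in> S"
    then show "(g has_derivative (\<lambda>h. g' s * h)) (at s within S)"
      using has_derivative_at_withinI[OF g'(2)[OF S, unfolded has_field_derivative_def]] by simp
  next
    fix h show "arcsine_algebra L k (\<lambda>s. g' s * h)"
      by (intro arcsine_algebra.mult g' arcsine_algebra.const)
  qed
qed

section \<open>Geometry of the explicit curve\<close>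

locale arcsine_curve =
  fixes x0 L :: real
  assumes x0_pos: "0 < x0" and x0_less: "3 * x0 < L"
begin

text \<open>The constants let \<open>p * a s\<close> run from -\<pi> to \<pi>, one full turn: k is
  fixed by a(2L) = \<sigma>, and p = \<pi> / \<sigma>. The square root amounts to p^2 - 1 = L / x0,
  which is precisely what puts the endpoints at distance x0 from the axis of symmetry.\<close>

definition \<sigma> :: real where "\<sigma> = pi * sqrt (x0 / (L + x0))"
definition k :: real where "k = L / sin \<sigma>"
definition p :: real where "p = pi / \<sigma>"
definition a :: "real \<Rightarrow> real" where "a s = arcsin ((s - L) / k)"
abbreviation I :: "real set" where "I \<equiv> {0..2*L}"

lemma L_pos: "0 < L" using x0_pos x0_less by simp

text \<open>The condition 3 x0 < L says exactly that sqrt(x0 / (L + x0)) < 1/2; it keeps \<sigma> in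
  the range where the arcsine inverts the sine.\<close>

lemma sigma: "0 < \<sigma>" "\<sigma> < pi / 2"
proof -
  have "sqrt (x0 / (L + x0)) < sqrt ((1/2)\<^sup>2)"
    using x0_pos x0_less by (intro real_sqrt_less_mono) (simp add: field_simps power2_eq_square)
  then have "sqrt (x0 / (L + x0)) < 1/2" by simp
  then show "\<sigma> < pi / 2" unfolding \<sigma>_def using pi_gt_zero by simp
  show "0 < \<sigma>" unfolding \<sigma>_def using x0_pos L_pos by simp
qed

lemma p_gt: "p > 2" and p_sigma: "p * \<sigma> = pi" "pi / p = \<sigma>"
  unfolding p_def using sigma by (simp_all add: field_simps)

lemma p_sq: "p\<^sup>2 = (L + x0) / x0"
  unfolding p_def \<sigma>_def using x0_pos L_pos by (simp add: power_divide power_mult_distrib)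

lemma p_sq_minus: "p\<^sup>2 - 1 = L / x0"
  unfolding p_sq using x0_pos by (simp add: field_simps)

lemma sin_sigma: "0 < sin \<sigma>" "sin \<sigma> < 1"
proof -
  show "0 < sin \<sigma>" using sigma by (intro sin_gt_zero) auto
  have "sin \<sigma> < sin (pi / 2)" using sigma by (intro sin_monotone_2pi) auto
  then show "sin \<sigma> < 1" by simp
qed

lemma k_gt: "L < k" and k_pos: "0 < k"
proof -
  show "L < k" unfolding k_def using sin_sigma L_pos by (simp add: field_simps)
  then show "0 < k" using L_pos by simp
qed

lemma abs_less_k: "s \<in> I \<Longrightarrow> \<bar>s - L\<bar> < k"
  using k_gt by auto

lemmas a_facts = arcsin_ratio[OF k_pos abs_less_k, folded a_def]

lemma a_ends: "a 0 = - \<sigma>" "a (2*L) = \<sigma>"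
proof -
  have "L / k = sin \<sigma>" unfolding k_def using L_pos sin_sigma by simp
  then have "arcsin (L / k) = \<sigma>" using sigma by (simp add: arcsin_sin)
  moreover have "-1 \<le> L / k" "L / k \<le> 1" using k_gt L_pos by (auto simp: field_simps)
  ultimately show "a 0 = - \<sigma>" "a (2*L) = \<sigma>" by (auto simp: a_def arcsin_minus)
qed

lemma a_mono: "s < t \<Longrightarrow> s \<in> I \<Longrightarrow> t \<in> I \<Longrightarrow> a s < a t"
  unfolding a_def using abs_less_k[of s] abs_less_k[of t] k_pos
  by (intro arcsin_less_mono[THEN iffD2]) (auto simp: divide_strict_right_mono abs_less_iff field_simps)

lemma a_bounds: "s \<in> I \<Longrightarrow> - \<sigma> \<le> a s" "s \<in> I \<Longrightarrow> a s \<le> \<sigma>"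
    "s \<in> {0<..<2*L} \<Longrightarrow> - \<sigma> < a s" "s \<in> {0<..<2*L} \<Longrightarrow> a s < \<sigma>"
proof -
  have l: "- \<sigma> < a s" if "s \<in> {0<..2*L}" for s
    using a_mono[of 0 s] that unfolding a_ends by simp
  have r: "a s < \<sigma>" if "s \<in> {0..<2*L}" for s
    using a_mono[of s "2*L"] that unfolding a_ends by simp
  show "s \<in> I \<Longrightarrow> - \<sigma> \<le> a s"
    using l[of s] a_ends(1) by (cases "s = 0") auto
  show "s \<in> I \<Longrightarrow> a s \<le> \<sigma>"
    using r[of s] a_ends(2) by (cases "s = 2*L") auto
  show "s \<in> {0<..<2*L} \<Longrightarrow> - \<sigma> < a s" "s \<in> {0<..<2*L} \<Longrightarrow> a s < \<sigma>"
    using l[of s] r[of s] by auto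
qed

lemma a_reflect: "s \<in> I \<Longrightarrow> a (2*L - s) = - a s"
proof -
  assume s: "s \<in> I"
  have "2*L - s - L = - (s - L)" by simp
  then have "(2*L - s - L) / k = - ((s - L) / k)" by (simp only: minus_divide_left)
  moreover have "-1 \<le> (s - L) / k" "(s - L) / k \<le> 1"
    using abs_less_k[OF s] k_pos by (auto simp: field_simps abs_less_iff)
  ultimately show ?thesis unfolding a_def by (simp add: arcsin_minus)
qed

lemma gamma0_eq: "gamma0 x0 L s = (- k / 2 * profile_x p (a s), k / 2 * profile_y p (a s) + p * x0 / tan \<sigma>)"
proof -
  have "\<sigma> / (pi + \<sigma>) = 1 / (p + 1)" "\<sigma> / (pi - \<sigma>) = 1 / (p - 1)"
    "(pi + \<sigma>) / \<sigma> = p + 1" "(pi - \<sigma>) / \<sigma> = p - 1"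
    unfolding p_def using sigma by (simp_all add: field_simps)
  then show ?thesis
    unfolding gamma0_def Let_def \<sigma>_def[symmetric] k_def[symmetric] a_def[symmetric] profile_x_def profile_y_def
    by (simp add: p_def)
qed

lemma gamma0_height: "k / 2 * profile_y p \<sigma> + p * x0 / tan \<sigma> = 0"
proof -
  have "profile_y p \<sigma> = - 2 * p * cos \<sigma> * x0 / L"
    using profile_x_half(2)[of p] p_gt unfolding p_sigma(2) p_sq_minus by simp
  then show ?thesis
    unfolding k_def tan_def using L_pos sin_sigma by (simp add: field_simps)
qed

lemma gamma0_width: "k / 2 * profile_x p \<sigma> = x0"
proof -
  have "profile_x p \<sigma> = 2 * sin \<sigma> * x0 / L"
    using profile_x_half(1)[of p] p_gt unfolding p_sigma(2) p_sq_minus by simp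
  then show ?thesis
    unfolding k_def using L_pos sin_sigma by simp
qed

lemma gamma0_ends: "gamma0 x0 L 0 = (x0, 0)" "gamma0 x0 L (2*L) = (- x0, 0)"
  using gamma0_height gamma0_width by (simp_all add: gamma0_eq a_ends)

text \<open>The derivative is -2 sin(p b) cos b, where p b stays in (0, \<pi>) and cos b > 0.
  Monotone height on each half of the curve serves both y > 0 and injectivity.\<close>

lemma profile_y_decreasing:
  assumes "0 \<le> b" "b < c" "c \<le> \<sigma>"
  shows "profile_y p c < profile_y p b"
proof (rule DERIV_neg_imp_decreasing_open[OF assms(2)])
  fix t assume t: "b < t" "t < c"
  have "0 < p * t" "p * t < p * \<sigma>" using t assms p_gt by auto
  then have "sin (p * t) > 0" unfolding p_sigma by (intro sin_gt_zero)
  moreover have "cos t > 0" using t assms sigma by (intro cos_gt_zero) auto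
  ultimately have "- 2 * sin (p * t) * cos t < 0" by simp
  moreover have "p > 1" using p_gt by simp
  ultimately show "\<exists>y. (profile_y p has_real_derivative y) (at t) \<and> y < 0"
    using DERIV_profile_y[of p t] by blast
next
  show "continuous_on {b..c} (profile_y p)"
    using p_gt by (intro continuous_at_imp_continuous_on ballI DERIV_isCont[OF DERIV_profile_y]) simp
qed

text \<open>The function rises from 0 until p b = \<pi>/2 and does not increase afterwards, so on
  the second part it is bounded below by its final value 2 x0 / k.\<close>

lemma profile_x_pos:
  assumes "0 < b" "b \<le> \<sigma>"
  shows "profile_x p b > 0"
proof -
  have p1: "p > 1" using p_gt by simp
  have cont: "continuous_on A (profile_x p)" for A
    by (intro continuous_at_imp_continuous_on ballI DERIV_isCont[OF DERIV_profile_x[OF p1]])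
  have half: "pi / (2 * p) < \<sigma>" unfolding p_sigma(2)[symmetric] using p_gt by (simp add: field_simps)
  show ?thesis
  proof (cases "b \<le> pi / (2 * p)")
    case True
    have "profile_x p 0 < profile_x p b"
    proof (rule DERIV_pos_imp_increasing_open[OF assms(1)])
      fix t assume t: "0 < t" "t < b"
      have "p * t < p * (pi / (2 * p))" using t True p1 by (intro mult_strict_left_mono) auto
      then have "p * t < pi / 2" using p1 by simp
      then have "cos (p * t) > 0" using t p1 by (intro cos_gt_zero) auto
      moreover have "cos t > 0" using t assms sigma by (intro cos_gt_zero) auto
      ultimately have "2 * cos (p * t) * cos t > 0" by simp
      then show "\<exists>y. (profile_x p has_real_derivative y) (at t) \<and> 0 < y"
        using DERIV_profile_x[OF p1, of t] by blast
    qed (rule cont)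
    then show ?thesis by (simp add: profile_x_def)
  next
    case False
    have "profile_x p \<sigma> \<le> profile_x p b"
    proof (rule DERIV_nonpos_imp_decreasing_open[OF assms(2)])
      fix t assume t: "b < t" "t < \<sigma>"
      have "p * (pi / (2 * p)) < p * t" using t False p1 by (intro mult_strict_left_mono) auto
      then have "pi / 2 < p * t" using p1 by simp
      moreover have "p * t < p * \<sigma>" using t p1 by simp
      ultimately have "- cos (p * t) > 0" unfolding p_sigma
        using cos_gt_zero_pi[of "p * t - pi"] by simp
      moreover have "cos t > 0" using t assms sigma by (intro cos_gt_zero) auto
      ultimately have "2 * cos (p * t) * cos t \<le> 0" by (simp add: mult_le_0_iff)
      then show "\<exists>y. (profile_x p has_real_derivative y) (at t) \<and> y \<le> 0"
        using DERIV_profile_x[OF p1, of t] by blast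
    qed (rule cont)
    moreover have "profile_x p \<sigma> > 0"
    proof -
      have "0 < k * profile_x p \<sigma>" using gamma0_width x0_pos by simp
      then show ?thesis using k_pos by (rule zero_less_mult_pos)
    qed
    ultimately show ?thesis by simp
  qed
qed

text \<open>The height determines |a| by monotonicity. The abscissa then separates a from -a, since
  \<open>profile_x\<close> is odd and positive on (0, \<sigma>].\<close>

lemma gamma0_inj: "inj_on (gamma0 x0 L) I"
proof (rule inj_onI)
  fix s t assume st: "s \<in> I" "t \<in> I" and eq: "gamma0 x0 L s = gamma0 x0 L t"
  have x: "profile_x p (a s) = profile_x p (a t)" and y: "profile_y p (a s) = profile_y p (a t)"
    using eq k_pos unfolding gamma0_eq by simp_all
  have abs: "\<bar>a r\<bar> \<le> \<sigma>" "profile_y p \<bar>a r\<bar> = profile_y p (a r)" if "r \<in> I" for r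
    using a_bounds(1,2)[OF that] by (simp_all add: abs_le_iff abs_if)
  have less: "profile_y p (a v) < profile_y p (a u)" if "\<bar>a u\<bar> < \<bar>a v\<bar>" "u \<in> I" "v \<in> I" for u v
    using profile_y_decreasing[OF abs_ge_zero that(1) abs(1)[OF that(3)]] abs(2) that(2,3) by simp
  have "\<not> \<bar>a s\<bar> < \<bar>a t\<bar>" "\<not> \<bar>a t\<bar> < \<bar>a s\<bar>"
    using less[OF _ st] less[OF _ st(2,1)] unfolding y by blast+
  then have "a s = a t \<or> a s = - a t" by linarith
  moreover have "a s = a t" if neg: "a s = - a t"
  proof -
    have z: "profile_x p (a t) = 0" "profile_x p (a s) = 0" using x neg by auto
    have "\<not> 0 < a s" "\<not> 0 < a t"
      using profile_x_pos[of "a s"] profile_x_pos[of "a t"] z a_bounds(2)[OF st(1)] a_bounds(2)[OF st(2)] by linarith+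
    then show ?thesis using neg by linarith
  qed
  ultimately have "a s = a t" by blast
  then have "\<not> s < t" "\<not> t < s"
    using a_mono[of s t] a_mono[of t s] st by linarith+
  then show "s = t" by linarith
qed

lemma gamma0_pos:
  assumes "s \<in> {0<..<2*L}"
  shows "snd (gamma0 x0 L s) > 0"
proof -
  have "profile_y p \<sigma> < profile_y p \<bar>a s\<bar>"
    by (rule profile_y_decreasing) (use a_bounds(3,4)[OF assms] in \<open>auto simp: abs_less_iff\<close>)
  also have "profile_y p \<bar>a s\<bar> = profile_y p (a s)" by (simp add: abs_if)
  finally have "k / 2 * profile_y p \<sigma> < k / 2 * profile_y p (a s)" using k_pos by simp
  then show ?thesis unfolding gamma0_eq snd_conv using gamma0_height by linarith
qed

text \<open>The tangent angle is p a + \<pi>, whence the minus signs: at the ends p a is -\<pi> or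
  \<pi> and the tangent is (1, 0). The quotient \<open>p / (k * cos (a s))\<close> is the derivative
  of p a, that is, the curvature.\<close>

lemma gamma0_derivatives:
  assumes s: "s \<in> I"
  shows "((\<lambda>s. fst (gamma0 x0 L s)) has_real_derivative - cos (p * a s)) (at s)"
    "((\<lambda>s. snd (gamma0 x0 L s)) has_real_derivative - sin (p * a s)) (at s)"
    "((\<lambda>s. - cos (p * a s)) has_real_derivative - (p / (k * cos (a s))) * (- sin (p * a s))) (at s)"
    "((\<lambda>s. - sin (p * a s)) has_real_derivative p / (k * cos (a s)) * (- cos (p * a s))) (at s)"
    "((\<lambda>s. p / (k * cos (a s))) has_real_derivative p * sin (a s) / (k\<^sup>2 * cos (a s) ^ 3)) (at s)"
    "((\<lambda>s. p * sin (a s) / (k\<^sup>2 * cos (a s) ^ 3)) has_real_derivative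
        p * (1 + 2 * (sin (a s))\<^sup>2) / (k ^ 3 * cos (a s) ^ 5)) (at s)"
proof -
  have p1: "p > 1" using p_gt by simp
  note da = a_facts(3)[OF s]
  have nz: "cos (a s) \<noteq> 0" "k \<noteq> 0" "k * cos (a s) \<noteq> 0" "k\<^sup>2 * cos (a s) ^ 3 \<noteq> 0"
    using a_facts(2)[OF s] k_pos by auto
  show "((\<lambda>s. fst (gamma0 x0 L s)) has_real_derivative - cos (p * a s)) (at s)"
    unfolding gamma0_eq fst_conv
    using DERIV_cmult[OF DERIV_chain2[OF DERIV_profile_x[OF p1] da], of "- k / 2"] nz by simp
  show "((\<lambda>s. snd (gamma0 x0 L s)) has_real_derivative - sin (p * a s)) (at s)"
    unfolding gamma0_eq snd_conv
    using DERIV_add[OF DERIV_cmult[OF DERIV_chain2[OF DERIV_profile_y[OF p1] da], of "k / 2"] DERIV_const] nz by simp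
  show "((\<lambda>s. - cos (p * a s)) has_real_derivative - (p / (k * cos (a s))) * (- sin (p * a s))) (at s)"
    by (rule derivative_eq_intros da refl)+ simp
  show "((\<lambda>s. - sin (p * a s)) has_real_derivative p / (k * cos (a s)) * (- cos (p * a s))) (at s)"
    by (rule derivative_eq_intros da refl)+ simp
  show "((\<lambda>s. p / (k * cos (a s))) has_real_derivative p * sin (a s) / (k\<^sup>2 * cos (a s) ^ 3)) (at s)"
    by (rule derivative_eq_intros da nz refl)+
      (use nz in \<open>simp add: divide_simps power2_eq_square power3_eq_cube\<close>)
  have "((\<lambda>s. p * sin (a s) / (k\<^sup>2 * cos (a s) ^ 3)) has_real_derivative
      p * ((cos (a s))\<^sup>2 + 3 * (sin (a s))\<^sup>2) / (k ^ 3 * cos (a s) ^ 5)) (at s)"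
    by (rule derivative_eq_intros da nz refl)+
      (use nz in \<open>simp add: divide_simps eval_nat_numeral algebra_simps\<close>)
  moreover have "(cos (a s))\<^sup>2 + 3 * (sin (a s))\<^sup>2 = 1 + 2 * (sin (a s))\<^sup>2"
    by (simp add: cos_squared_eq)
  ultimately show "((\<lambda>s. p * sin (a s) / (k\<^sup>2 * cos (a s) ^ 3)) has_real_derivative
        p * (1 + 2 * (sin (a s))\<^sup>2) / (k ^ 3 * cos (a s) ^ 5)) (at s)"
    by simp
qed

lemma gamma0_jet2: "jet2 L (gamma0 x0 L) (\<lambda>s. - cos (p * a s)) (\<lambda>s. - sin (p * a s))
    (\<lambda>s. - (p / (k * cos (a s))) * (- sin (p * a s))) (\<lambda>s. p / (k * cos (a s)) * (- cos (p * a s)))"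
  unfolding jet2_def using gamma0_derivatives by (blast intro: has_field_derivative_at_within)

lemma gamma0_smooth: "Cinf_on I (gamma0 x0 L)"
proof -
  have "arcsine_algebra L k (\<lambda>s. - k / 2 * (1 / (p + 1) * sin ((p + 1) * a s) + 1 / (p - 1) * sin ((p - 1) * a s)))"
    "arcsine_algebra L k (\<lambda>s. k / 2 * (1 / (p + 1) * cos ((p + 1) * a s) + 1 / (p - 1) * cos ((p - 1) * a s)) + p * x0 / tan \<sigma>)"
    unfolding a_def by (intro arcsine_algebra.intros)+
  then have "arcsine_algebra L k (\<lambda>s. - k / 2 * profile_x p (a s))" "arcsine_algebra L k (\<lambda>s. k / 2 * profile_y p (a s) + p * x0 / tan \<sigma>)"
    by (simp_all add: profile_x_def profile_y_def)
  then have "Cinf_on I (\<lambda>s. (- k / 2 * profile_x p (a s), k / 2 * profile_y p (a s) + p * x0 / tan \<sigma>))"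
    using Cinf_on_Pair[OF arcsine_algebra_Cinf_on[OF _ k_pos abs_less_k] arcsine_algebra_Cinf_on[OF _ k_pos abs_less_k]]
    by blast
  then show ?thesis unfolding gamma0_eq[abs_def] .
qed

lemma gamma0_admissible: "admissible x0 L (gamma0 x0 L)"
proof -
  have "dvec L (gamma0 x0 L) s \<noteq> 0 \<and> curv L (gamma0 x0 L) s > 0" if s: "s \<in> I" for s
  proof (rule jet2_curv_pos[OF L_pos gamma0_jet2 s, THEN iffD2])
    have "h = - c * (h * - c) - - d * (- h * - d)" if "d\<^sup>2 + c\<^sup>2 = 1" for c d h :: real
      using that by algebra
    note eq = this[OF sin_cos_squared_add, of "p / (k * cos (a s))" "p * a s"]
    have "0 < p / (k * cos (a s))" using a_facts(2)[OF s] k_pos p_gt by simp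
    then show "0 < - cos (p * a s) * (p / (k * cos (a s)) * - cos (p * a s)) -
        - sin (p * a s) * (- (p / (k * cos (a s))) * - sin (p * a s))"
      by (rule less_le_trans[OF _ eq_refl[OF eq]])
  qed
  note reg = this
  show ?thesis
    unfolding admissible_def
    by (intro conjI ballI gamma0_smooth gamma0_inj gamma0_ends gamma0_pos reg[THEN conjunct1] reg[THEN conjunct2])
qed

lemma gamma0_arclength: "arclength L (gamma0 x0 L)"
  unfolding arclength_def by (simp add: jet2_dvec[OF L_pos gamma0_jet2] norm_Pair)

lemma gamma0_vert_sym: "vert_sym L (gamma0 x0 L)"
  unfolding vert_sym_def
proof
  fix z assume "z \<in> gamma0 x0 L ` I"
  then obtain s where s: "s \<in> I" "z = gamma0 x0 L s" by blast
  then have "(- fst z, snd z) = gamma0 x0 L (2*L - s)"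
    by (simp add: gamma0_eq a_reflect)
  then show "(- fst z, snd z) \<in> gamma0 x0 L ` I"
    by (rule image_eqI) (use s(1) in simp)
qed

text \<open>With s - L = k sin a the curvature gives 1/H^2 = (k^2 - (s - L)^2) / p^2, whose second
  derivative is -2 / p^2 = -2 x0 / (L + x0). Adding 2 gives the multiplier.\<close>

lemma gamma0_lagr_crit: "lagr_crit x0 L (2 * L / (L + x0)) (gamma0 x0 L)"
proof -
  interpret c: unit_speed_curve x0 L "gamma0 x0 L" "\<lambda>s. - cos (p * a s)" "\<lambda>s. - sin (p * a s)"
    "\<lambda>s. p / (k * cos (a s))" "\<lambda>s. p * sin (a s) / (k\<^sup>2 * cos (a s) ^ 3)"
    "\<lambda>s. p * (1 + 2 * (sin (a s))\<^sup>2) / (k ^ 3 * cos (a s) ^ 5)"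
  proof
    have ca: "continuous_on I a"
      by (rule DERIV_continuous_on[OF has_field_derivative_at_within[OF a_facts(3)]])
    have "k ^ 3 * cos (a s) ^ 5 \<noteq> 0" if "s \<in> I" for s
      using a_facts(2)[OF that] k_pos by simp
    then show "continuous_on I (\<lambda>s. p * (1 + 2 * (sin (a s))\<^sup>2) / (k ^ 3 * cos (a s) ^ 5))"
      by (intro continuous_intros ca ballI)
    fix s assume s: "s \<in> I"
    show "p / (k * cos (a s)) > 0" using a_facts(2)[OF s] k_pos p_gt by simp
    show "(- cos (p * a s))\<^sup>2 + (- sin (p * a s))\<^sup>2 = 1" by simp
    show "((\<lambda>s. p / (k * cos (a s))) has_real_derivative p * sin (a s) / (k\<^sup>2 * cos (a s) ^ 3)) (at s within I)"
      "((\<lambda>s. p * sin (a s) / (k\<^sup>2 * cos (a s) ^ 3)) has_real_derivative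
        p * (1 + 2 * (sin (a s))\<^sup>2) / (k ^ 3 * cos (a s) ^ 5)) (at s within I)"
      by (rule has_field_derivative_at_within[OF gamma0_derivatives(5)[OF s]]
          has_field_derivative_at_within[OF gamma0_derivatives(6)[OF s]])+
  qed (rule L_pos gamma0_admissible gamma0_jet2)+
  show ?thesis
  proof (rule c.lagr_critI)
    fix s assume s: "s \<in> I"
    have pos: "cos (a s) > 0" by (rule a_facts(2)[OF s])
    have e1: "(p * d / (k\<^sup>2 * c ^ 3))\<^sup>2 / (p / (k * c)) ^ 4 = d\<^sup>2 / (p\<^sup>2 * c\<^sup>2)"
      and e2: "(p * d / (k ^ 3 * c ^ 5)) / (p / (k * c)) ^ 3 = d / (p\<^sup>2 * c\<^sup>2)" if "c > 0" for c d
      using that k_pos p_gt by (simp_all add: divide_simps eval_nat_numeral)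
    have "6 * (p * sin (a s) / (k\<^sup>2 * cos (a s) ^ 3))\<^sup>2 / (p / (k * cos (a s))) ^ 4
        - 2 * (p * (1 + 2 * (sin (a s))\<^sup>2) / (k ^ 3 * cos (a s) ^ 5)) / (p / (k * cos (a s))) ^ 3
        = (6 * (sin (a s))\<^sup>2 - 2 * (1 + 2 * (sin (a s))\<^sup>2)) / (p\<^sup>2 * (cos (a s))\<^sup>2)"
      unfolding times_divide_eq_right[symmetric, of 6] times_divide_eq_right[symmetric, of 2]
      unfolding e1[OF pos] e2[OF pos] by (simp only: diff_divide_distrib times_divide_eq_right)
    also have "6 * (sin (a s))\<^sup>2 - 2 * (1 + 2 * (sin (a s))\<^sup>2) = - 2 * (cos (a s))\<^sup>2"
      by (simp add: cos_squared_eq)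
    also have "- 2 * (cos (a s))\<^sup>2 / (p\<^sup>2 * (cos (a s))\<^sup>2) = - 2 / p\<^sup>2"
      using pos by simp
    also have "\<dots> = 2 * L / (L + x0) - 2"
      unfolding p_sq using x0_pos L_pos by (simp add: field_simps)
    finally show "c.g2 s = 2 * L / (L + x0) - 2" unfolding c.g2_def .
  qed (simp_all add: a_ends p_sigma)
qed

end

section \<open>Uniqueness\<close>

context unit_speed_curve
begin

lemma constant_on_I:
  assumes "\<And>s. s \<in> I \<Longrightarrow> (f has_real_derivative 0) (at s within I)" "s \<in> I" "t \<in> I"
  shows "f s = f t"
proof -
  obtain c where "\<And>s. s \<in> I \<Longrightarrow> f s = c"
    using has_field_derivative_zero_constant[of I f] assms(1) by auto
  with assms(2,3) show ?thesis by simp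
qed

text \<open>The conserved vector is compared at the two ends, where T = (1, 0). Its horizontal
  component gives equal curvature there, hence a parabola g symmetric about L; its vertical
  component relates the change of g' to the distance 2 x0 of the endpoints and so determines
  \<open>lam\<close>.\<close>

lemma curvature_of_constant_g2:
  assumes x0: "x0 > 0" and g2: "\<And>s. s \<in> I \<Longrightarrow> g2 s = lam - 2"
    and ends: "y1 0 = 0" "x1 0 = 1" "y1 (2*L) = 0" "x1 (2*L) = 1"
  obtains k where "lam = 2 * L / (L + x0)" "k > L"
    "\<And>s. s \<in> I \<Longrightarrow> 1 / (H s)\<^sup>2 = x0 / (L + x0) * (k\<^sup>2 - (s - L)\<^sup>2)"
proof -
  have O: "0 \<in> I" "2*L \<in> I" using L_pos by auto
  have \<gamma>_ends: "\<gamma> 0 = (x0, 0)" "\<gamma> (2*L) = (- x0, 0)" using adm by (auto simp: admissible_def)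
  have "((\<lambda>s. p s + lam * snd (\<gamma> s)) has_real_derivative 0) (at s within I)" if "s \<in> I" for s
    using DERIV_add[OF dp[OF that] DERIV_cmult[OF dy[OF that], of lam]] g2[OF that] by (simp add: algebra_simps)
  from constant_on_I[OF this O] have "2 / H 0 = 2 / H (2*L)"
    by (simp add: p_def ends \<gamma>_ends)
  then have H_ends: "H 0 = H (2*L)"
    by simp
  have "((\<lambda>s. q s - lam * fst (\<gamma> s)) has_real_derivative 0) (at s within I)" if "s \<in> I" for s
    using DERIV_diff[OF dq[OF that] DERIV_cmult[OF dx[OF that], of lam]] g2[OF that] by (simp add: algebra_simps)
  from constant_on_I[OF this O] have balance: "- 2 * H1 0 / H 0 ^ 3 - lam * x0 = - 2 * H1 (2*L) / H (2*L) ^ 3 + lam * x0"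
    by (simp add: q_def ends \<gamma>_ends)
  define g1 where "g1 = - 2 * H1 0 / H 0 ^ 3"
  have "((\<lambda>s. - 2 * H1 s / H s ^ 3 - (lam - 2) * s) has_real_derivative g2 s - (lam - 2)) (at s within I)"
    if "s \<in> I" for s
    by (rule DERIV_diff[OF dg1[OF that]]) (rule derivative_eq_intros refl | simp)+
  note d1 = this
  have "((\<lambda>s. - 2 * H1 s / H s ^ 3 - (lam - 2) * s) has_real_derivative 0) (at s within I)" if "s \<in> I" for s
    by (rule d1[OF that, unfolded g2[OF that] diff_self])
  note g1_const = constant_on_I[OF this _ O(1)]
  have g1: "- 2 * H1 s / H s ^ 3 = g1 + (lam - 2) * s" if "s \<in> I" for s
    using g1_const[OF _ that] unfolding g1_def by simp
  define g0 where "g0 = 1 / (H 0)\<^sup>2"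
  have "((\<lambda>s. 1 / (H s)\<^sup>2 - (g1 * s + (lam - 2) * s\<^sup>2 / 2)) has_real_derivative
      - 2 * H1 s / H s ^ 3 - (g1 + (lam - 2) * s)) (at s within I)" if "s \<in> I" for s
    by (rule DERIV_diff[OF dg[OF that]]) (rule derivative_eq_intros refl | simp)+
  note d2 = this
  have "((\<lambda>s. 1 / (H s)\<^sup>2 - (g1 * s + (lam - 2) * s\<^sup>2 / 2)) has_real_derivative 0) (at s within I)" if "s \<in> I" for s
    by (rule d2[OF that, unfolded g1[OF that] diff_self])
  note g_const = constant_on_I[OF this _ O(1)]
  have g: "1 / (H s)\<^sup>2 = g0 + g1 * s + (lam - 2) * s\<^sup>2 / 2" if "s \<in> I" for s
    using g_const[OF _ that] unfolding g0_def by simp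
  \<comment> \<open>Equal values of g at 0 and 2L place the vertex of the parabola at s = L.\<close>
  have "g1 * (2*L) + (lam - 2) * (2*L)\<^sup>2 / 2 = 0"
    using g[OF O(2)] H_ends by (simp add: g0_def)
  moreover have "(lam - 2) * (2*L)\<^sup>2 / 2 = (lam - 2) * L * (2*L)" by (simp add: power2_eq_square)
  ultimately have "(g1 + (lam - 2) * L) * (2*L) = 0" by (simp only: distrib_right)
  then have "g1 + (lam - 2) * L = 0" using L_pos by simp
  then have g1_eq: "g1 = - (lam - 2) * L" by (simp only: eq_neg_iff_add_eq_0 mult_minus_left)
  have "g1 - lam * x0 = g1 + (lam - 2) * (2*L) + lam * x0"
    using balance unfolding g1[OF O(2)] g1_def by simp
  then have lam: "lam * (L + x0) = 2 * L" by (simp add: algebra_simps)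
  then have lam_eq: "lam = 2 * L / (L + x0)" using L_pos x0 by (simp add: field_simps)
  define \<beta> where "\<beta> = x0 / (L + x0)"
  have \<beta>: "\<beta> > 0" "lam - 2 = - 2 * \<beta>" using L_pos x0 unfolding lam_eq \<beta>_def by (auto simp: field_simps)
  \<comment> \<open>k is the distance from L at which the parabola would vanish; g(0) = \<beta> (k^2
    - L^2) is positive, so k > L.\<close>
  define k where "k = sqrt (g0 / \<beta> + L\<^sup>2)"
  have "g0 > 0" using H_nz[OF O(1)] by (simp add: g0_def)
  then have "g0 / \<beta> > 0" using \<beta>(1) by simp
  then have k2: "k\<^sup>2 = g0 / \<beta> + L\<^sup>2" by (simp add: k_def)
  have "L\<^sup>2 < k\<^sup>2" using k2 \<open>g0 / \<beta> > 0\<close> by simp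
  moreover have "k \<ge> 0" using \<open>g0 / \<beta> > 0\<close> by (simp add: k_def)
  ultimately have "k > L" by (rule power2_less_imp_less)
  have "1 / (H s)\<^sup>2 = \<beta> * (k\<^sup>2 - (s - L)\<^sup>2)" if "s \<in> I" for s
  proof -
    have "\<beta> * k\<^sup>2 = g0 + \<beta> * L\<^sup>2" unfolding k2 using \<beta>(1) by (simp add: distrib_left)
    then show ?thesis
      unfolding g[OF that] g1_eq \<beta>(2) by (simp add: power2_eq_square algebra_simps)
  qed
  then show ?thesis
    unfolding \<beta>_def by (rule that[OF lam_eq \<open>k > L\<close>])
qed

text \<open>The curvature integrates to the tangent angle \<Theta> = P b up to a constant rotation,
  and a second integration gives the curve. What remains is discrete: P B must be a multiple of
  \<pi>, and simplicity of the curve selects the first one.\<close>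

lemma tangential_curve_eq_gamma0:
  assumes x0: "x0 > 0" and g2: "\<And>s. s \<in> I \<Longrightarrow> g2 s = lam - 2"
    and ends: "y1 0 = 0" "x1 0 = 1" "y1 (2*L) = 0" "x1 (2*L) = 1"
  shows "3 * x0 < L" "lam = 2 * L / (L + x0)" "\<And>s. s \<in> I \<Longrightarrow> \<gamma> s = gamma0 x0 L s"
proof -
  obtain k where lam: "lam = 2 * L / (L + x0)" and kL: "k > L"
    and H_eq: "\<And>s. s \<in> I \<Longrightarrow> 1 / (H s)\<^sup>2 = x0 / (L + x0) * (k\<^sup>2 - (s - L)\<^sup>2)"
    using curvature_of_constant_g2[OF assms] by blast
  show "lam = 2 * L / (L + x0)" by fact
  have O: "0 \<in> I" "2*L \<in> I" using L_pos by auto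
  have \<gamma>_ends: "\<gamma> 0 = (x0, 0)" "\<gamma> (2*L) = (- x0, 0)" and inj: "inj_on \<gamma> I"
    using adm by (auto simp: admissible_def)
  have k_pos: "k > 0" using kL L_pos by simp
  have less_k: "\<bar>s - L\<bar> < k" if "s \<in> I" for s using that kL by auto
  \<comment> \<open>1 / \<tau> will turn out to be the factor p of the explicit curve; it is defined
    here before 3 x0 < L is known.\<close>
  define \<tau> where "\<tau> = sqrt (x0 / (L + x0))"
  have \<tau>: "0 < \<tau>" "\<tau> < 1" "\<tau>\<^sup>2 = x0 / (L + x0)" using x0 L_pos by (auto simp: \<tau>_def)
  define P where "P = 1 / \<tau>"
  have P: "P > 1" "P\<^sup>2 * (x0 / (L + x0)) = 1" "P * \<tau> = 1"
    using \<tau> unfolding \<tau>(3)[symmetric] by (auto simp: P_def power_divide)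
  define b where "b s = arcsin ((s - L) / k)" for s
  note b_facts = arcsin_ratio[OF k_pos less_k, folded b_def]
  have H_b: "H s = P / (k * cos (b s))" if s: "s \<in> I" for s
  proof -
    have "(k * cos (b s))\<^sup>2 = P\<^sup>2 * (x0 / (L + x0)) * (k * cos (b s))\<^sup>2" unfolding P(2) by simp
    also have "\<dots> = P\<^sup>2 / (H s)\<^sup>2" using H_eq[OF s] b_facts(4)[OF s] by (simp add: divide_inverse)
    finally have "(k * cos (b s))\<^sup>2 = (P / H s)\<^sup>2" by (simp add: power_divide)
    moreover have "k * cos (b s) > 0" "P / H s > 0" using b_facts(2)[OF s] k_pos P(1) H_pos[OF s] by simp_all
    ultimately have "k * cos (b s) = P / H s"
      by (meson less_imp_le power2_eq_imp_eq)
    then show ?thesis using H_nz[OF s] P(1) by simp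
  qed
  have db: "(b has_real_derivative 1 / (k * cos (b s))) (at s within I)" if "s \<in> I" for s
    using has_field_derivative_at_within[OF b_facts(3)[OF that]] by (simp add: b_def[abs_def])
  have d\<Theta>: "((\<lambda>s. P * b s) has_real_derivative H s) (at s within I)" if "s \<in> I" for s
    using DERIV_cmult[OF db[OF that], of P] H_b[OF that] by simp
  define \<Theta> where "\<Theta> = (\<lambda>s. P * b s)"
  note d = d\<Theta>[folded \<Theta>_def]
  \<comment> \<open>The components of the tangent in the frame rotated by \<Theta> are constant
    because \<Theta> has derivative H.\<close>
  have "((\<lambda>s. x1 s * cos (\<Theta> s) + y1 s * sin (\<Theta> s)) has_real_derivative 0) (at s within I)" if "s \<in> I" for s
    by (rule derivative_eq_intros dx1[OF that] dy1[OF that] d[OF that] refl)+ (simp add: algebra_simps)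
  note c_const = constant_on_I[OF this _ O(1)]
  have "((\<lambda>s. y1 s * cos (\<Theta> s) - x1 s * sin (\<Theta> s)) has_real_derivative 0) (at s within I)" if "s \<in> I" for s
    by (rule derivative_eq_intros dx1[OF that] dy1[OF that] d[OF that] refl)+ (simp add: algebra_simps)
  note d_const = constant_on_I[OF this _ O(1)]
  define B where "B = arcsin (L / k)"
  have Lk: "0 < L / k" "L / k < 1" using kL L_pos k_pos by (auto simp: field_simps)
  have B: "0 < B" "B < pi / 2" "sin B = L / k"
    unfolding B_def using Lk arcsin_less_mono[of 0 "L / k"] arcsin_less_mono[of "L / k" 1] by auto
  have b_ends: "b 0 = - B" "b (2*L) = B"
    unfolding b_def B_def using Lk by (auto simp: arcsin_minus)
  have \<Theta>_ends: "\<Theta> 0 = - (P * B)" "\<Theta> (2*L) = P * B" by (simp_all add: \<Theta>_def b_ends)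
  \<comment> \<open>The tangent is (1, 0) at both ends, while \<Theta> takes opposite values
    there.\<close>
  have "- sin (P * B) = sin (P * B)"
    using d_const[OF _ O(2)] unfolding \<Theta>_ends ends by simp
  then have sin0: "sin (P * B) = 0" by simp
  define c where "c = cos (P * B)"
  have T: "x1 s = c * cos (\<Theta> s)" "y1 s = c * sin (\<Theta> s)" if s: "s \<in> I" for s
  proof -
    have 1: "x1 s * cos (\<Theta> s) + y1 s * sin (\<Theta> s) = c" "y1 s * cos (\<Theta> s) - x1 s * sin (\<Theta> s) = 0"
      using c_const[OF _ s] d_const[OF _ s] sin0 unfolding \<Theta>_ends ends c_def by simp_all
    have 2: "(sin (\<Theta> s))\<^sup>2 + (cos (\<Theta> s))\<^sup>2 = 1" by simp
    have 3: "y1 s * cos (\<Theta> s) = x1 s * sin (\<Theta> s)" using 1(2) by simp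
    have "c * cos (\<Theta> s) = x1 s * (cos (\<Theta> s))\<^sup>2 + (y1 s * cos (\<Theta> s)) * sin (\<Theta> s)"
      unfolding 1(1)[symmetric] by (simp add: algebra_simps power2_eq_square)
    also have "\<dots> = x1 s * ((sin (\<Theta> s))\<^sup>2 + (cos (\<Theta> s))\<^sup>2)"
      unfolding 3 by (simp only: algebra_simps power2_eq_square)
    finally show "x1 s = c * cos (\<Theta> s)" unfolding 2 by simp
    have "c * sin (\<Theta> s) = y1 s * (sin (\<Theta> s))\<^sup>2 + (x1 s * sin (\<Theta> s)) * cos (\<Theta> s)"
      unfolding 1(1)[symmetric] by (simp add: algebra_simps power2_eq_square)
    also have "\<dots> = y1 s * ((sin (\<Theta> s))\<^sup>2 + (cos (\<Theta> s))\<^sup>2)"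
      unfolding 3[symmetric] by (simp only: algebra_simps power2_eq_square)
    finally show "y1 s = c * sin (\<Theta> s)" unfolding 2 by simp
  qed
  have dxs: "((\<lambda>s. k / 2 * profile_x P (b s)) has_real_derivative cos (\<Theta> s)) (at s within I)"
    and dys: "((\<lambda>s. k / 2 * profile_y P (b s)) has_real_derivative - sin (\<Theta> s)) (at s within I)" if s: "s \<in> I" for s
    using DERIV_cmult[OF DERIV_chain2[OF DERIV_profile_x[OF P(1)] db[OF s]], of "k / 2"]
      DERIV_cmult[OF DERIV_chain2[OF DERIV_profile_y[OF P(1)] db[OF s]], of "k / 2"] b_facts(2)[OF s] k_pos
    by (simp_all add: \<Theta>_def)
  have "((\<lambda>s. fst (\<gamma> s) - c * (k / 2 * profile_x P (b s))) has_real_derivative 0) (at s within I)" if s: "s \<in> I" for s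
    using DERIV_diff[OF dx[OF s] DERIV_cmult[OF dxs[OF s], of c]] T(1)[OF s] by simp
  note x_const = constant_on_I[OF this _ O(1)]
  \<comment> \<open>\<open>profile_x\<close> is odd and the endpoints have opposite abscissas, so
    this constant equals its own negative.\<close>
  have "fst (\<gamma> 0) - c * (k / 2 * profile_x P (b 0)) = 0"
    using x_const[OF _ O(2)] unfolding b_ends \<gamma>_ends by simp
  then have x_eq: "fst (\<gamma> s) = c * (k / 2 * profile_x P (b s))" if "s \<in> I" for s
    using x_const[OF _ that] by simp
  have "((\<lambda>s. snd (\<gamma> s) + c * (k / 2 * profile_y P (b s))) has_real_derivative 0) (at s within I)" if s: "s \<in> I" for s
    using DERIV_add[OF dy[OF s] DERIV_cmult[OF dys[OF s], of c]] T(2)[OF s] by simp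
  note y_const = constant_on_I[OF this _ O(1)]
  have y_eq: "snd (\<gamma> s) = c * (k / 2 * profile_y P B) - c * (k / 2 * profile_y P (b s))" if "s \<in> I" for s
    using y_const[OF _ that] unfolding b_ends \<gamma>_ends by simp
  obtain m :: int where m: "P * B = of_int m * pi"
    using sin0 sin_zero_iff_int2 by blast
  have "P * B > 0" using P B by simp
  then have "m > 0" unfolding m by (simp add: zero_less_mult_iff)
  \<comment> \<open>For \<open>m \<ge> 2\<close> the curve crosses its axis of symmetry away from the midpoint, so it is not simple.\<close>
  have "m = 1"
  proof (rule ccontr)
    assume "m \<noteq> 1"
    with \<open>m > 0\<close> have "m \<ge> 2" by simp
    then have "of_int m * pi \<ge> 2 * pi" by simp
    then have "2 * pi \<le> P * B" using m by simp
    then have "3 * pi < 2 * (P * B)" using pi_gt_zero by linarith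
    then have "3 * pi < B * (2 * P)" by (simp only: mult_ac)
    then have 3: "3 * pi / (2 * P) < B" using P(1) by (simp add: pos_divide_less_eq)
    have 1: "pi / (2 * P) < 3 * pi / (2 * P)" using P(1) by (simp add: divide_strict_right_mono)
    have "0 < pi / (2 * P)" using P(1) by simp
    have lt: "pi / (2 * P) < pi / 2" "0 < 3 * pi / (2 * P)" "3 * pi / (2 * P) < pi / 2"
      using 1 3 B(2) \<open>0 < pi / (2 * P)\<close> by linarith+
    have c_pos: "cos (pi / (2 * P)) > 0" "cos (3 * pi / (2 * P)) > 0"
      by (rule cos_gt_zero[OF \<open>0 < pi / (2 * P)\<close> lt(1)] cos_gt_zero[OF lt(2,3)])+
    have w: "1 / (P + 1) + 1 / (P - 1) > 0" using P(1) by (intro add_pos_pos) auto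
    have "profile_x P (pi / (2 * P)) > 0"
      unfolding profile_x_quarter(1)[OF P(1)] by (rule mult_pos_pos[OF c_pos(1) w])
    moreover have "profile_x P (3 * pi / (2 * P)) < 0"
      unfolding profile_x_quarter(2)[OF P(1)] using mult_pos_pos[OF c_pos(2) w] by linarith
    \<comment> \<open>The sign change yields a parameter z > 0 on the axis of symmetry. The points
      with b = z and b = -z then coincide, having abscissa zero and equal heights.\<close>
    ultimately obtain z where z: "pi / (2 * P) \<le> z" "z \<le> 3 * pi / (2 * P)" "profile_x P z = 0"
      using IVT2[of "profile_x P" "3 * pi / (2 * P)" 0 "pi / (2 * P)"] 1 DERIV_isCont[OF DERIV_profile_x[OF P(1)]]
      by (meson less_imp_le)
    have zB: "0 < z" "z < B" using z 3 \<open>0 < pi / (2 * P)\<close> by auto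
    have "0 < sin z" using zB B by (intro sin_gt_zero) auto
    moreover have "sin z < L / k" unfolding B(3)[symmetric] using zB B by (intro sin_monotone_2pi) auto
    ultimately have ks: "0 < k * sin z" "k * sin z < L" using k_pos by (auto simp: field_simps)
    have I': "L + k * sin z \<in> I" "L - k * sin z \<in> I" using ks by auto
    have "arcsin (sin z) = z" "arcsin (- sin z) = - z"
      using zB B arcsin_sin[of z] arcsin_sin[of "- z"] by simp_all
    then have bz: "b (L + k * sin z) = z" "b (L - k * sin z) = - z"
      using k_pos by (simp_all add: b_def)
    have "\<gamma> (L + k * sin z) = \<gamma> (L - k * sin z)"
    proof (rule prod_eqI)
      show "fst (\<gamma> (L + k * sin z)) = fst (\<gamma> (L - k * sin z))"
        unfolding x_eq[OF I'(1)] x_eq[OF I'(2)] bz by (simp add: z(3))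
      show "snd (\<gamma> (L + k * sin z)) = snd (\<gamma> (L - k * sin z))"
        unfolding y_eq[OF I'(1)] y_eq[OF I'(2)] bz by simp
    qed
    then have "L + k * sin z = L - k * sin z" using inj I' by (auto dest: inj_onD)
    then show False using ks(1) by linarith
  qed
  then have PB: "P * B = pi" using m by simp
  \<comment> \<open>Exactly one turn fixes B = \<pi> \<tau>. As B is the arcsine of L / k < 1, it is
    below \<pi>/2; so \<tau> < 1/2, which is the bound on x0.\<close>
  then have B_eq: "B = pi * \<tau>" unfolding P_def using \<tau>(1) by (simp add: field_simps)
  then have "\<tau> < 1/2" using B(2) pi_gt_zero by simp
  then have "\<tau>\<^sup>2 < (1/2)\<^sup>2" using \<tau>(1) by (intro power_strict_mono) auto
  then show 3: "3 * x0 < L" unfolding \<tau>(3) using x0 L_pos by (simp add: field_simps power2_eq_square)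
  interpret g: arcsine_curve x0 L using x0 3 by unfold_locales
  have \<sigma>: "g.\<sigma> = B" unfolding g.\<sigma>_def B_eq \<tau>_def ..
  have k_eq: "g.k = k" unfolding g.k_def \<sigma> B(3) using L_pos by simp
  have p_eq: "g.p = P" unfolding g.p_def \<sigma> using PB B(1) by (simp add: field_simps)
  have c: "c = -1" by (simp add: c_def PB)
  have a_eq: "g.a s = b s" for s unfolding g.a_def k_eq b_def ..
  fix s assume s: "s \<in> I"
  have z: "k / 2 * profile_y P B + P * x0 / tan B = 0"
    using g.gamma0_height unfolding k_eq p_eq \<sigma> .
  have "fst (\<gamma> s) = - k / 2 * profile_x P (b s)" using x_eq[OF s] unfolding c by linarith
  moreover have "snd (\<gamma> s) = k / 2 * profile_y P (b s) + P * x0 / tan B"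
    using y_eq[OF s] z unfolding c by linarith
  ultimately show "\<gamma> s = gamma0 x0 L s"
    unfolding g.gamma0_eq k_eq p_eq \<sigma> a_eq by (metis prod.collapse)
qed

end

section \<open>Classification of the critical points\<close>

lemma area_crit_unique:
  assumes "x0 > 0" "L > 0" "arclength L \<gamma>" "area_crit x0 L \<gamma>"
  shows "3 * x0 < L" "\<And>s. s \<in> {0..2*L} \<Longrightarrow> \<gamma> s = gamma0 x0 L s"
    "\<And>lam. lagr_crit x0 L lam \<gamma> \<Longrightarrow> lam = 2 * L / (L + x0)"
proof -
  have "admissible x0 L \<gamma>" using assms(4) by (simp add: area_crit_def)
  then obtain x1 y1 H H1 H2 where "unit_speed_curve x0 L \<gamma> x1 y1 H H1 H2"
    by (rule unit_speed_curve_exists[OF assms(2) _ assms(3)])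
  then interpret unit_speed_curve x0 L \<gamma> x1 y1 H H1 H2 .
  obtain lam where lam: "\<And>s. s \<in> I \<Longrightarrow> g2 s = lam - 2"
    using area_crit_g2[OF assms(4)] by blast
  note T = area_crit_tangential[OF assms(4)]
  show "3 * x0 < L"
    by (rule tangential_curve_eq_gamma0(1)[OF assms(1) lam T])
  show "\<gamma> s = gamma0 x0 L s" if "s \<in> I" for s
    by (rule tangential_curve_eq_gamma0(3)[OF assms(1) lam T that])
  show "lam = 2 * L / (L + x0)" if "lagr_crit x0 L lam \<gamma>" for lam
    by (rule tangential_curve_eq_gamma0(2)[OF assms(1) lagr_crit_g2[OF that] T])
qed

text \<open>Existence is proved for the stronger notion \<open>lagr_crit\<close> and uniqueness for
  the weaker \<open>area_crit\<close>; the implication between them then serves both parts. Curves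
  are compared on \<open>{0..2*L}\<close>, their domain.\<close>

theorem mainTheorem7:
  fixes x0 L :: real
  assumes "x0 > 0" and "L > 0"
  shows "((\<exists>\<gamma>. vert_sym L \<gamma> \<and> arclength L \<gamma> \<and> area_crit x0 L \<gamma>) \<longleftrightarrow> 3 * x0 < L) \<and>
         (3 * x0 < L \<longrightarrow>
            vert_sym L (gamma0 x0 L) \<and> arclength L (gamma0 x0 L) \<and> area_crit x0 L (gamma0 x0 L) \<and>
            (\<forall>\<gamma>. vert_sym L \<gamma> \<and> arclength L \<gamma> \<and> area_crit x0 L \<gamma> \<longrightarrow>
                 (\<forall>s\<in>{0..2*L}. \<gamma> s = gamma0 x0 L s))) \<and>
         (\<forall>lam::real.
            ((\<exists>\<gamma>. vert_sym L \<gamma> \<and> arclength L \<gamma> \<and> lagr_crit x0 L lam \<gamma>) \<longleftrightarrow>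
               3 * x0 < L \<and> lam = 2 * L / (L + x0)) \<and>
            (3 * x0 < L \<and> lam = 2 * L / (L + x0) \<longrightarrow>
               vert_sym L (gamma0 x0 L) \<and> arclength L (gamma0 x0 L) \<and> lagr_crit x0 L lam (gamma0 x0 L) \<and>
               (\<forall>\<gamma>. vert_sym L \<gamma> \<and> arclength L \<gamma> \<and> lagr_crit x0 L lam \<gamma> \<longrightarrow>
                    (\<forall>s\<in>{0..2*L}. \<gamma> s = gamma0 x0 L s))))"
proof -
  have exist: "vert_sym L (gamma0 x0 L)" "arclength L (gamma0 x0 L)"
    "lagr_crit x0 L (2 * L / (L + x0)) (gamma0 x0 L)" "area_crit x0 L (gamma0 x0 L)" if "3 * x0 < L"
  proof -
    interpret arcsine_curve x0 L using assms(1) that by unfold_locales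
    show "vert_sym L (gamma0 x0 L)" "arclength L (gamma0 x0 L)"
      "lagr_crit x0 L (2 * L / (L + x0)) (gamma0 x0 L)" "area_crit x0 L (gamma0 x0 L)"
      by (rule gamma0_vert_sym gamma0_arclength gamma0_lagr_crit lagr_crit_imp_area_crit[OF gamma0_lagr_crit])+
  qed
  note unique = area_crit_unique[OF assms]
  show ?thesis
  proof (intro conjI allI iffI impI)
    assume "\<exists>\<gamma>. vert_sym L \<gamma> \<and> arclength L \<gamma> \<and> area_crit x0 L \<gamma>"
    then show "3 * x0 < L" using unique(1) by blast
  next
    assume "3 * x0 < L"
    then show "\<exists>\<gamma>. vert_sym L \<gamma> \<and> arclength L \<gamma> \<and> area_crit x0 L \<gamma>" using exist by blast
  next
    assume "3 * x0 < L"
    then show "vert_sym L (gamma0 x0 L)" "arclength L (gamma0 x0 L)" "area_crit x0 L (gamma0 x0 L)"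
      using exist by blast+
  next
    fix \<gamma> assume "vert_sym L \<gamma> \<and> arclength L \<gamma> \<and> area_crit x0 L \<gamma>"
    then show "\<forall>s\<in>{0..2*L}. \<gamma> s = gamma0 x0 L s" using unique(2) by blast
  next
    fix lam assume "\<exists>\<gamma>. vert_sym L \<gamma> \<and> arclength L \<gamma> \<and> lagr_crit x0 L lam \<gamma>"
    then obtain \<gamma> where "arclength L \<gamma>" "lagr_crit x0 L lam \<gamma>" by blast
    then show "3 * x0 < L" "lam = 2 * L / (L + x0)"
      using unique(1,3) lagr_crit_imp_area_crit by blast+
  next
    fix lam assume "3 * x0 < L \<and> lam = 2 * L / (L + x0)"
    then show "\<exists>\<gamma>. vert_sym L \<gamma> \<and> arclength L \<gamma> \<and> lagr_crit x0 L lam \<gamma>" using exist by blast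
  next
    fix lam assume "3 * x0 < L \<and> lam = 2 * L / (L + x0)"
    then show "vert_sym L (gamma0 x0 L)" "arclength L (gamma0 x0 L)" "lagr_crit x0 L lam (gamma0 x0 L)"
      using exist by blast+
  next
    fix lam \<gamma> assume "vert_sym L \<gamma> \<and> arclength L \<gamma> \<and> lagr_crit x0 L lam \<gamma>"
    then show "\<forall>s\<in>{0..2*L}. \<gamma> s = gamma0 x0 L s"
      using unique(2) lagr_crit_imp_area_crit by blast
  qed
qed

end
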